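(* Let $H_1,H_2$ be separable Hilbert spaces and $I_1,I_2$ countable index sets. Let $\mathcal{A}_1$ and $\mathcal{A}_2$ be two solid spectral matrix algebras of matrices indexed by $I_1^2$ and $I_2^2$, respectively, such that the associated spaces of rank-four tensors $\widetilde{\mathcal{A}}_1$ and $\widetilde{\mathcal{A}}_2$ (as defined in the context) are inverse-closed. Let $\Psi_1=\{\psi_{1,i}\}_{i\in I_1}$ be an $\mathcal{A}_1$-self-localised frame for $H_1$ and $\Psi_2=\{\psi_{2,k}\}_{k\in I_2}$ an $\mathcal{A}_2$-self-localised frame for $H_2$. Then the tensor product frame $\Psi_1\otimes\Psi_2=\{\psi_{1,i}\otimes\psi_{2,k}\}_{(i,k)\in I_1\times I_2}$ is an $\mathcal{A}$-self-localised frame for $H_1\otimes H_2$, where $\mathcal{A}=\widetilde{\mathcal{A}}_1\cap\widetilde{\mathcal{A}}_2$.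
   Context: A frame for a separable Hilbert space $H$ is a countable family $\{\psi_i\}_{i\in I}\subset H$ for which there are constants $A,B>0$ with $A\|f\|^2\le\sum_{i\in I}|\langle f,\psi_i\rangle|^2\le B\|f\|^2$ for all $f\in H$. A Banach algebra of matrices indexed by $I^2$ is a linear space of complex matrices $(M_{i,j})_{(i,j)\in I^2}$ with a complete submultiplicative norm that is closed under matrix multiplication; it is involutive if it is closed under the conjugate transpose and the conjugate transpose is isometric. A spectral matrix algebra is an involutive Banach algebra $\mathcal{M}$ of matrices indexed by $I^2$ such that (i) every $M\in\mathcal{M}$ defines a bounded operator on $\ell^2(I)$, and (ii) $\mathcal{M}$ is inverse-closed: if $M\in\mathcal{M}$ is invertible in $\mathcal{B}(\ell^2(I))$, then $M^{-1}\in\mathcal{M}$. It is solid if moreover $M\in\mathcal{M}$ and $|N_{i,j}|\le|M_{i,j}|$ for all $(i,j)\in I^2$ imply $N\in\mathcal{M}$ and $\|N\|_{\mathcal{M}}\le\|M\|_{\mathcal{M}}$. A family $\Psi=\{\psi_i\}_{i\in I}$ in a Hilbert space is $\mathcal{M}$-self-localised if its Gram matrix $G_\Psi=(\langle\psi_i,\psi_{i'}\rangle)_{(i,i')\in I^2}$ belongs to the spectral matrix algebra $\mathcal{M}$. The elementary tensor $f_1\otimes f_2$ of $f_1\in H_1,f_2\in H_2$ is the rank-one operator $H_1\to H_2$, $f\mapsto\langle f,f_1\rangle_{H_1}f_2$. $H_1\otimes H_2$ is the completion of the span of the elementary tensors with respect to the inner product determined by $\langle f_1\otimes f_2,g_1\otimes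 g_2\rangle=\overline{\langle f_1,g_1\rangle}_{H_1}\langle f_2,g_2\rangle_{H_2}$ (equivalently, the Hilbert–Schmidt operators $H_1\to H_2$). Let $\mathcal{T}$ be the vector space of all rank-four tensors $A=(A_{i,k,l,j})_{(i,k,l,j)\in I_1\times I_2^2\times I_1}$ with complex entries. For $A\in\mathcal{T}$ and $(i,j)\in I_1^2$ let $A|_{\{i\}\times I_2^2\times\{j\}}$ be the matrix $(A_{i,k,l,j})_{(k,l)\in I_2^2}$, and for $(k,l)\in I_2^2$ let $A|_{I_1\times\{(k,l)\}\times I_1}$ be the matrix $(A_{i,k,l,j})_{(i,j)\in I_1^2}$. Define $$\|A\|_{\widetilde{\mathcal{A}}_1} := \Big\| \big( \| A|_{\{i\}\times I_2^2\times\{j\}} \|_{\mathcal{B}(\ell^2(I_2))} \big)_{(i,j)\in I_1^2} \Big\|_{\mathcal{A}_1},\qquad \|A\|_{\widetilde{\mathcal{A}}_2} := \Big\| \big( \| A|_{I_1\times\{(k,l)\}\times I_1} \|_{\mathcal{B}(\ell^2(I_1))} \big)_{(k,l)\in I_2^2} \Big\|_{\mathcal{A}_2},$$ where $\|\cdot\|_{\mathcal{B}(\ell^2)}$ is the operator norm, and the expressions are taken to be $+\infty$ if some restricted matrix does not define a bounded operator or if the resulting matrix of norms does not lie in $\mathcal{A}_1$ (resp. $\mathcal{A}_2$). Set $\widetilde{\mathcal{A}}_n := \{A\in\mathcal{T} : \|A\|_{\widetilde{\mathcal{A}}_n}<\infty\}$, and $\mathcal{A}=\widetilde{\mathcal{A}}_1\cap\widetilde{\mathcal{A}}_2$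 with norm $\|A\|_{\mathcal{A}}=\max\{\|A\|_{\widetilde{\mathcal{A}}_1},\|A\|_{\widetilde{\mathcal{A}}_2}\}$, multiplication $(A:B)_{i,k,l,j} := \sum_{n\in I_2}\sum_{m\in I_1} A_{i,k,n,m}B_{m,n,l,j}$ and involution $(A^* )_{i,k,l,j} := \overline{A_{j,l,k,i}}$. A tensor $A$ acts on sequences $c$ on $I_1\times I_2$ by $(Ac)_{i,k}=\sum_{m\in I_1}\sum_{n\in I_2}A_{i,k,n,m}c_{m,n}$. A set $\mathcal{X}$ of tensors defining bounded operators on $\ell^2(I_1\times I_2)$ is inverse-closed if, whenever $A\in\mathcal{X}$ is invertible in $\mathcal{B}(\ell^2(I_1\times I_2))$, the tensor representing $A^{-1}$ belongs to $\mathcal{X}$. The Gram tensor of a family $\Omega=\{\Omega_{i,k}\}_{(i,k)\in I_1\times I_2}\subset H_1\otimes H_2$ is $G_\Omega=(\langle\Omega_{i,k},\Omega_{j,l}\rangle_{H_1\otimes H_2})_{(i,k,l,j)\in I_1\times I_2^2\times I_1}$. The family $\Omega$ is $\mathcal{A}$-self-localised if $G_\Omega$ belongs to $\mathcal{A}$, $\mathcal{A}$ being an involutive inverse-closed Banach algebra of tensors that define bounded operators on $\ell^2(I_1\times I_2)$. *)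

theory Defs
  imports "HOL-Analysis.Analysis"
begin

section \<open>Complex Hilbert spaces\<close>

text \<open>The inner product is linear in the first argument.\<close>

class chilbert_space = banach +
  fixes scaleC :: "complex \<Rightarrow> 'a \<Rightarrow> 'a" (infixr "*\<^sub>C" 75)
    and cinner :: "'a \<Rightarrow> 'a \<Rightarrow> complex"
  assumes scaleR_scaleC: "r *\<^sub>R x = of_real r *\<^sub>C x"
    and scaleC_add_right: "a *\<^sub>C (x + y) = a *\<^sub>C x + a *\<^sub>C y"
    and scaleC_add_left: "(a + b) *\<^sub>C x = a *\<^sub>C x + b *\<^sub>C x"
    and scaleC_scaleC [simp]: "a *\<^sub>C (b *\<^sub>C x) = (a * b) *\<^sub>C x"
    and cinner_commute: "cinner x y = cnj (cinner y x)"
    and cinner_add_left: "cinner (x + y) z = cinner x z + cinner y z"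
    and cinner_scaleC_left [simp]: "cinner (a *\<^sub>C x) y = a * cinner x y"
    and norm_eq_sqrt_cinner: "norm x = sqrt (Re (cinner x x))"

lemma scaleC_one [simp]: "1 *\<^sub>C x = (x :: 'a::chilbert_space)"
  using scaleR_scaleC[of 1 x] by simp

lemma scaleC_zero_left [simp]: "0 *\<^sub>C x = (0 :: 'a::chilbert_space)"
  using scaleR_scaleC[of 0 x] by simp

lemma scaleC_zero_right [simp]: "a *\<^sub>C 0 = (0 :: 'a::chilbert_space)"
  using scaleC_add_right[of a 0 0] by simp

lemma scaleC_minus_left: "(- a) *\<^sub>C x = - (a *\<^sub>C (x :: 'a::chilbert_space))"
  using scaleC_add_left[of a "- a" x] by (simp add: minus_unique)

lemma scaleC_minus_right: "a *\<^sub>C (- x) = - (a *\<^sub>C (x :: 'a::chilbert_space))"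
  using scaleC_add_right[of a x "- x"] by (simp add: minus_unique)

lemma cinner_zero_left [simp]: "cinner 0 (x :: 'a::chilbert_space) = 0"
  using cinner_add_left[of 0 0 x] by simp

lemma cinner_zero_right [simp]: "cinner (x :: 'a::chilbert_space) 0 = 0"
  by (subst cinner_commute) simp

lemma cinner_add_right: "cinner (x :: 'a::chilbert_space) (y + z) = cinner x y + cinner x z"
  by (metis cinner_add_left cinner_commute complex_cnj_add)

lemma cinner_scaleC_right [simp]: "cinner (x :: 'a::chilbert_space) (a *\<^sub>C y) = cnj a * cinner x y"
  by (metis cinner_scaleC_left cinner_commute complex_cnj_mult)

lemma cinner_minus_left [simp]: "cinner (- x) (y :: 'a::chilbert_space) = - cinner x y"
  using cinner_add_left[of x "- x" y] by (simp add: minus_unique)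

lemma cinner_minus_right [simp]: "cinner (x :: 'a::chilbert_space) (- y) = - cinner x y"
  using cinner_add_right[of x y "- y"] by (simp add: minus_unique)

lemma cinner_diff_left: "cinner (x - y) (z :: 'a::chilbert_space) = cinner x z - cinner y z"
  using cinner_add_left[of x "- y" z] by simp

lemma cinner_diff_right: "cinner (z :: 'a::chilbert_space) (x - y) = cinner z x - cinner z y"
  using cinner_add_right[of z x "- y"] by simp

lemma cinner_sum_left: "cinner (\<Sum>i\<in>S. f i) (y :: 'a::chilbert_space) = (\<Sum>i\<in>S. cinner (f i) y)"
  by (induction S rule: infinite_finite_induct) (auto simp: cinner_add_left)

lemma cinner_sum_right: "cinner (y :: 'a::chilbert_space) (\<Sum>i\<in>S. f i) = (\<Sum>i\<in>S. cinner y (f i))"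
  by (induction S rule: infinite_finite_induct) (auto simp: cinner_add_right)

lemma cinner_self: "cinner x x = of_real ((norm (x :: 'a::chilbert_space))\<^sup>2)"
proof -
  have "Im (cinner x x) = 0"
    using cinner_commute[of x x] by (metis Reals_cnj_iff complex_is_Real_iff)
  moreover have "Re (cinner x x) \<ge> 0"
    using norm_eq_sqrt_cinner[of x] norm_ge_zero[of x] by simp
  ultimately show ?thesis
    by (simp add: norm_eq_sqrt_cinner complex_eq_iff)
qed

lemma cinner_eq_zero_iff [simp]: "cinner x x = 0 \<longleftrightarrow> (x :: 'a::chilbert_space) = 0"
  by (simp add: cinner_self)

lemma norm_scaleC [simp]: "norm (a *\<^sub>C (x :: 'a::chilbert_space)) = cmod a * norm x"
proof -
  have "complex_of_real ((norm (a *\<^sub>C x))\<^sup>2) = of_real ((cmod a * norm x)\<^sup>2)"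
    unfolding cinner_self[symmetric] power_mult_distrib of_real_mult complex_norm_square
    by simp
  hence "(norm (a *\<^sub>C x))\<^sup>2 = (cmod a * norm x)\<^sup>2"
    by (simp only: of_real_eq_iff)
  thus ?thesis
    by (simp add: power2_eq_iff_nonneg)
qed

lemma norm_diff_sq_cinner:
  "(norm (x - y :: 'a::chilbert_space))\<^sup>2 = (norm x)\<^sup>2 - 2 * Re (cinner x y) + (norm y)\<^sup>2"
proof -
  have "complex_of_real ((norm (x - y))\<^sup>2) =
    of_real ((norm x)\<^sup>2) - (cinner x y + cnj (cinner x y)) + of_real ((norm y)\<^sup>2)"
    unfolding cinner_self[symmetric] cinner_commute[of y x, symmetric]
    by (simp add: cinner_diff_left cinner_diff_right)
  also have "\<dots> = of_real ((norm x)\<^sup>2 - 2 * Re (cinner x y) + (norm y)\<^sup>2)"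
    by (simp add: complex_add_cnj)
  finally show ?thesis
    by (simp only: of_real_eq_iff)
qed

lemma cinner_Cauchy_Schwarz: "cmod (cinner x y) \<le> norm x * norm (y :: 'a::chilbert_space)"
proof (cases "y = 0")
  case False
  define c where "c = cinner x y / of_real ((norm y)\<^sup>2)"
  have n: "(norm y)\<^sup>2 > 0" using False by simp
  have re: "Re (cinner x (c *\<^sub>C y)) = (cmod (cinner x y))\<^sup>2 / (norm y)\<^sup>2"
  proof -
    have "cinner x (c *\<^sub>C y) = of_real ((cmod (cinner x y))\<^sup>2 / (norm y)\<^sup>2)"
      by (simp add: c_def complex_norm_square mult_ac del: of_real_power)
    thus ?thesis by simp
  qed
  have "0 \<le> (norm (x - c *\<^sub>C y))\<^sup>2" by simp
  also have "\<dots> = (norm x)\<^sup>2 - 2 * ((cmod (cinner x y))\<^sup>2 / (norm y)\<^sup>2) + (cmod c * norm y)\<^sup>2"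
    by (simp add: norm_diff_sq_cinner re del: cinner_scaleC_right)
  also have "(cmod c * norm y)\<^sup>2 = (cmod (cinner x y))\<^sup>2 / (norm y)\<^sup>2"
    using False by (simp add: c_def norm_divide norm_power power_mult_distrib power_divide norm_mult power2_eq_square)
  finally have "(cmod (cinner x y))\<^sup>2 \<le> (norm x * norm y)\<^sup>2"
    using n by (simp add: field_simps power_mult_distrib)
  thus ?thesis
    by (rule power2_le_imp_le) simp
qed simp

lemma bounded_linear_cinner_left: "bounded_linear (\<lambda>x. cinner x (y :: 'a::chilbert_space))"
  by (rule bounded_linear_intro[where K = "norm y"])
     (auto simp: cinner_add_left scaleR_scaleC scaleR_conv_of_real cinner_Cauchy_Schwarz)

lemma bounded_linear_scaleC_right: "bounded_linear (\<lambda>x :: 'a::chilbert_space. a *\<^sub>C x)"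
  by (rule bounded_linear_intro[where K = "cmod a"])
     (auto simp: scaleC_add_right scaleR_scaleC mult_ac)


section \<open>Orthonormal bases\<close>

definition orthonormal :: "'a::chilbert_space set \<Rightarrow> bool" where
  "orthonormal S \<longleftrightarrow> (\<forall>x\<in>S. \<forall>y\<in>S. cinner x y = (if x = y then 1 else 0))"

definition is_onb :: "'a::chilbert_space set \<Rightarrow> bool" where
  "is_onb S \<longleftrightarrow> orthonormal S \<and> (\<forall>x. (\<forall>e\<in>S. cinner x e = 0) \<longrightarrow> x = 0)"

definition some_onb :: "'a::chilbert_space set" where
  "some_onb = (SOME S. is_onb S)"

lemma ex_onb: "\<exists>S :: 'a::chilbert_space set. is_onb S"
proof -
  have "\<exists>M\<in>{S :: 'a set. orthonormal S}. \<forall>X\<in>{S. orthonormal S}. M \<subseteq> X \<longrightarrow> X = M"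
  proof (rule subset_Zorn')
    fix C :: "'a set set" assume C: "subset.chain {S. orthonormal S} C"
    have "cinner x y = (if x = y then 1 else 0)" if "x \<in> \<Union>C" "y \<in> \<Union>C" for x y
    proof -
      from that obtain A B where AB: "x \<in> A" "y \<in> B" "A \<in> C" "B \<in> C" by blast
      have "A \<subseteq> B \<or> B \<subseteq> A" using C AB by (auto simp: subset.chain_def)
      hence "\<exists>D\<in>C. x \<in> D \<and> y \<in> D" using AB by blast
      thus ?thesis using C by (auto simp: subset.chain_def orthonormal_def)
    qed
    thus "\<Union>C \<in> {S. orthonormal S}" by (simp add: orthonormal_def)
  qed
  then obtain M :: "'a set" where M: "orthonormal M"
    and max: "\<And>X. orthonormal X \<Longrightarrow> M \<subseteq> X \<Longrightarrow> X = M" by blast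
  have "x = 0" if x: "\<And>e. e \<in> M \<Longrightarrow> cinner x e = 0" for x
  proof (rule ccontr)
    assume "x \<noteq> 0"
    define u where "u = of_real (inverse (norm x)) *\<^sub>C x"
    have uu: "cinner u u = 1"
      using \<open>x \<noteq> 0\<close> by (simp add: u_def cinner_self power2_eq_square norm_inverse)
    have ue: "cinner u e = 0" "cinner e u = 0" if "e \<in> M" for e
      using x[OF that] cinner_commute[of e u] by (simp_all add: u_def)
    have "orthonormal (insert u M)"
      using M uu ue unfolding orthonormal_def by auto
    hence "u \<in> M" using max by blast
    thus False using ue uu by simp
  qed
  with M show ?thesis unfolding is_onb_def by blast
qed

lemma some_onb: "is_onb some_onb"
  unfolding some_onb_def by (rule someI_ex) (rule ex_onb)

lemma orthonormal_some_onb: "orthonormal some_onb"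
  using some_onb unfolding is_onb_def by blast

lemma cinner_sum_orthonormal:
  assumes "orthonormal S" "F \<subseteq> S" "finite F" "e \<in> S"
  shows "cinner (\<Sum>e\<in>F. a e *\<^sub>C e) e = (if e \<in> F then a e else 0)"
proof -
  have "cinner (\<Sum>e\<in>F. a e *\<^sub>C e) e = (\<Sum>f\<in>F. if f = e then a e else 0)"
    unfolding cinner_sum_left
    by (rule sum.cong) (use assms in \<open>auto simp: orthonormal_def\<close>)
  thus ?thesis using assms by simp
qed

lemma norm_sum_orthonormal:
  assumes "orthonormal S" "F \<subseteq> S" "finite F"
  shows "(norm (\<Sum>e\<in>F. a e *\<^sub>C e))\<^sup>2 = (\<Sum>e\<in>F. (cmod (a e))\<^sup>2)"
proof -
  have "complex_of_real ((norm (\<Sum>e\<in>F. a e *\<^sub>C e))\<^sup>2) = (\<Sum>e\<in>F. cnj (a e) * cinner (\<Sum>e\<in>F. a e *\<^sub>C e) e)"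
    unfolding cinner_self[symmetric] by (simp add: cinner_sum_right)
  also have "\<dots> = (\<Sum>e\<in>F. cnj (a e) * a e)"
    by (rule sum.cong) (use assms in \<open>auto simp: cinner_sum_orthonormal subset_iff\<close>)
  also have "\<dots> = of_real (\<Sum>e\<in>F. (cmod (a e))\<^sup>2)"
    by (simp add: complex_norm_square mult_ac del: of_real_power)
  finally show ?thesis by (simp only: of_real_eq_iff)
qed

lemma Bessel:
  assumes "orthonormal S" "F \<subseteq> S" "finite F"
  shows "(\<Sum>e\<in>F. (cmod (cinner x e))\<^sup>2) \<le> (norm x)\<^sup>2"
proof -
  define s where "s = (\<Sum>e\<in>F. cinner x e *\<^sub>C e)"
  define t where "t = (\<Sum>e\<in>F. (cmod (cinner x e))\<^sup>2)"
  have "cinner x s = of_real t"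
    by (simp add: s_def t_def cinner_sum_right complex_norm_square mult_ac del: of_real_power)
  moreover have "(norm s)\<^sup>2 = t"
    unfolding s_def t_def by (rule norm_sum_orthonormal[OF assms])
  ultimately have "(norm (x - s))\<^sup>2 = (norm x)\<^sup>2 - t"
    by (simp add: norm_diff_sq_cinner)
  thus ?thesis
    unfolding t_def using zero_le_power2[of "norm (x - s)"] by linarith
qed

lemma Bessel_summable:
  assumes "orthonormal S"
  shows "(\<lambda>e. (cmod (cinner x e))\<^sup>2) summable_on S"
  by (rule nonneg_bdd_above_summable_on)
     (use Bessel[OF assms] in \<open>auto intro!: bdd_aboveI2[where M = "(norm x)\<^sup>2"]\<close>)

lemma orthogonal_series_summable:
  assumes S: "orthonormal S" and a: "(\<lambda>e. (cmod (a e))\<^sup>2) summable_on S"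
  shows "(\<lambda>e. a e *\<^sub>C e) summable_on S"
proof -
  let ?s = "sum (\<lambda>e. a e *\<^sub>C e)" and ?b = "\<lambda>e. (cmod (a e))\<^sup>2"
  have "cauchy_filter (filtermap ?s (finite_subsets_at_top S))"
    unfolding cauchy_filter_metric_filtermap
  proof (intro allI impI)
    fix \<epsilon> :: real assume \<epsilon>: "\<epsilon> > 0"
    have "(sum ?b \<longlongrightarrow> infsum ?b S) (finite_subsets_at_top S)"
      using a by (rule infsum_tendsto)
    hence "\<forall>\<^sub>F F in finite_subsets_at_top S. dist (sum ?b F) (infsum ?b S) < \<epsilon>\<^sup>2 / 2"
      using \<epsilon> by (intro tendstoD) auto
    moreover have "\<forall>\<^sub>F F in finite_subsets_at_top S. finite F \<and> F \<subseteq> S"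
      by (rule eventually_finite_subsets_at_top_weakI) simp
    ultimately have ev: "\<forall>\<^sub>F F in finite_subsets_at_top S.
        dist (sum ?b F) (infsum ?b S) < \<epsilon>\<^sup>2 / 2 \<and> finite F \<and> F \<subseteq> S"
      by eventually_elim auto
    have "dist (?s F) (?s G) < \<epsilon>"
      if F: "dist (sum ?b F) (infsum ?b S) < \<epsilon>\<^sup>2 / 2" "finite F" "F \<subseteq> S"
        and G: "dist (sum ?b G) (infsum ?b S) < \<epsilon>\<^sup>2 / 2" "finite G" "G \<subseteq> S" for F G
    proof -
      define c where "c e = (if e \<in> F then a e else - a e)" for e
      let ?D = "(F - G) \<union> (G - F)"
      have "?s F = ?s (F \<inter> G) + ?s (F - G)"
        using F(2) by (subst sum.union_disjoint[symmetric]) (auto intro!: sum.cong)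
      moreover have "?s G = ?s (F \<inter> G) + ?s (G - F)"
        using G(2) by (subst sum.union_disjoint[symmetric]) (auto intro!: sum.cong)
      moreover have "(\<Sum>e\<in>?D. c e *\<^sub>C e) = ?s (F - G) - ?s (G - F)"
        using F(2) G(2) by (subst sum.union_disjoint)
           (auto simp: c_def scaleC_minus_left simp flip: sum_negf intro!: arg_cong2[where f = "(+)"] sum.cong)
      ultimately have "(norm (?s F - ?s G))\<^sup>2 = (norm (\<Sum>e\<in>?D. c e *\<^sub>C e))\<^sup>2"
        by simp
      also have "\<dots> = (\<Sum>e\<in>?D. (cmod (c e))\<^sup>2)"
        using F G by (intro norm_sum_orthonormal[OF S]) auto
      also have "\<dots> = sum ?b (F - G) + sum ?b (G - F)"
        using F(2) G(2) by (subst sum.union_disjoint)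
           (auto simp: c_def intro!: arg_cong2[where f = "(+)"] sum.cong)
      also have "sum ?b (F - G) = sum ?b (F \<union> G) - sum ?b G"
        using F(2) G(2) sum.union_disjoint[of "F - G" G ?b] by (simp add: Un_commute Int_commute)
      also have "sum ?b (G - F) = sum ?b (F \<union> G) - sum ?b F"
        using F(2) G(2) sum.union_disjoint[of "G - F" F ?b] by (simp add: Un_commute Int_commute)
      also have "sum ?b (F \<union> G) \<le> infsum ?b S"
        using F G by (intro finite_sum_le_infsum[OF a]) auto
      finally have "(norm (?s F - ?s G))\<^sup>2 < \<epsilon>\<^sup>2"
        using F(1) G(1) unfolding dist_real_def by linarith
      thus ?thesis
        unfolding dist_norm using \<epsilon> by (simp add: power2_less_imp_less)
    qed
    with ev show "\<exists>P. eventually P (finite_subsets_at_top S) \<and> (\<forall>x y. P x \<and> P y \<longrightarrow> dist (?s x) (?s y) < \<epsilon>)"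
      by (intro exI[of _ "\<lambda>F. dist (sum ?b F) (infsum ?b S) < \<epsilon>\<^sup>2 / 2 \<and> finite F \<and> F \<subseteq> S"]) blast
  qed
  hence "convergent_filter (filtermap ?s (finite_subsets_at_top S))"
    by (rule cauchy_filter_convergent)
  thus ?thesis
    unfolding convergent_filter_iff summable_on_def has_sum_def filterlim_def by auto
qed

lemma onb_expansion:
  assumes "is_onb S"
  shows "((\<lambda>e. cinner x e *\<^sub>C e) has_sum x) S"
proof -
  have S: "orthonormal S" using assms by (simp add: is_onb_def)
  have sm: "(\<lambda>e. cinner x e *\<^sub>C e) summable_on S"
    by (intro orthogonal_series_summable Bessel_summable S)
  define y where "y = (\<Sum>\<^sub>\<infinity>e\<in>S. cinner x e *\<^sub>C e)"
  have hy: "((\<lambda>e. cinner x e *\<^sub>C e) has_sum y) S"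
    unfolding y_def using sm by simp
  have "cinner (x - y) e = 0" if e: "e \<in> S" for e
  proof -
    have "((\<lambda>f. cinner (cinner x f *\<^sub>C f) e) has_sum cinner y e) S"
      by (rule has_sum_bounded_linear[OF bounded_linear_cinner_left hy])
    moreover have "((\<lambda>f. cinner (cinner x f *\<^sub>C f) e) has_sum cinner x e) S"
      using e S by (intro has_sum_finite_neutralI[where B = "{e}"]) (auto simp: orthonormal_def)
    ultimately have "cinner y e = cinner x e"
      by (rule has_sum_unique)
    thus ?thesis by (simp add: cinner_diff_left)
  qed
  hence "x - y = 0" using assms unfolding is_onb_def by blast
  with hy show ?thesis by simp
qed

lemma Parseval:
  assumes "is_onb S"
  shows "((\<lambda>e. cinner x e * cnj (cinner y e)) has_sum cinner x y) S"
  using has_sum_bounded_linear[OF bounded_linear_cinner_left onb_expansion[OF assms, of x], of y]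
  by (simp flip: cinner_commute)


section \<open>Hilbert-Schmidt operators and the Hilbert space tensor product\<close>

text \<open>
  The Hilbert-Schmidt inner product \<open>\<Sum>\<^sub>e \<langle>S e, T e\<rangle>\<close> and the class of Hilbert-Schmidt operators do
  not depend on the orthonormal basis. The lemmas \<open>cinner_elementary_tensor\<close> and
  \<open>elementary_tensors_dense\<close> below determine the resulting space: it is the completion of the span
  of the rank-one operators with respect to the inner product of elementary tensors.
\<close>

definition hilbert_schmidt :: "('a::chilbert_space \<Rightarrow> 'b::chilbert_space) \<Rightarrow> bool" where
  "hilbert_schmidt T \<longleftrightarrow> bounded_linear T \<and> (\<forall>c x. T (c *\<^sub>C x) = c *\<^sub>C T x) \<and>
     (\<lambda>e. (norm (T e))\<^sup>2) summable_on some_onb"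

lemma l2_triangle:
  fixes f g h :: "'x \<Rightarrow> real"
  assumes f: "(\<lambda>x. (f x)\<^sup>2) summable_on A" and g: "(\<lambda>x. (g x)\<^sup>2) summable_on A"
    and h: "\<And>x. x \<in> A \<Longrightarrow> 0 \<le> h x" "\<And>x. x \<in> A \<Longrightarrow> h x \<le> f x + g x"
  shows "(\<lambda>x. (h x)\<^sup>2) summable_on A"
    and "sqrt (\<Sum>\<^sub>\<infinity>x\<in>A. (h x)\<^sup>2) \<le> sqrt (\<Sum>\<^sub>\<infinity>x\<in>A. (f x)\<^sup>2) + sqrt (\<Sum>\<^sub>\<infinity>x\<in>A. (g x)\<^sup>2)"
proof -
  define C where "C = sqrt (\<Sum>\<^sub>\<infinity>x\<in>A. (f x)\<^sup>2) + sqrt (\<Sum>\<^sub>\<infinity>x\<in>A. (g x)\<^sup>2)"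
  have C0: "C \<ge> 0" unfolding C_def by (intro add_nonneg_nonneg real_sqrt_ge_zero infsum_nonneg) auto
  have fin: "(\<Sum>x\<in>F. (h x)\<^sup>2) \<le> C\<^sup>2" if F: "finite F" "F \<subseteq> A" for F
  proof -
    have "L2_set h F \<le> L2_set (\<lambda>x. f x + g x) F"
      using h F by (intro L2_set_mono) auto
    also have "\<dots> \<le> L2_set f F + L2_set g F" by (rule L2_set_triangle_ineq)
    also have "\<dots> \<le> C"
      unfolding C_def L2_set_def
      using F by (intro add_mono real_sqrt_le_mono finite_sum_le_infsum f g) auto
    finally have "(L2_set h F)\<^sup>2 \<le> C\<^sup>2"
      by (intro power_mono) auto
    thus ?thesis by (simp add: L2_set_def sum_nonneg)
  qed
  show sm: "(\<lambda>x. (h x)\<^sup>2) summable_on A"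
    by (rule nonneg_bdd_above_summable_on) (use fin in \<open>auto intro!: bdd_aboveI2\<close>)
  have "(\<Sum>\<^sub>\<infinity>x\<in>A. (h x)\<^sup>2) \<le> C\<^sup>2"
    by (rule infsum_le_finite_sums[OF sm fin])
  hence "sqrt (\<Sum>\<^sub>\<infinity>x\<in>A. (h x)\<^sup>2) \<le> sqrt (C\<^sup>2)" by (rule real_sqrt_le_mono)
  thus "sqrt (\<Sum>\<^sub>\<infinity>x\<in>A. (h x)\<^sup>2) \<le> sqrt (\<Sum>\<^sub>\<infinity>x\<in>A. (f x)\<^sup>2) + sqrt (\<Sum>\<^sub>\<infinity>x\<in>A. (g x)\<^sup>2)"
    using C0 unfolding C_def by simp
qed

lemma hilbert_schmidt_add:
  assumes "hilbert_schmidt S" "hilbert_schmidt T"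
  shows "hilbert_schmidt (\<lambda>x. S x + T x)"
  unfolding hilbert_schmidt_def
proof (intro conjI)
  show "(\<lambda>e. (norm (S e + T e))\<^sup>2) summable_on some_onb"
    by (rule l2_triangle(1)[where f = "\<lambda>e. norm (S e)" and g = "\<lambda>e. norm (T e)"])
       (use assms in \<open>auto simp: hilbert_schmidt_def norm_triangle_ineq\<close>)
qed (use assms in \<open>auto simp: hilbert_schmidt_def scaleC_add_right intro: bounded_linear_add\<close>)

lemma hilbert_schmidt_scaleC:
  assumes "hilbert_schmidt T"
  shows "hilbert_schmidt (\<lambda>x. c *\<^sub>C T x)"
  using assms bounded_linear_compose[OF bounded_linear_scaleC_right[of c], of T]
  by (auto simp: hilbert_schmidt_def power_mult_distrib mult_ac intro: summable_on_cmult_right)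

lemma hilbert_schmidt_minus: "hilbert_schmidt T \<Longrightarrow> hilbert_schmidt (\<lambda>x. - T x)"
  using hilbert_schmidt_scaleC[of T "-1"] by (simp add: scaleC_minus_left)

lemma hilbert_schmidt_diff:
  "hilbert_schmidt S \<Longrightarrow> hilbert_schmidt T \<Longrightarrow> hilbert_schmidt (\<lambda>x. S x - T x)"
  using hilbert_schmidt_add[of S "\<lambda>x. - T x"] hilbert_schmidt_minus[of T] by simp

lemma hilbert_schmidt_scaleR: "hilbert_schmidt T \<Longrightarrow> hilbert_schmidt (\<lambda>x. r *\<^sub>R T x)"
  unfolding scaleR_scaleC by (rule hilbert_schmidt_scaleC)

lemma hilbert_schmidt_zero: "hilbert_schmidt (\<lambda>x. 0)"
  by (simp add: hilbert_schmidt_def)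

lemma hilbert_schmidt_bound:
  assumes "hilbert_schmidt T"
  shows "norm (T x) \<le> sqrt (\<Sum>\<^sub>\<infinity>e\<in>some_onb. (norm (T e))\<^sup>2) * norm x"
proof -
  have T: "bounded_linear T" "\<And>c x. T (c *\<^sub>C x) = c *\<^sub>C T x"
      "(\<lambda>e. (norm (T e))\<^sup>2) summable_on some_onb"
    using assms by (auto simp: hilbert_schmidt_def)
  have "((\<lambda>e. T (cinner x e *\<^sub>C e)) has_sum T x) some_onb"
    by (rule has_sum_bounded_linear[OF T(1) onb_expansion[OF some_onb]])
  hence "((\<lambda>F. norm (\<Sum>e\<in>F. cinner x e *\<^sub>C T e)) \<longlongrightarrow> norm (T x)) (finite_subsets_at_top some_onb)"
    unfolding has_sum_def T(2) by (rule tendsto_norm)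
  moreover have "norm (\<Sum>e\<in>F. cinner x e *\<^sub>C T e) \<le>
      sqrt (\<Sum>\<^sub>\<infinity>e\<in>some_onb. (norm (T e))\<^sup>2) * norm x"
    if F: "finite F" "F \<subseteq> some_onb" for F
  proof -
    have "norm (\<Sum>e\<in>F. cinner x e *\<^sub>C T e) \<le> (\<Sum>e\<in>F. \<bar>norm (T e)\<bar> * \<bar>cmod (cinner x e)\<bar>)"
      by (rule order_trans[OF norm_sum]) (simp add: mult_ac)
    also have "\<dots> \<le> L2_set (\<lambda>e. norm (T e)) F * L2_set (\<lambda>e. cmod (cinner x e)) F"
      by (rule L2_set_mult_ineq)
    also have "\<dots> \<le> sqrt (\<Sum>\<^sub>\<infinity>e\<in>some_onb. (norm (T e))\<^sup>2) * sqrt ((norm x)\<^sup>2)"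
      unfolding L2_set_def
      using F by (intro mult_mono real_sqrt_le_mono finite_sum_le_infsum T(3)
        Bessel[OF orthonormal_some_onb] real_sqrt_ge_zero infsum_nonneg sum_nonneg) auto
    finally show ?thesis by simp
  qed
  ultimately show ?thesis
    by (intro tendsto_upperbound[where F = "finite_subsets_at_top some_onb"])
       (auto intro!: eventually_finite_subsets_at_top_weakI)
qed

typedef (overloaded) ('a::chilbert_space, 'b::chilbert_space) hs =
  "{T :: 'a \<Rightarrow> 'b. hilbert_schmidt T}"
  morphisms hs_apply Abs_hs
  using hilbert_schmidt_zero by blast

setup_lifting type_definition_hs

lemma hilbert_schmidt_hs_apply: "hilbert_schmidt (hs_apply T)"
  using hs_apply by blast

lemma hs_eqI: "(\<And>x. hs_apply S x = hs_apply T x) \<Longrightarrow> S = T"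
  by transfer auto

instantiation hs :: (chilbert_space, chilbert_space) real_normed_vector
begin

lift_definition zero_hs :: "('a, 'b) hs" is "\<lambda>_. 0"
  by (rule hilbert_schmidt_zero)

lift_definition plus_hs :: "('a, 'b) hs \<Rightarrow> ('a, 'b) hs \<Rightarrow> ('a, 'b) hs" is "\<lambda>S T x. S x + T x"
  by (rule hilbert_schmidt_add)

lift_definition minus_hs :: "('a, 'b) hs \<Rightarrow> ('a, 'b) hs \<Rightarrow> ('a, 'b) hs" is "\<lambda>S T x. S x - T x"
  by (rule hilbert_schmidt_diff)

lift_definition uminus_hs :: "('a, 'b) hs \<Rightarrow> ('a, 'b) hs" is "\<lambda>T x. - T x"
  by (rule hilbert_schmidt_minus)

lift_definition scaleR_hs :: "real \<Rightarrow> ('a, 'b) hs \<Rightarrow> ('a, 'b) hs" is "\<lambda>r T x. r *\<^sub>R T x"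
  by (rule hilbert_schmidt_scaleR)

lift_definition norm_hs :: "('a, 'b) hs \<Rightarrow> real" is
  "\<lambda>T. sqrt (\<Sum>\<^sub>\<infinity>e\<in>some_onb. (norm (T e))\<^sup>2)" .

definition dist_hs :: "('a, 'b) hs \<Rightarrow> ('a, 'b) hs \<Rightarrow> real" where
  "dist_hs S T = norm (S - T)"

definition sgn_hs :: "('a, 'b) hs \<Rightarrow> ('a, 'b) hs" where
  "sgn_hs T = inverse (norm T) *\<^sub>R T"

definition uniformity_hs :: "(('a, 'b) hs \<times> ('a, 'b) hs) filter" where
  "uniformity_hs = (INF e\<in>{0 <..}. principal {(S, T). dist S T < e})"

definition open_hs :: "('a, 'b) hs set \<Rightarrow> bool" where
  "open_hs U = (\<forall>S\<in>U. \<forall>\<^sub>F (S', T) in uniformity. S' = S \<longrightarrow> T \<in> U)"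

instance
proof
  fix S T U :: "('a, 'b) hs" and a b :: real
  show "dist S T = norm (S - T)" by (rule dist_hs_def)
  show "sgn T = inverse (norm T) *\<^sub>R T" by (rule sgn_hs_def)
  show "(uniformity :: (('a, 'b) hs \<times> ('a, 'b) hs) filter) =
      (INF e\<in>{0 <..}. principal {(S, T). dist S T < e})"
    by (rule uniformity_hs_def)
  show "open V = (\<forall>S\<in>V. \<forall>\<^sub>F (S', T) in uniformity. S' = S \<longrightarrow> T \<in> V)" for V :: "('a, 'b) hs set"
    by (rule open_hs_def)
  show "S + T + U = S + (T + U)" "S + T = T + S" "0 + S = S" "- S + S = 0" "S - T = S + - T"
    by (transfer; simp add: fun_eq_iff algebra_simps)+
  show "a *\<^sub>R (S + T) = a *\<^sub>R S + a *\<^sub>R T" "(a + b) *\<^sub>R S = a *\<^sub>R S + b *\<^sub>R S"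
      "a *\<^sub>R b *\<^sub>R S = (a * b) *\<^sub>R S" "1 *\<^sub>R S = S"
    by (transfer; simp add: fun_eq_iff algebra_simps)+
  show "norm (a *\<^sub>R S) = \<bar>a\<bar> * norm S"
    by transfer (simp add: power_mult_distrib infsum_cmult_right' real_sqrt_mult)
  show "norm (S + T) \<le> norm S + norm T"
    by transfer
       (rule l2_triangle(2), auto simp: hilbert_schmidt_def norm_triangle_ineq)
  show "norm S = 0 \<longleftrightarrow> S = 0"
  proof
    assume "norm S = 0"
    hence "norm (hs_apply S x) \<le> 0" for x
      using hilbert_schmidt_bound[OF hilbert_schmidt_hs_apply, of S x] by (simp add: norm_hs.rep_eq)
    thus "S = 0" by (intro hs_eqI) (simp add: zero_hs.rep_eq)
  next
    show "S = 0 \<Longrightarrow> norm S = 0" by (simp add: norm_hs.rep_eq zero_hs.rep_eq)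
  qed
qed

end

lemma norm_hs_apply: "norm (hs_apply T x) \<le> norm T * norm x"
  unfolding norm_hs.rep_eq by (rule hilbert_schmidt_bound[OF hilbert_schmidt_hs_apply])

lemma bounded_linear_hs_apply: "bounded_linear (hs_apply T)"
  and hs_apply_scaleC: "hs_apply T (c *\<^sub>C x) = c *\<^sub>C hs_apply T x"
  and hs_summable: "(\<lambda>e. (norm (hs_apply T e))\<^sup>2) summable_on some_onb"
  using hilbert_schmidt_hs_apply[of T] by (auto simp: hilbert_schmidt_def)

instance hs :: (chilbert_space, chilbert_space) banach
proof
  fix X :: "nat \<Rightarrow> ('a, 'b) hs"
  assume X: "Cauchy X"
  define B where "B n = Blinfun (hs_apply (X n))" for n
  have B: "blinfun_apply (B n) x = hs_apply (X n) x" for n x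
    by (simp add: B_def bounded_linear_Blinfun_apply bounded_linear_hs_apply)
  have nB: "norm (B m - B n) \<le> norm (X m - X n)" for m n
    by (rule norm_blinfun_bound)
       (simp_all add: blinfun.diff_left B norm_hs_apply[of "X m - X n", unfolded minus_hs.rep_eq])
  have "Cauchy B"
    using X unfolding Cauchy_iff by (meson nB le_less_trans)
  then obtain L where L: "B \<longlonglongrightarrow> L"
    using Cauchy_convergent convergent_def by blast
  define T where "T = blinfun_apply L"
  have lim: "(\<lambda>n. hs_apply (X n) x) \<longlonglongrightarrow> T x" for x
    using blinfun.tendsto[OF L tendsto_const[of x]] by (simp add: B T_def)
  have T1: "bounded_linear T" unfolding T_def by (rule blinfun.bounded_linear_right)
  have T2: "T (c *\<^sub>C x) = c *\<^sub>C T x" for c x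
  proof (rule LIMSEQ_unique[OF lim])
    show "(\<lambda>n. hs_apply (X n) (c *\<^sub>C x)) \<longlonglongrightarrow> c *\<^sub>C T x"
      unfolding hs_apply_scaleC
      by (rule bounded_linear.tendsto[OF bounded_linear_scaleC_right lim])
  qed
  have key: "(\<Sum>e\<in>F. (norm (hs_apply (X n) e - T e))\<^sup>2) \<le> r\<^sup>2"
    if r: "r \<ge> 0" "\<And>m. m \<ge> n \<Longrightarrow> norm (X n - X m) \<le> r" and F: "finite F" "F \<subseteq> some_onb" for n r F
  proof (rule tendsto_upperbound)
    show "(\<lambda>m. \<Sum>e\<in>F. (norm (hs_apply (X n) e - hs_apply (X m) e))\<^sup>2) \<longlonglongrightarrow>
        (\<Sum>e\<in>F. (norm (hs_apply (X n) e - T e))\<^sup>2)"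
      by (intro tendsto_intros lim)
    have "(\<Sum>e\<in>F. (norm (hs_apply (X n) e - hs_apply (X m) e))\<^sup>2) \<le> r\<^sup>2" if m: "m \<ge> n" for m
    proof -
      have "(\<Sum>e\<in>F. (norm (hs_apply (X n) e - hs_apply (X m) e))\<^sup>2)
          = (\<Sum>e\<in>F. (norm (hs_apply (X n - X m) e))\<^sup>2)"
        by (simp add: minus_hs.rep_eq)
      also have "\<dots> \<le> (\<Sum>\<^sub>\<infinity>e\<in>some_onb. (norm (hs_apply (X n - X m) e))\<^sup>2)"
        by (intro finite_sum_le_infsum hs_summable F) simp
      also have "\<dots> = (norm (X n - X m))\<^sup>2"
        by (simp add: norm_hs.rep_eq infsum_nonneg)
      also have "\<dots> \<le> r\<^sup>2" using r m by (intro power_mono) auto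
      finally show ?thesis .
    qed
    thus "\<forall>\<^sub>F m in sequentially. (\<Sum>e\<in>F. (norm (hs_apply (X n) e - hs_apply (X m) e))\<^sup>2) \<le> r\<^sup>2"
      using eventually_sequentially by blast
  qed simp
  have diff: "hilbert_schmidt (\<lambda>x. hs_apply (X n) x - T x)"
      "sqrt (\<Sum>\<^sub>\<infinity>e\<in>some_onb. (norm (hs_apply (X n) e - T e))\<^sup>2) \<le> r"
    if r: "r \<ge> 0" "\<And>m. m \<ge> n \<Longrightarrow> norm (X n - X m) \<le> r" for n r
  proof -
    note k = key[of r n, OF r]
    have sm: "(\<lambda>e. (norm (hs_apply (X n) e - T e))\<^sup>2) summable_on some_onb"
      by (rule nonneg_bdd_above_summable_on) (use k in \<open>auto intro!: bdd_aboveI2\<close>)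
    thus "hilbert_schmidt (\<lambda>x. hs_apply (X n) x - T x)"
      unfolding hilbert_schmidt_def
      by (auto intro: bounded_linear_sub bounded_linear_hs_apply T1
          simp: T2 hs_apply_scaleC scaleC_add_right scaleC_minus_right simp flip: diff_conv_add_uminus)
         (simp add: scaleC_add_right scaleC_minus_right diff_conv_add_uminus del: add_uminus_conv_diff)
    have "(\<Sum>\<^sub>\<infinity>e\<in>some_onb. (norm (hs_apply (X n) e - T e))\<^sup>2) \<le> r\<^sup>2"
      by (rule infsum_le_finite_sums[OF sm k])
    thus "sqrt (\<Sum>\<^sub>\<infinity>e\<in>some_onb. (norm (hs_apply (X n) e - T e))\<^sup>2) \<le> r"
      by (rule real_le_lsqrt[OF r(1)])
  qed
  have small: "\<exists>N. \<forall>n\<ge>N. \<forall>m\<ge>n. norm (X n - X m) \<le> r" if "r > 0" for r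
    using X that unfolding Cauchy_iff by (meson less_imp_le order_trans)
  obtain N where N: "\<And>m. m \<ge> N \<Longrightarrow> norm (X N - X m) \<le> 1"
    using small[of 1] by auto
  have "hilbert_schmidt (\<lambda>x. hs_apply (X N) x - (hs_apply (X N) x - T x))"
    by (intro hilbert_schmidt_diff hilbert_schmidt_hs_apply diff(1)[of 1] N) auto
  hence T: "hilbert_schmidt T" by simp
  have ap: "hs_apply (Abs_hs T) = T" using T by (simp add: Abs_hs_inverse)
  have "X \<longlonglongrightarrow> Abs_hs T"
    unfolding LIMSEQ_iff
  proof (intro allI impI)
    fix r :: real assume r: "r > 0"
    then obtain N where N: "\<And>n m. n \<ge> N \<Longrightarrow> m \<ge> n \<Longrightarrow> norm (X n - X m) \<le> r / 2"
      using small[of "r / 2"] by auto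
    have "norm (X n - Abs_hs T) < r" if "n \<ge> N" for n
    proof -
      have "norm (X n - Abs_hs T) \<le> r / 2"
        unfolding norm_hs.rep_eq minus_hs.rep_eq ap using diff(2)[of "r / 2" n] N r that by simp
      thus ?thesis using r by simp
    qed
    thus "\<exists>N. \<forall>n\<ge>N. norm (X n - Abs_hs T) < r" by blast
  qed
  thus "convergent X" by (rule convergentI)
qed

lemma hs_cinner_summable:
  "(\<lambda>e. cinner (hs_apply S e) (hs_apply T e)) summable_on some_onb"
proof (rule abs_summable_summable, rule summable_on_comparison_test)
  show "(\<lambda>e. (norm (hs_apply S e))\<^sup>2 + (norm (hs_apply T e))\<^sup>2) summable_on some_onb"
    by (intro summable_on_add hs_summable)
  fix e :: 'a
  let ?s = "norm (hs_apply S e)" and ?t = "norm (hs_apply T e)"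
  have "cmod (cinner (hs_apply S e) (hs_apply T e)) \<le> ?s * ?t"
    by (rule cinner_Cauchy_Schwarz)
  also have "\<dots> \<le> ?s\<^sup>2 + ?t\<^sup>2"
    using sum_squares_bound[of ?s ?t] mult_nonneg_nonneg[of ?s ?t, OF norm_ge_zero norm_ge_zero]
    by linarith
  finally show "norm (cinner (hs_apply S e) (hs_apply T e)) \<le> ?s\<^sup>2 + ?t\<^sup>2" .
qed simp

instantiation hs :: (chilbert_space, chilbert_space) chilbert_space
begin

lift_definition scaleC_hs :: "complex \<Rightarrow> ('a, 'b) hs \<Rightarrow> ('a, 'b) hs" is "\<lambda>c T x. c *\<^sub>C T x"
  by (rule hilbert_schmidt_scaleC)

lift_definition cinner_hs :: "('a, 'b) hs \<Rightarrow> ('a, 'b) hs \<Rightarrow> complex" is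
  "\<lambda>S T. \<Sum>\<^sub>\<infinity>e\<in>some_onb. cinner (S e) (T e)" .

instance
proof
  fix S T U :: "('a, 'b) hs" and a b :: complex and r :: real
  show "r *\<^sub>R S = of_real r *\<^sub>C S"
    by transfer (simp add: fun_eq_iff scaleR_scaleC)
  show "a *\<^sub>C (S + T) = a *\<^sub>C S + a *\<^sub>C T"
    by transfer (simp add: fun_eq_iff scaleC_add_right)
  show "(a + b) *\<^sub>C S = a *\<^sub>C S + b *\<^sub>C S"
    by transfer (simp add: fun_eq_iff scaleC_add_left)
  show "a *\<^sub>C (b *\<^sub>C S) = (a * b) *\<^sub>C S"
    by transfer (simp add: fun_eq_iff)
  show "cinner S T = cnj (cinner T S)"
    unfolding cinner_hs.rep_eq infsum_cnj[symmetric] by (simp flip: cinner_commute)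
  show "cinner (S + T) U = cinner S U + cinner T U"
    unfolding cinner_hs.rep_eq plus_hs.rep_eq cinner_add_left
    by (intro infsum_add hs_cinner_summable)
  show "cinner (a *\<^sub>C S) T = a * cinner S T"
    unfolding cinner_hs.rep_eq scaleC_hs.rep_eq cinner_scaleC_left by (rule infsum_cmult_right')
  have "complex_of_real (\<Sum>\<^sub>\<infinity>e\<in>some_onb. (norm (hs_apply S e))\<^sup>2) =
      (\<Sum>\<^sub>\<infinity>e\<in>some_onb. of_real ((norm (hs_apply S e))\<^sup>2))"
    by (rule infsum_bounded_linear_strong[symmetric])
       (auto intro: bounded_linear_of_real summable_on_of_real hs_summable simp del: of_real_power)
  also have "\<dots> = cinner S S"
    unfolding cinner_hs.rep_eq cinner_self ..
  finally have "cinner S S = of_real (\<Sum>\<^sub>\<infinity>e\<in>some_onb. (norm (hs_apply S e))\<^sup>2)" ..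
  thus "norm S = sqrt (Re (cinner S S))"
    unfolding norm_hs.rep_eq by simp
qed

end

lift_definition elementary_tensor ::
    "'a::chilbert_space \<Rightarrow> 'b::chilbert_space \<Rightarrow> ('a, 'b) hs" (infixr "\<otimes>\<^sub>H" 70)
  is "\<lambda>f1 f2 f. cinner f f1 *\<^sub>C f2"
proof -
  fix f1 :: 'a and f2 :: 'b
  have "bounded_linear (\<lambda>f. cinner f f1 *\<^sub>C f2)"
  proof (rule bounded_linear_intro[where K = "norm f1 * norm f2"])
    show "norm (cinner f f1 *\<^sub>C f2) \<le> norm f * (norm f1 * norm f2)" for f
      using mult_right_mono[OF cinner_Cauchy_Schwarz[of f f1], of "norm f2"] by (simp add: mult_ac)
  qed (auto simp: cinner_add_left scaleC_add_left scaleR_scaleC)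
  moreover have "(\<lambda>e. (cmod (cinner e f1))\<^sup>2 * (norm f2)\<^sup>2) summable_on some_onb"
    using Bessel_summable[OF orthonormal_some_onb, of f1]
    by (intro summable_on_cmult_left) (simp add: cinner_commute[of _ f1])
  ultimately show "hilbert_schmidt (\<lambda>f. cinner f f1 *\<^sub>C f2)"
    unfolding hilbert_schmidt_def by (simp add: power_mult_distrib)
qed

lemma cinner_hs_elementary_tensor: "cinner T (f \<otimes>\<^sub>H g) = cinner (hs_apply T f) g"
proof -
  have "((\<lambda>e. hs_apply T (cinner f e *\<^sub>C e)) has_sum hs_apply T f) some_onb"
    by (rule has_sum_bounded_linear[OF bounded_linear_hs_apply onb_expansion[OF some_onb]])
  from has_sum_bounded_linear[OF bounded_linear_cinner_left this, of g] show ?thesis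
    unfolding cinner_hs.rep_eq elementary_tensor.rep_eq hs_apply_scaleC
    by (auto dest!: infsumI simp flip: cinner_commute[of f])
qed

lemma cinner_elementary_tensor:
  "cinner (f1 \<otimes>\<^sub>H f2) (g1 \<otimes>\<^sub>H g2) = cnj (cinner f1 g1) * cinner f2 g2"
  by (simp add: cinner_hs_elementary_tensor elementary_tensor.rep_eq flip: cinner_commute[of g1])

text \<open>Finite sums of elementary tensors already form their linear span, because
  \<open>a *\<^sub>C (f \<otimes>\<^sub>H g) = f \<otimes>\<^sub>H (a *\<^sub>C g)\<close>.\<close>

lemma elementary_tensors_dense:
  fixes T :: "('a::chilbert_space, 'b::chilbert_space) hs"
  assumes "r > 0"
  shows "\<exists>(F :: 'a set) g. finite F \<and> norm (T - (\<Sum>f\<in>F. f \<otimes>\<^sub>H g f)) < r"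
proof -
  have "((\<lambda>F. \<Sum>e\<in>F. (norm (hs_apply T e))\<^sup>2) \<longlongrightarrow>
      (\<Sum>\<^sub>\<infinity>e\<in>some_onb. (norm (hs_apply T e))\<^sup>2)) (finite_subsets_at_top some_onb)"
    by (rule infsum_tendsto[OF hs_summable])
  hence "\<forall>\<^sub>F F in finite_subsets_at_top some_onb. dist (\<Sum>e\<in>F. (norm (hs_apply T e))\<^sup>2)
      (\<Sum>\<^sub>\<infinity>e\<in>some_onb. (norm (hs_apply T e))\<^sup>2) < r\<^sup>2"
    using assms by (intro tendstoD) auto
  then obtain F where F: "finite F" "F \<subseteq> some_onb" and
    d: "dist (\<Sum>e\<in>F. (norm (hs_apply T e))\<^sup>2) (\<Sum>\<^sub>\<infinity>e\<in>some_onb. (norm (hs_apply T e))\<^sup>2) < r\<^sup>2"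
    unfolding eventually_finite_subsets_at_top by blast
  define S where "S = (\<Sum>f\<in>F. f \<otimes>\<^sub>H hs_apply T f)"
  define t where "t = (\<Sum>e\<in>F. (norm (hs_apply T e))\<^sup>2)"
  have TS: "cinner T S = of_real t"
    by (simp add: S_def t_def cinner_sum_right cinner_hs_elementary_tensor cinner_self)
  have "cinner S S = (\<Sum>f\<in>F. \<Sum>e\<in>F. cnj (cinner e f) * cinner (hs_apply T e) (hs_apply T f))"
    by (simp add: S_def cinner_sum_right cinner_sum_left cinner_elementary_tensor)
  also have "\<dots> = (\<Sum>f\<in>F. \<Sum>e\<in>F. if e = f then cinner (hs_apply T f) (hs_apply T f) else 0)"
  proof (intro sum.cong refl)
    fix f e assume "f \<in> F" "e \<in> F"
    hence "cinner e f = (if e = f then 1 else 0)"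
      using F orthonormal_some_onb unfolding orthonormal_def by blast
    thus "cnj (cinner e f) * cinner (hs_apply T e) (hs_apply T f) =
        (if e = f then cinner (hs_apply T f) (hs_apply T f) else 0)"
      by auto
  qed
  also have "\<dots> = of_real t"
    using F by (simp add: t_def cinner_self)
  finally have "(norm S)\<^sup>2 = t"
    unfolding cinner_self of_real_eq_iff .
  hence "(norm (T - S))\<^sup>2 = (norm T)\<^sup>2 - t"
    by (simp add: norm_diff_sq_cinner TS)
  also have "(norm T)\<^sup>2 = (\<Sum>\<^sub>\<infinity>e\<in>some_onb. (norm (hs_apply T e))\<^sup>2)"
    by (simp add: norm_hs.rep_eq infsum_nonneg)
  finally have "(norm (T - S))\<^sup>2 < r\<^sup>2"
    using d unfolding t_def dist_real_def by linarith
  hence "norm (T - S) < r"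
    using assms by (simp add: power2_less_imp_less)
  thus ?thesis using F(1) unfolding S_def by blast
qed


section \<open>Matrices and operators on \<open>\<ell>\<^sup>2\<close>\<close>

type_synonym 'i mat = "'i \<times> 'i \<Rightarrow> complex"

definition ell2 :: "('x \<Rightarrow> complex) set" where
  "ell2 = {c. (\<lambda>x. (cmod (c x))\<^sup>2) summable_on UNIV}"

definition ell2_norm :: "('x \<Rightarrow> complex) \<Rightarrow> real" where
  "ell2_norm c = sqrt (\<Sum>\<^sub>\<infinity>x. (cmod (c x))\<^sup>2)"

definition ell2_unit :: "'x \<Rightarrow> 'x \<Rightarrow> complex" where
  "ell2_unit x = (\<lambda>y. if y = x then 1 else 0)"

text \<open>Operators on \<open>\<ell>\<^sup>2\<close> are functions on all sequences of which only the restriction to \<open>ell2\<close>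
  matters.\<close>

definition ell2_bounded_op :: "(('x \<Rightarrow> complex) \<Rightarrow> ('x \<Rightarrow> complex)) \<Rightarrow> bool" where
  "ell2_bounded_op T \<longleftrightarrow>
     (\<forall>c\<in>ell2. T c \<in> ell2) \<and>
     (\<forall>c\<in>ell2. \<forall>d\<in>ell2. T (\<lambda>x. c x + d x) = (\<lambda>x. T c x + T d x)) \<and>
     (\<forall>a. \<forall>c\<in>ell2. T (\<lambda>x. a * c x) = (\<lambda>x. a * T c x)) \<and>
     (\<exists>C. \<forall>c\<in>ell2. ell2_norm (T c) \<le> C * ell2_norm c)"

definition ell2_op_norm :: "(('x \<Rightarrow> complex) \<Rightarrow> ('x \<Rightarrow> complex)) \<Rightarrow> real" where
  "ell2_op_norm T = (SUP c\<in>{c\<in>ell2. ell2_norm c \<le> 1}. ell2_norm (T c))"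

definition ell2_inverse ::
    "(('x \<Rightarrow> complex) \<Rightarrow> ('x \<Rightarrow> complex)) \<Rightarrow> (('x \<Rightarrow> complex) \<Rightarrow> ('x \<Rightarrow> complex)) \<Rightarrow> bool" where
  "ell2_inverse T S \<longleftrightarrow> ell2_bounded_op S \<and> (\<forall>c\<in>ell2. S (T c) = c \<and> T (S c) = c)"

definition mat_apply :: "'i mat \<Rightarrow> ('i \<Rightarrow> complex) \<Rightarrow> ('i \<Rightarrow> complex)" where
  "mat_apply M c = (\<lambda>i. \<Sum>\<^sub>\<infinity>j. M (i, j) * c j)"

definition mat_bounded :: "'i mat \<Rightarrow> bool" where
  "mat_bounded M \<longleftrightarrow>
     (\<forall>c\<in>ell2. \<forall>i. (\<lambda>j. M (i, j) * c j) summable_on UNIV) \<and> ell2_bounded_op (mat_apply M)"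

definition mat_op_norm :: "'i mat \<Rightarrow> real" where
  "mat_op_norm M = ell2_op_norm (mat_apply M)"

text \<open>The matrix representing an operator with respect to the standard basis.\<close>

definition mat_of_op :: "(('i \<Rightarrow> complex) \<Rightarrow> ('i \<Rightarrow> complex)) \<Rightarrow> 'i mat" where
  "mat_of_op S = (\<lambda>(i, j). S (ell2_unit j) i)"

definition mat_mult :: "'i mat \<Rightarrow> 'i mat \<Rightarrow> 'i mat" where
  "mat_mult M N = (\<lambda>(i, j). \<Sum>\<^sub>\<infinity>n. M (i, n) * N (n, j))"

definition mat_adjoint :: "'i mat \<Rightarrow> 'i mat" where
  "mat_adjoint M = (\<lambda>(i, j). cnj (M (j, i)))"

definition mat_inverse_closed :: "'i mat set \<Rightarrow> bool" where
  "mat_inverse_closed \<M> \<longleftrightarrow> (\<forall>M\<in>\<M>. \<forall>S. ell2_inverse (mat_apply M) S \<longrightarrow> mat_of_op S \<in> \<M>)"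


section \<open>Spectral matrix algebras\<close>

text \<open>
  Matrices and tensors are both families of complex numbers with entrywise linear structure, so one
  locale serves for both. Associativity and distributivity are stated because products of infinite
  matrices given by convergent sums need not satisfy them; they are automatic if all elements
  define bounded operators.
\<close>

locale involutive_banach_algebra =
  fixes \<X> :: "('x \<Rightarrow> complex) set"
    and nrm :: "('x \<Rightarrow> complex) \<Rightarrow> real"
    and mult :: "('x \<Rightarrow> complex) \<Rightarrow> ('x \<Rightarrow> complex) \<Rightarrow> ('x \<Rightarrow> complex)"
    and star :: "('x \<Rightarrow> complex) \<Rightarrow> ('x \<Rightarrow> complex)"
  assumes zero_closed: "(\<lambda>_. 0) \<in> \<X>"
    and add_closed: "M \<in> \<X> \<Longrightarrow> N \<in> \<X> \<Longrightarrow> (\<lambda>x. M x + N x) \<in> \<X>"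
    and scale_closed: "M \<in> \<X> \<Longrightarrow> (\<lambda>x. a * M x) \<in> \<X>"
    and nrm_eq_zero_iff: "M \<in> \<X> \<Longrightarrow> nrm M = 0 \<longleftrightarrow> M = (\<lambda>_. 0)"
    and nrm_triangle: "M \<in> \<X> \<Longrightarrow> N \<in> \<X> \<Longrightarrow> nrm (\<lambda>x. M x + N x) \<le> nrm M + nrm N"
    and nrm_scale: "M \<in> \<X> \<Longrightarrow> nrm (\<lambda>x. a * M x) = cmod a * nrm M"
    and nrm_complete:
      "\<lbrakk>\<And>n :: nat. X n \<in> \<X>; \<And>r. r > 0 \<Longrightarrow> \<exists>N. \<forall>m\<ge>N. \<forall>n\<ge>N. nrm (\<lambda>x. X m x - X n x) < r\<rbrakk>
        \<Longrightarrow> \<exists>L\<in>\<X>. (\<lambda>n. nrm (\<lambda>x. X n x - L x)) \<longlonglongrightarrow> 0"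
    and mult_closed: "M \<in> \<X> \<Longrightarrow> N \<in> \<X> \<Longrightarrow> mult M N \<in> \<X>"
    and mult_assoc: "M \<in> \<X> \<Longrightarrow> N \<in> \<X> \<Longrightarrow> P \<in> \<X> \<Longrightarrow> mult (mult M N) P = mult M (mult N P)"
    and mult_add_left: "M \<in> \<X> \<Longrightarrow> N \<in> \<X> \<Longrightarrow> P \<in> \<X> \<Longrightarrow>
      mult (\<lambda>x. M x + N x) P = (\<lambda>x. mult M P x + mult N P x)"
    and mult_add_right: "M \<in> \<X> \<Longrightarrow> N \<in> \<X> \<Longrightarrow> P \<in> \<X> \<Longrightarrow>
      mult P (\<lambda>x. M x + N x) = (\<lambda>x. mult P M x + mult P N x)"
    and mult_scale_left: "M \<in> \<X> \<Longrightarrow> N \<in> \<X> \<Longrightarrow> mult (\<lambda>x. a * M x) N = (\<lambda>x. a * mult M N x)"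
    and mult_scale_right: "M \<in> \<X> \<Longrightarrow> N \<in> \<X> \<Longrightarrow> mult M (\<lambda>x. a * N x) = (\<lambda>x. a * mult M N x)"
    and nrm_mult: "M \<in> \<X> \<Longrightarrow> N \<in> \<X> \<Longrightarrow> nrm (mult M N) \<le> nrm M * nrm N"
    and star_closed: "M \<in> \<X> \<Longrightarrow> star M \<in> \<X>"
    and star_star: "M \<in> \<X> \<Longrightarrow> star (star M) = M"
    and star_add: "M \<in> \<X> \<Longrightarrow> N \<in> \<X> \<Longrightarrow> star (\<lambda>x. M x + N x) = (\<lambda>x. star M x + star N x)"
    and star_scale: "M \<in> \<X> \<Longrightarrow> star (\<lambda>x. a * M x) = (\<lambda>x. cnj a * star M x)"
    and star_mult: "M \<in> \<X> \<Longrightarrow> N \<in> \<X> \<Longrightarrow> star (mult M N) = mult (star N) (star M)"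
    and nrm_star: "M \<in> \<X> \<Longrightarrow> nrm (star M) = nrm M"

locale spectral_matrix_algebra = involutive_banach_algebra \<M> nrm mat_mult mat_adjoint
  for \<M> :: "'i::countable mat set" and nrm +
  assumes bounded: "M \<in> \<M> \<Longrightarrow> mat_bounded M"
    and inverse_closed: "mat_inverse_closed \<M>"

locale solid_spectral_matrix_algebra = spectral_matrix_algebra +
  assumes solid: "M \<in> \<M> \<Longrightarrow> (\<And>i j. cmod (N (i, j)) \<le> cmod (M (i, j))) \<Longrightarrow> N \<in> \<M>"
    and nrm_solid: "M \<in> \<M> \<Longrightarrow> (\<And>i j. cmod (N (i, j)) \<le> cmod (M (i, j))) \<Longrightarrow> nrm N \<le> nrm M"


section \<open>Rank-four tensors\<close>

type_synonym ('i, 'k) tensor4 = "'i \<times> 'k \<times> 'k \<times> 'i \<Rightarrow> complex"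

definition tensor_apply ::
    "('i, 'k) tensor4 \<Rightarrow> ('i \<times> 'k \<Rightarrow> complex) \<Rightarrow> ('i \<times> 'k \<Rightarrow> complex)" where
  "tensor_apply A c = (\<lambda>(i, k). \<Sum>\<^sub>\<infinity>m. \<Sum>\<^sub>\<infinity>n. A (i, k, n, m) * c (m, n))"

definition tensor_bounded :: "('i, 'k) tensor4 \<Rightarrow> bool" where
  "tensor_bounded A \<longleftrightarrow>
     (\<forall>c\<in>ell2. \<forall>i k. (\<lambda>(m, n). A (i, k, n, m) * c (m, n)) summable_on UNIV) \<and>
     ell2_bounded_op (tensor_apply A)"

text \<open>The tensor representing an operator: \<open>A\<^sub>i\<^sub>,\<^sub>k\<^sub>,\<^sub>l\<^sub>,\<^sub>j\<close> is the entry at \<open>(i, k)\<close> of the image of the unit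
  vector at \<open>(j, l)\<close>.\<close>

definition tensor_of_op ::
    "(('i \<times> 'k \<Rightarrow> complex) \<Rightarrow> ('i \<times> 'k \<Rightarrow> complex)) \<Rightarrow> ('i, 'k) tensor4" where
  "tensor_of_op S = (\<lambda>(i, k, l, j). S (ell2_unit (j, l)) (i, k))"

definition tensor_mult ::
    "('i, 'k) tensor4 \<Rightarrow> ('i, 'k) tensor4 \<Rightarrow> ('i, 'k) tensor4" where
  "tensor_mult A B = (\<lambda>(i, k, l, j). \<Sum>\<^sub>\<infinity>n. \<Sum>\<^sub>\<infinity>m. A (i, k, n, m) * B (m, n, l, j))"

definition tensor_adjoint :: "('i, 'k) tensor4 \<Rightarrow> ('i, 'k) tensor4" where
  "tensor_adjoint A = (\<lambda>(i, k, l, j). cnj (A (j, l, k, i)))"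

definition tensor_inverse_closed :: "('i, 'k) tensor4 set \<Rightarrow> bool" where
  "tensor_inverse_closed \<X> \<longleftrightarrow>
     (\<forall>A\<in>\<X>. \<forall>S. ell2_inverse (tensor_apply A) S \<longrightarrow> tensor_of_op S \<in> \<X>)"

definition inner_block :: "('i, 'k) tensor4 \<Rightarrow> 'i \<Rightarrow> 'i \<Rightarrow> 'k mat" where
  "inner_block A i j = (\<lambda>(k, l). A (i, k, l, j))"

definition outer_block :: "('i, 'k) tensor4 \<Rightarrow> 'k \<Rightarrow> 'k \<Rightarrow> 'i mat" where
  "outer_block A k l = (\<lambda>(i, j). A (i, k, l, j))"

definition inner_block_norms :: "('i, 'k) tensor4 \<Rightarrow> 'i mat" where
  "inner_block_norms A = (\<lambda>(i, j). of_real (mat_op_norm (inner_block A i j)))"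

definition outer_block_norms :: "('i, 'k) tensor4 \<Rightarrow> 'k mat" where
  "outer_block_norms A = (\<lambda>(k, l). of_real (mat_op_norm (outer_block A k l)))"

definition tilde1_norm :: "'i mat set \<Rightarrow> ('i mat \<Rightarrow> real) \<Rightarrow> ('i, 'k) tensor4 \<Rightarrow> ereal" where
  "tilde1_norm \<A>1 nrm1 A =
     (if (\<forall>i j. mat_bounded (inner_block A i j)) \<and> inner_block_norms A \<in> \<A>1
      then ereal (nrm1 (inner_block_norms A)) else \<infinity>)"

definition tilde2_norm :: "'k mat set \<Rightarrow> ('k mat \<Rightarrow> real) \<Rightarrow> ('i, 'k) tensor4 \<Rightarrow> ereal" where
  "tilde2_norm \<A>2 nrm2 A =
     (if (\<forall>k l. mat_bounded (outer_block A k l)) \<and> outer_block_norms A \<in> \<A>2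
      then ereal (nrm2 (outer_block_norms A)) else \<infinity>)"

definition tilde1 :: "'i mat set \<Rightarrow> ('i mat \<Rightarrow> real) \<Rightarrow> ('i, 'k) tensor4 set" where
  "tilde1 \<A>1 nrm1 = {A. tilde1_norm \<A>1 nrm1 A < \<infinity>}"

definition tilde2 :: "'k mat set \<Rightarrow> ('k mat \<Rightarrow> real) \<Rightarrow> ('i, 'k) tensor4 set" where
  "tilde2 \<A>2 nrm2 = {A. tilde2_norm \<A>2 nrm2 A < \<infinity>}"

definition tensor_algebra ::
    "'i mat set \<Rightarrow> ('i mat \<Rightarrow> real) \<Rightarrow> 'k mat set \<Rightarrow> ('k mat \<Rightarrow> real) \<Rightarrow> ('i, 'k) tensor4 set" where
  "tensor_algebra \<A>1 nrm1 \<A>2 nrm2 = tilde1 \<A>1 nrm1 \<inter> tilde2 \<A>2 nrm2"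

text \<open>On \<open>tensor_algebra\<close> both extended norms are finite, so nothing is lost by \<open>real_of_ereal\<close>.\<close>

definition tensor_algebra_norm ::
    "'i mat set \<Rightarrow> ('i mat \<Rightarrow> real) \<Rightarrow> 'k mat set \<Rightarrow> ('k mat \<Rightarrow> real) \<Rightarrow> ('i, 'k) tensor4 \<Rightarrow> real" where
  "tensor_algebra_norm \<A>1 nrm1 \<A>2 nrm2 A =
     real_of_ereal (max (tilde1_norm \<A>1 nrm1 A) (tilde2_norm \<A>2 nrm2 A))"


section \<open>Frames and self-localisation\<close>

definition is_frame :: "('i::countable \<Rightarrow> 'a::chilbert_space) \<Rightarrow> bool" where
  "is_frame \<psi> \<longleftrightarrow> (\<exists>A>0. \<exists>B>0. \<forall>f.
     (\<lambda>i. (cmod (cinner f (\<psi> i)))\<^sup>2) summable_on UNIV \<and>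
     A * (norm f)\<^sup>2 \<le> (\<Sum>\<^sub>\<infinity>i. (cmod (cinner f (\<psi> i)))\<^sup>2) \<and>
     (\<Sum>\<^sub>\<infinity>i. (cmod (cinner f (\<psi> i)))\<^sup>2) \<le> B * (norm f)\<^sup>2)"

definition gram_matrix :: "('i \<Rightarrow> 'a::chilbert_space) \<Rightarrow> 'i mat" where
  "gram_matrix \<psi> = (\<lambda>(i, i'). cinner (\<psi> i) (\<psi> i'))"

definition self_localised ::
    "'i mat set \<Rightarrow> ('i mat \<Rightarrow> real) \<Rightarrow> ('i::countable \<Rightarrow> 'a::chilbert_space) \<Rightarrow> bool" where
  "self_localised \<M> nrm \<psi> \<longleftrightarrow> spectral_matrix_algebra \<M> nrm \<and> gram_matrix \<psi> \<in> \<M>"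

definition gram_tensor :: "('i \<times> 'k \<Rightarrow> 'a::chilbert_space) \<Rightarrow> ('i, 'k) tensor4" where
  "gram_tensor \<Omega> = (\<lambda>(i, k, l, j). cinner (\<Omega> (i, k)) (\<Omega> (j, l)))"

definition tensor_self_localised ::
    "('i, 'k) tensor4 set \<Rightarrow> (('i, 'k) tensor4 \<Rightarrow> real) \<Rightarrow>
     ('i::countable \<times> 'k::countable \<Rightarrow> 'a::chilbert_space) \<Rightarrow> bool" where
  "tensor_self_localised \<X> nrm \<Omega> \<longleftrightarrow>
     involutive_banach_algebra \<X> nrm tensor_mult tensor_adjoint \<and>
     (\<forall>A\<in>\<X>. tensor_bounded A) \<and> tensor_inverse_closed \<X> \<and>
     gram_tensor \<Omega> \<in> \<X>"

definition tensor_family ::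
    "('i \<Rightarrow> 'a::chilbert_space) \<Rightarrow> ('k \<Rightarrow> 'b::chilbert_space) \<Rightarrow> 'i \<times> 'k \<Rightarrow> ('a, 'b) hs" where
  "tensor_family \<psi>1 \<psi>2 = (\<lambda>(i, k). \<psi>1 i \<otimes>\<^sub>H \<psi>2 k)"

end

theory Submission
  imports Defs
begin

text \<open>
  Solidity turns entrywise estimates of block norms into membership and norm estimates. The block
  norms of a sum, a product and an adjoint are dominated by the sum, the product and the adjoint of
  the block norm matrices, so each of the two tensor spaces inherits the structure of an involutive
  Banach algebra from its matrix algebra; the second space is the first one after exchanging the two
  index sets. A matrix entry is controlled by the norm of a solid algebra, hence limits in the two
  tensor spaces agree entrywise, and the intersection is complete.

  The blocks of the Gram tensor of \<open>\<psi>1 \<otimes> \<psi>2\<close> are scalar multiples of one Gram matrix, the scalars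
  being the entries of the other one up to conjugation.

  For the frame bounds, \<open>\<langle>T, \<psi>1 i \<otimes> \<psi>2 k\<rangle> = \<langle>T (\<psi>1 i), \<psi>2 k\<rangle>\<close>. The frame inequality for \<open>\<psi>2\<close> reduces the
  sum over \<open>k\<close> to \<open>\<parallel>T (\<psi>1 i)\<parallel>\<^sup>2\<close>, and the sum of these over \<open>i\<close> is evaluated by the frame inequality for
  \<open>\<psi>1\<close> at the vectors \<open>T\<^sup>* e\<close> for \<open>e\<close> in an orthonormal basis.
\<close>

section \<open>Square-summable sequences and bounded operators\<close>

text \<open>On an infinite \<open>F\<close> the underlying sum defaults to 0, hence so does
  \<open>finnorm\<close>; upper bounds by a nonnegative constant remain valid there.\<close>

abbreviation finnorm :: "('x \<Rightarrow> complex) \<Rightarrow> 'x set \<Rightarrow> real" where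
  "finnorm c F \<equiv> L2_set (\<lambda>x. cmod (c x)) F"

lemma ell2_norm_nonneg [simp]: "0 \<le> ell2_norm c"
  by (simp add: ell2_norm_def infsum_nonneg)

lemma ell2_norm_zero [simp]: "ell2_norm (\<lambda>_. 0) = 0"
  by (simp add: ell2_norm_def)

lemma zero_in_ell2 [simp]: "(\<lambda>_. 0) \<in> ell2"
  by (simp add: ell2_def)

lemma finnorm_le_ell2_norm:
  assumes "c \<in> ell2"
  shows "finnorm c F \<le> ell2_norm c"
proof (cases "finite F")
  case True
  then show ?thesis
    unfolding L2_set_def ell2_norm_def using assms
    by (intro real_sqrt_le_mono finite_sum_le_infsum) (auto simp: ell2_def)
qed simp

text \<open>The partial sums of squares increase and stay below the square of \<open>C\<close>, so
  the full sum converges to at most that value. This reduces membership in \<open>ell2\<close> and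
  norm bounds to finite sections; the empty set gives \<open>C \<ge> 0\<close>.\<close>

lemma ell2I:
  assumes "\<And>F. finite F \<Longrightarrow> finnorm c F \<le> C"
  shows "c \<in> ell2" and "ell2_norm c \<le> C"
proof -
  have C: "0 \<le> C" using assms[of "{}"] by simp
  have bd: "(\<Sum>x\<in>F. (cmod (c x))\<^sup>2) \<le> C\<^sup>2" if "finite F" for F
    using power_mono[OF assms[OF that], of 2] by (simp add: L2_set_def sum_nonneg)
  show c: "c \<in> ell2"
    unfolding ell2_def mem_Collect_eq
    by (rule nonneg_bdd_above_summable_on) (use bd in \<open>auto intro!: bdd_aboveI2\<close>)
  have "(\<Sum>\<^sub>\<infinity>x. (cmod (c x))\<^sup>2) \<le> C\<^sup>2"
    by (rule infsum_le_finite_sums) (use c bd in \<open>auto simp: ell2_def\<close>)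
  then show "ell2_norm c \<le> C"
    unfolding ell2_norm_def by (rule real_le_lsqrt[OF C])
qed

lemma finnorm_add: "finnorm (\<lambda>x. c x + d x) F \<le> finnorm c F + finnorm d F"
  by (rule order_trans[OF L2_set_mono L2_set_triangle_ineq]) (auto simp: norm_triangle_ineq)

lemma ell2_add:
  assumes "c \<in> ell2" "d \<in> ell2"
  shows "(\<lambda>x. c x + d x) \<in> ell2" and "ell2_norm (\<lambda>x. c x + d x) \<le> ell2_norm c + ell2_norm d"
proof -
  have "finnorm (\<lambda>x. c x + d x) F \<le> ell2_norm c + ell2_norm d" for F
    using finnorm_add[of c d F] finnorm_le_ell2_norm[of c F] finnorm_le_ell2_norm[of d F] assms
    by linarith
  from ell2I[OF this] show "(\<lambda>x. c x + d x) \<in> ell2"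
    "ell2_norm (\<lambda>x. c x + d x) \<le> ell2_norm c + ell2_norm d" .
qed

lemma ell2_scale: "c \<in> ell2 \<Longrightarrow> (\<lambda>x. a * c x) \<in> ell2"
  by (auto simp: ell2_def norm_mult power_mult_distrib intro: summable_on_cmult_right)

lemma ell2_norm_scale: "ell2_norm (\<lambda>x. a * c x) = cmod a * ell2_norm c"
  by (simp add: ell2_norm_def norm_mult power_mult_distrib infsum_cmult_right' real_sqrt_mult)

lemma ell2_finite_support:
  assumes "finite F" "\<And>x. x \<notin> F \<Longrightarrow> c x = 0"
  shows "c \<in> ell2" and "ell2_norm c = finnorm c F"
proof -
  have "((\<lambda>x. (cmod (c x))\<^sup>2) has_sum (\<Sum>x\<in>F. (cmod (c x))\<^sup>2)) UNIV"
    by (rule has_sum_finite_neutralI) (use assms in auto)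
  then show "c \<in> ell2" "ell2_norm c = finnorm c F"
    by (auto simp: ell2_def ell2_norm_def L2_set_def summable_on_def dest: infsumI)
qed

lemma ell2_unit_ell2: "ell2_unit x \<in> ell2"
  by (rule ell2_finite_support[of "{x}"]) (auto simp: ell2_unit_def)

lemma cmod_le_ell2_norm: "c \<in> ell2 \<Longrightarrow> cmod (c x) \<le> ell2_norm c"
  using finnorm_le_ell2_norm[of c "{x}"] by simp

lemma ell2_product_abs_summable:
  assumes "c \<in> ell2" "d \<in> ell2"
  shows "(\<lambda>x. norm (c x * d x)) summable_on UNIV"
proof (rule summable_on_comparison_test)
  show "(\<lambda>x. (cmod (c x))\<^sup>2 + (cmod (d x))\<^sup>2) summable_on UNIV"
    using assms by (intro summable_on_add) (auto simp: ell2_def)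
  fix x
  show "norm (c x * d x) \<le> (cmod (c x))\<^sup>2 + (cmod (d x))\<^sup>2"
    using sum_squares_bound[of "cmod (c x)" "cmod (d x)"]
      mult_nonneg_nonneg[of "cmod (c x)" "cmod (d x)", OF norm_ge_zero norm_ge_zero]
    unfolding norm_mult by linarith
qed simp

lemmas ell2_product_summable = abs_summable_summable[OF ell2_product_abs_summable]

lemma cmod_sum_product_le: "cmod (\<Sum>x\<in>F. c x * d x) \<le> finnorm c F * finnorm d F"
proof -
  have "cmod (\<Sum>x\<in>F. c x * d x) \<le> (\<Sum>x\<in>F. \<bar>cmod (c x)\<bar> * \<bar>cmod (d x)\<bar>)"
    by (rule order_trans[OF norm_sum]) (simp add: norm_mult)
  also have "\<dots> \<le> finnorm c F * finnorm d F" by (rule L2_set_mult_ineq)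
  finally show ?thesis .
qed

lemma finnorm_self: "(\<Sum>x\<in>F. cnj (c x) * c x) = of_real ((finnorm c F)\<^sup>2)"
  by (simp add: L2_set_def sum_nonneg complex_norm_square mult.commute del: of_real_power)

text \<open>Self-duality of finite-dimensional l2: testing with the conjugate of \<open>c\<close>
  bounds the square of \<open>finnorm c F\<close> by \<open>C * finnorm c F\<close>, and a nonzero
  factor cancels.\<close>

lemma finnorm_le_dual:
  assumes "C \<ge> 0" "\<And>d. cmod (\<Sum>x\<in>F. d x * c x) \<le> C * finnorm d F"
  shows "finnorm c F \<le> C"
proof -
  have "(finnorm c F)\<^sup>2 \<le> C * finnorm c F"
    using assms(2)[of "\<lambda>x. cnj (c x)"] unfolding finnorm_self by (simp add: norm_power)
  then show ?thesis
    using assms(1) L2_set_nonneg[of "\<lambda>x. cmod (c x)" F]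
    by (cases "finnorm c F = 0") (auto simp: power2_eq_square)
qed

text \<open>The squared norm of the tail is the full sum minus the partial sum over
  \<open>F\<close>, which tends to zero along the finite sets.\<close>

lemma ell2_tail_tendsto_0:
  assumes "c \<in> ell2"
  shows "((\<lambda>F. ell2_norm (\<lambda>x. if x \<in> F then 0 else c x)) \<longlongrightarrow> 0) (finite_subsets_at_top UNIV)"
proof -
  let ?s = "\<lambda>x. (cmod (c x))\<^sup>2"
  have sm: "?s summable_on UNIV" using assms by (simp add: ell2_def)
  have eq: "ell2_norm (\<lambda>x. if x \<in> F then 0 else c x) = sqrt (infsum ?s UNIV - sum ?s F)"
    if F: "finite F" for F
  proof -
    have "(\<lambda>x. (cmod (if x \<in> F then 0 else c x))\<^sup>2) = (\<lambda>x. if x \<in> - F then ?s x else 0)"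
      by auto
    then have "(\<Sum>\<^sub>\<infinity>x. (cmod (if x \<in> F then 0 else c x))\<^sup>2) = infsum ?s (- F)"
      by (simp only:) (rule infsum_cong_neutral, auto)
    also have "\<dots> = infsum ?s UNIV - sum ?s F"
      using F sm infsum_Diff[of ?s UNIV F] by (simp add: Compl_eq_Diff_UNIV)
    finally show ?thesis by (simp add: ell2_norm_def)
  qed
  have "((\<lambda>F. sqrt (infsum ?s UNIV - sum ?s F)) \<longlongrightarrow> sqrt (infsum ?s UNIV - infsum ?s UNIV))
      (finite_subsets_at_top UNIV)"
    by (intro tendsto_intros infsum_tendsto sm)
  then have "((\<lambda>F. sqrt (infsum ?s UNIV - sum ?s F)) \<longlongrightarrow> 0) (finite_subsets_at_top UNIV)"
    by simp
  then show ?thesis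
    by (rule Lim_transform_eventually) (auto intro!: eventually_finite_subsets_at_top_weakI simp: eq)
qed

section \<open>Bounded operators on square-summable sequences\<close>

lemma ell2_bounded_opD:
  assumes "ell2_bounded_op T"
  obtains C where "C \<ge> 0" "\<And>c. c \<in> ell2 \<Longrightarrow> ell2_norm (T c) \<le> C * ell2_norm c"
proof -
  from assms obtain C where C: "\<And>c. c \<in> ell2 \<Longrightarrow> ell2_norm (T c) \<le> C * ell2_norm c"
    unfolding ell2_bounded_op_def by blast
  then have "ell2_norm (T c) \<le> max C 0 * ell2_norm c" if "c \<in> ell2" for c
    using that mult_right_mono[of C "max C 0" "ell2_norm c"] by fastforce
  then show ?thesis by (intro that[of "max C 0"]) auto
qed

lemma ell2_bounded_op_sum_unit:
  assumes "ell2_bounded_op T" "finite F"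
  shows "T (\<lambda>x. if x \<in> F then c x else 0) = (\<lambda>y. \<Sum>x\<in>F. T (ell2_unit x) y * c x)"
  using assms(2)
proof induction
  case empty
  have "\<forall>a. \<forall>c\<in>ell2. T (\<lambda>x. a * c x) = (\<lambda>x. a * T c x)"
    using assms(1) unfolding ell2_bounded_op_def by blast
  from this[rule_format, of "\<lambda>_. 0" 0]
  have "T (\<lambda>_. 0) = (\<lambda>_. 0)" by simp
  then show ?case by simp
next
  case (insert a F)
  have "(\<lambda>x. if x \<in> insert a F then c x else 0) =
      (\<lambda>x. c a * ell2_unit a x + (if x \<in> F then c x else 0))"
    using insert by (auto simp: ell2_unit_def)
  moreover have "(\<lambda>x. if x \<in> F then c x else 0) \<in> ell2"
    by (rule ell2_finite_support[OF insert(1)]) simp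
  ultimately have "T (\<lambda>x. if x \<in> insert a F then c x else 0) =
      (\<lambda>y. c a * T (ell2_unit a) y + T (\<lambda>x. if x \<in> F then c x else 0) y)"
    using assms(1) ell2_unit_ell2[of a] ell2_scale[OF ell2_unit_ell2[of a], of "c a"]
    unfolding ell2_bounded_op_def by simp
  then show ?case using insert by (auto simp: mult.commute)
qed

text \<open>Continuity carries the finite expansion in unit vectors to the limit: the error at a
  finite \<open>F\<close> is an entry of \<open>T\<close> applied to the tail of \<open>c\<close>,
  at most \<open>C\<close> times the tail norm. Hence a bounded operator is determined by its
  matrix, which later identifies the entries of a composition.\<close>

lemma ell2_bounded_op_expansion:
  assumes T: "ell2_bounded_op T" and c: "c \<in> ell2"
  shows "((\<lambda>x. T (ell2_unit x) y * c x) has_sum T c y) UNIV"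
proof -
  obtain C where C: "C \<ge> 0" "\<And>c. c \<in> ell2 \<Longrightarrow> ell2_norm (T c) \<le> C * ell2_norm c"
    using ell2_bounded_opD[OF T] by blast
  let ?h = "\<lambda>F x. if x \<in> F then c x else 0" and ?t = "\<lambda>F x. if x \<in> F then 0 else c x"
  have bd: "cmod (T c y - (\<Sum>x\<in>F. T (ell2_unit x) y * c x)) \<le> C * ell2_norm (?t F)"
    if F: "finite F" for F
  proof -
    have h: "?h F \<in> ell2" by (rule ell2_finite_support[OF F]) simp
    have t: "?t F \<in> ell2"
      using ell2_add(1)[OF c ell2_scale[OF h, of "-1"]]
      by (rule back_subst[of "\<lambda>c. c \<in> ell2"]) auto
    have "c = (\<lambda>x. ?h F x + ?t F x)" by auto
    then have "T c = (\<lambda>y. T (?h F) y + T (?t F) y)"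
      using T h t unfolding ell2_bounded_op_def by metis
    then have "T c y - (\<Sum>x\<in>F. T (ell2_unit x) y * c x) = T (?t F) y"
      by (simp add: ell2_bounded_op_sum_unit[OF T F])
    also have "cmod \<dots> \<le> ell2_norm (T (?t F))"
      using T t unfolding ell2_bounded_op_def by (intro cmod_le_ell2_norm) blast
    also have "\<dots> \<le> C * ell2_norm (?t F)" by (rule C(2)[OF t])
    finally show ?thesis .
  qed
  have "((\<lambda>F. C * ell2_norm (?t F)) \<longlongrightarrow> 0) (finite_subsets_at_top UNIV)"
    by (rule tendsto_mult_right_zero[OF ell2_tail_tendsto_0[OF c]])
  then have "((\<lambda>F. T c y - (\<Sum>x\<in>F. T (ell2_unit x) y * c x)) \<longlongrightarrow> 0) (finite_subsets_at_top UNIV)"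
    by (rule Lim_null_comparison[rotated]) (auto intro!: eventually_finite_subsets_at_top_weakI bd)
  from tendsto_diff[OF tendsto_const[of "T c y"] this] show ?thesis
    by (simp add: has_sum_def)
qed

lemma ell2_bounded_op_norm_bdd:
  assumes "ell2_bounded_op T"
  shows "bdd_above ((\<lambda>c. ell2_norm (T c)) ` {c\<in>ell2. ell2_norm c \<le> 1})"
proof -
  obtain C where C: "C \<ge> 0" "\<And>c. c \<in> ell2 \<Longrightarrow> ell2_norm (T c) \<le> C * ell2_norm c"
    using ell2_bounded_opD[OF assms] by blast
  show ?thesis
    by (rule bdd_aboveI2[where M = C])
       (use C in \<open>auto intro: order_trans mult_left_le\<close>)
qed

lemma ell2_op_norm_nonneg:
  assumes "ell2_bounded_op T"
  shows "0 \<le> ell2_op_norm T"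
  unfolding ell2_op_norm_def
  by (rule cSUP_upper2[OF ell2_bounded_op_norm_bdd[OF assms], of "\<lambda>_. 0"]) auto

lemma ell2_op_norm_bound:
  assumes T: "ell2_bounded_op T" and c: "c \<in> ell2"
  shows "ell2_norm (T c) \<le> ell2_op_norm T * ell2_norm c"
proof (cases "ell2_norm c = 0")
  case True
  \<comment> \<open>Normalising \<open>c\<close> is impossible here; boundedness with some constant
    forces the left side to be at most 0.\<close>
  then show ?thesis using ell2_bounded_opD[OF T] c by (metis mult_zero_right)
next
  case False
  let ?a = "complex_of_real (inverse (ell2_norm c))"
  have ac: "(\<lambda>x. ?a * c x) \<in> ell2" "ell2_norm (\<lambda>x. ?a * c x) \<le> 1"
    using ell2_scale[OF c, of ?a] False unfolding ell2_norm_scale by (simp_all add: norm_inverse)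
  have "ell2_norm (T (\<lambda>x. ?a * c x)) \<le> ell2_op_norm T"
    unfolding ell2_op_norm_def
    by (rule cSUP_upper[OF _ ell2_bounded_op_norm_bdd[OF T]]) (use ac in auto)
  moreover have "T (\<lambda>x. ?a * c x) = (\<lambda>x. ?a * T c x)"
    using T c unfolding ell2_bounded_op_def by blast
  ultimately have "cmod ?a * ell2_norm (T c) \<le> ell2_op_norm T"
    by (simp add: ell2_norm_scale)
  then show ?thesis using False ell2_norm_nonneg[of c] by (simp add: norm_inverse norm_divide field_simps)
qed

lemma ell2_op_norm_le:
  assumes "C \<ge> 0" "\<And>c. c \<in> ell2 \<Longrightarrow> ell2_norm (T c) \<le> C * ell2_norm c"
  shows "ell2_op_norm T \<le> C"
  unfolding ell2_op_norm_def
  by (rule cSUP_least) (use assms in \<open>auto intro!: exI[of _ "\<lambda>_. 0"] intro: order_trans mult_left_le\<close>)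


section \<open>Bounded matrices\<close>

text \<open>Boundedness on \<open>\<ell>\<^sup>2\<close> tested by finite bilinear forms only: in this form adjoints, entrywise limits
  and block decompositions need no summability arguments.\<close>

definition form_bounded :: "'i mat \<Rightarrow> real \<Rightarrow> bool" where
  "form_bounded M C \<longleftrightarrow> (\<forall>F G c d. finite F \<longrightarrow> finite G \<longrightarrow>
     cmod (\<Sum>i\<in>F. \<Sum>j\<in>G. d i * M (i, j) * c j) \<le> C * finnorm d F * finnorm c G)"

lemma form_boundedD:
  "form_bounded M C \<Longrightarrow> finite F \<Longrightarrow> finite G \<Longrightarrow>
    cmod (\<Sum>i\<in>F. \<Sum>j\<in>G. d i * M (i, j) * c j) \<le> C * finnorm d F * finnorm c G"
  unfolding form_bounded_def by blast

lemma form_bounded_entry: "form_bounded M C \<Longrightarrow> cmod (M (i, j)) \<le> C"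
  using form_boundedD[of M C "{i}" "{j}" "\<lambda>_. 1" "\<lambda>_. 1"] by simp

lemma form_bounded_nonneg: "form_bounded M C \<Longrightarrow> 0 \<le> C"
  using form_bounded_entry[of M C] norm_ge_zero order_trans by metis

lemma form_bounded_mono:
  assumes "form_bounded M C" "C \<le> D"
  shows "form_bounded M D"
  unfolding form_bounded_def
proof (intro allI impI)
  fix F G :: "'a set" and c d :: "'a \<Rightarrow> complex"
  assume "finite F" "finite G"
  from form_boundedD[OF assms(1) this, of d c]
  show "cmod (\<Sum>i\<in>F. \<Sum>j\<in>G. d i * M (i, j) * c j) \<le> D * finnorm d F * finnorm c G"
    by (rule order_trans) (intro mult_right_mono assms(2) L2_set_nonneg)
qed

lemma form_bounded_zero: "form_bounded (\<lambda>_. 0) 0"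
  by (simp add: form_bounded_def)

lemma form_bounded_add:
  assumes "form_bounded M C" "form_bounded N D"
  shows "form_bounded (\<lambda>x. M x + N x) (C + D)"
  unfolding form_bounded_def
proof (intro allI impI)
  fix F G :: "'a set" and c d :: "'a \<Rightarrow> complex"
  assume FG: "finite F" "finite G"
  have "cmod (\<Sum>i\<in>F. \<Sum>j\<in>G. d i * (M (i, j) + N (i, j)) * c j)
      \<le> cmod (\<Sum>i\<in>F. \<Sum>j\<in>G. d i * M (i, j) * c j) + cmod (\<Sum>i\<in>F. \<Sum>j\<in>G. d i * N (i, j) * c j)"
    by (simp add: distrib_left distrib_right sum.distrib norm_triangle_ineq)
  also have "\<dots> \<le> C * finnorm d F * finnorm c G + D * finnorm d F * finnorm c G"
    by (intro add_mono form_boundedD assms FG)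
  finally show "cmod (\<Sum>i\<in>F. \<Sum>j\<in>G. d i * (M (i, j) + N (i, j)) * c j)
      \<le> (C + D) * finnorm d F * finnorm c G"
    by (simp add: distrib_right)
qed

lemma form_bounded_scale:
  assumes "form_bounded M C"
  shows "form_bounded (\<lambda>x. a * M x) (cmod a * C)"
  unfolding form_bounded_def
proof (intro allI impI)
  fix F G :: "'a set" and c d :: "'a \<Rightarrow> complex"
  assume FG: "finite F" "finite G"
  have "(\<Sum>i\<in>F. \<Sum>j\<in>G. d i * (a * M (i, j)) * c j) = a * (\<Sum>i\<in>F. \<Sum>j\<in>G. d i * M (i, j) * c j)"
    by (simp add: sum_distrib_left mult_ac)
  then show "cmod (\<Sum>i\<in>F. \<Sum>j\<in>G. d i * (a * M (i, j)) * c j)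
      \<le> cmod a * C * finnorm d F * finnorm c G"
    using mult_left_mono[OF form_boundedD[OF assms FG, of d c], of "cmod a"]
    by (simp add: norm_mult mult_ac)
qed

lemma form_bounded_cnj:
  assumes "form_bounded M C"
  shows "form_bounded (\<lambda>x. cnj (M x)) C"
  unfolding form_bounded_def
proof (intro allI impI)
  fix F G :: "'a set" and c d :: "'a \<Rightarrow> complex"
  assume FG: "finite F" "finite G"
  have "(\<Sum>i\<in>F. \<Sum>j\<in>G. d i * cnj (M (i, j)) * c j) =
      cnj (\<Sum>i\<in>F. \<Sum>j\<in>G. cnj (d i) * M (i, j) * cnj (c j))"
    by simp
  then show "cmod (\<Sum>i\<in>F. \<Sum>j\<in>G. d i * cnj (M (i, j)) * c j) \<le> C * finnorm d F * finnorm c G"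
    using form_boundedD[OF assms FG, of "\<lambda>i. cnj (d i)" "\<lambda>i. cnj (c i)"]
    by (simp del: cnj_sum)
qed

lemma form_bounded_adjoint:
  assumes "form_bounded M C"
  shows "form_bounded (mat_adjoint M) C"
proof -
  have "form_bounded (\<lambda>(i, j). M (j, i)) C"
    unfolding form_bounded_def
  proof (intro allI impI)
    fix F G :: "'a set" and c d :: "'a \<Rightarrow> complex"
    assume FG: "finite F" "finite G"
    have "(\<Sum>i\<in>F. \<Sum>j\<in>G. d i * M (j, i) * c j) = (\<Sum>j\<in>G. \<Sum>i\<in>F. c j * M (j, i) * d i)"
      by (subst sum.swap) (simp add: mult_ac)
    then show "cmod (\<Sum>i\<in>F. \<Sum>j\<in>G. d i * (case (i, j) of (i, j) \<Rightarrow> M (j, i)) * c j)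
        \<le> C * finnorm d F * finnorm c G"
      using form_boundedD[OF assms FG(2,1), of c d] by (simp add: mult_ac)
  qed
  from form_bounded_cnj[OF this] show ?thesis
    by (simp add: mat_adjoint_def case_prod_unfold)
qed

text \<open>Each test form involves only finitely many entries, so entrywise convergence carries a
  convergent family of bounds to the limit.\<close>

lemma form_bounded_tendsto:
  fixes M :: "'i mat"
  assumes "\<And>i j. ((\<lambda>n. X n (i, j)) \<longlongrightarrow> M (i, j)) \<F>" "(f \<longlongrightarrow> C) \<F>"
    and "\<forall>\<^sub>F n in \<F>. form_bounded (X n) (f n)" "\<F> \<noteq> bot"
  shows "form_bounded M C"
  unfolding form_bounded_def
proof (intro allI impI)
  fix F G :: "'i set" and c d :: "'i \<Rightarrow> complex"
  assume FG: "finite F" "finite G"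
  show "cmod (\<Sum>i\<in>F. \<Sum>j\<in>G. d i * M (i, j) * c j) \<le> C * finnorm d F * finnorm c G"
  proof (rule tendsto_le[OF assms(4)])
    show "((\<lambda>n. cmod (\<Sum>i\<in>F. \<Sum>j\<in>G. d i * X n (i, j) * c j)) \<longlongrightarrow>
        cmod (\<Sum>i\<in>F. \<Sum>j\<in>G. d i * M (i, j) * c j)) \<F>"
      by (intro tendsto_intros assms(1))
    show "((\<lambda>n. f n * finnorm d F * finnorm c G) \<longlongrightarrow> C * finnorm d F * finnorm c G) \<F>"
      by (intro tendsto_intros assms(2))
    show "\<forall>\<^sub>F n in \<F>. cmod (\<Sum>i\<in>F. \<Sum>j\<in>G. d i * X n (i, j) * c j)
        \<le> f n * finnorm d F * finnorm c G"
      using assms(3) by eventually_elim (intro form_boundedD FG)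
  qed
qed

lemma form_bounded_sum:
  "(\<And>n. n \<in> H \<Longrightarrow> form_bounded (X n) (f n)) \<Longrightarrow> form_bounded (\<lambda>x. \<Sum>n\<in>H. X n x) (\<Sum>n\<in>H. f n)"
  by (induction H rule: infinite_finite_induct) (simp_all add: form_bounded_zero form_bounded_add)

text \<open>Partial sums have bounds that add up, and these pass to the limit. This later estimates
  a block of the product of two tensors, an infinite sum of matrix products.\<close>

lemma form_bounded_has_sum:
  assumes "\<And>i j. ((\<lambda>n. X n (i, j)) has_sum M (i, j)) A" "(f has_sum C) A"
    and "\<And>n. form_bounded (X n) (f n)"
  shows "form_bounded M C"
proof (rule form_bounded_tendsto[where X = "\<lambda>H x. \<Sum>n\<in>H. X n x" and f = "\<lambda>H. sum f H"])
  show "((\<lambda>H. \<Sum>n\<in>H. X n (i, j)) \<longlongrightarrow> M (i, j)) (finite_subsets_at_top A)" for i j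
    using assms(1) by (simp add: has_sum_def)
  show "(sum f \<longlongrightarrow> C) (finite_subsets_at_top A)"
    using assms(2) by (simp add: has_sum_def)
  show "\<forall>\<^sub>F H in finite_subsets_at_top A. form_bounded (\<lambda>x. \<Sum>n\<in>H. X n x) (sum f H)"
    by (rule always_eventually, rule allI, rule form_bounded_sum, rule assms(3))
qed simp

section \<open>From form bounds to bounded operators and back\<close>

lemma form_bounded_row:
  assumes "form_bounded M C"
  shows "(\<lambda>j. M (i, j)) \<in> ell2" and "ell2_norm (\<lambda>j. M (i, j)) \<le> C"
proof -
  have *: "finnorm (\<lambda>j. M (i, j)) G \<le> C" if "finite G" for G
    using form_boundedD[OF assms _ that, of "{i}" "\<lambda>_. 1"]
    by (intro finnorm_le_dual form_bounded_nonneg[OF assms]) (simp add: mult.commute)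
  show "(\<lambda>j. M (i, j)) \<in> ell2" "ell2_norm (\<lambda>j. M (i, j)) \<le> C"
    by (rule ell2I; rule *; assumption)+
qed

lemma form_bounded_col:
  assumes "form_bounded M C"
  shows "(\<lambda>i. M (i, j)) \<in> ell2" and "ell2_norm (\<lambda>i. M (i, j)) \<le> C"
proof -
  have *: "finnorm (\<lambda>i. M (i, j)) F \<le> C" if "finite F" for F
    using form_boundedD[OF assms that, of "{j}" _ "\<lambda>_. 1"]
    by (intro finnorm_le_dual form_bounded_nonneg[OF assms]) simp
  show "(\<lambda>i. M (i, j)) \<in> ell2" "ell2_norm (\<lambda>i. M (i, j)) \<le> C"
    by (rule ell2I; rule *; assumption)+
qed

text \<open>Rows are square-summable, so the series converges. For the norm, duality on a finite set
  \<open>F\<close> reduces the claim to forms with \<open>c\<close> truncated to a finite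
  \<open>G\<close>, and the bound survives the limit in \<open>G\<close>.\<close>

lemma form_bounded_apply:
  assumes M: "form_bounded M C" and c: "c \<in> ell2"
  shows "((\<lambda>j. M (i, j) * c j) has_sum mat_apply M c i) UNIV"
    and "mat_apply M c \<in> ell2" and "ell2_norm (mat_apply M c) \<le> C * ell2_norm c"
proof -
  show hs: "((\<lambda>j. M (i, j) * c j) has_sum mat_apply M c i) UNIV" for i
    unfolding mat_apply_def
    by (intro has_sum_infsum ell2_product_summable form_bounded_row[OF M] c)
  have *: "finnorm (mat_apply M c) F \<le> C * ell2_norm c" if F: "finite F" for F
  proof (rule finnorm_le_dual)
    show "0 \<le> C * ell2_norm c" using form_bounded_nonneg[OF M] by simp
    fix d
    have "((\<lambda>G. cmod (\<Sum>i\<in>F. d i * (\<Sum>j\<in>G. M (i, j) * c j))) \<longlongrightarrow>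
        cmod (\<Sum>i\<in>F. d i * mat_apply M c i)) (finite_subsets_at_top UNIV)"
      using hs unfolding has_sum_def by (intro tendsto_intros) auto
    then show "cmod (\<Sum>i\<in>F. d i * mat_apply M c i) \<le> C * ell2_norm c * finnorm d F"
    proof (rule tendsto_upperbound, intro eventually_finite_subsets_at_top_weakI)
      fix G :: "'a set" assume G: "finite G"
      have "cmod (\<Sum>i\<in>F. d i * (\<Sum>j\<in>G. M (i, j) * c j)) \<le> C * finnorm d F * finnorm c G"
        using form_boundedD[OF M F G, of d c] by (simp add: sum_distrib_left mult_ac)
      also have "\<dots> \<le> C * finnorm d F * ell2_norm c"
        using form_bounded_nonneg[OF M] by (intro mult_left_mono finnorm_le_ell2_norm c) simp
      finally show "cmod (\<Sum>i\<in>F. d i * (\<Sum>j\<in>G. M (i, j) * c j)) \<le> C * ell2_norm c * finnorm d F"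
        by (simp add: mult_ac)
    qed simp
  qed
  show "mat_apply M c \<in> ell2" "ell2_norm (mat_apply M c) \<le> C * ell2_norm c"
    by (rule ell2I; rule *; assumption)+
qed

lemma form_bounded_imp_mat_bounded:
  assumes "form_bounded M C"
  shows "mat_bounded M" and "mat_op_norm M \<le> C"
proof -
  note hs = form_bounded_apply(1)[OF assms]
  have add: "mat_apply M (\<lambda>x. c x + d x) = (\<lambda>x. mat_apply M c x + mat_apply M d x)"
    if "c \<in> ell2" "d \<in> ell2" for c d
  proof
    fix i
    from has_sum_add[OF hs[OF that(1)] hs[OF that(2)], of i i]
    show "mat_apply M (\<lambda>x. c x + d x) i = mat_apply M c i + mat_apply M d i"
      unfolding mat_apply_def[of _ "\<lambda>x. c x + d x"] by (simp add: distrib_left infsumI)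
  qed
  have scale: "mat_apply M (\<lambda>x. a * c x) = (\<lambda>x. a * mat_apply M c x)" for a c
    by (simp add: mat_apply_def infsum_cmult_right'[symmetric] mult_ac)
  show "mat_bounded M"
    unfolding mat_bounded_def ell2_bounded_op_def
  proof (intro conjI ballI allI exI)
    fix c d :: "'a \<Rightarrow> complex" and i a assume c: "c \<in> ell2"
    show "(\<lambda>j. M (i, j) * c j) summable_on UNIV"
      using hs[OF c] by (rule has_sum_imp_summable)
    show "mat_apply M c \<in> ell2" "ell2_norm (mat_apply M c) \<le> C * ell2_norm c"
      by (fact form_bounded_apply(2,3)[OF assms c])+
    show "mat_apply M (\<lambda>x. a * c x) = (\<lambda>x. a * mat_apply M c x)" by (rule scale)
    assume "d \<in> ell2"
    with c show "mat_apply M (\<lambda>x. c x + d x) = (\<lambda>x. mat_apply M c x + mat_apply M d x)" by (rule add)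
  qed
  show "mat_op_norm M \<le> C"
    unfolding mat_op_norm_def
    by (intro ell2_op_norm_le form_bounded_nonneg[OF assms] form_bounded_apply(3)[OF assms])
qed

lemma mat_op_norm_nonneg: "mat_bounded M \<Longrightarrow> 0 \<le> mat_op_norm M"
  unfolding mat_op_norm_def mat_bounded_def by (blast intro: ell2_op_norm_nonneg)

text \<open>Together with \<open>form_bounded_imp_mat_bounded\<close> this makes
  \<open>mat_op_norm M\<close> the least form bound of a bounded matrix. Truncating \<open>c\<close>
  to \<open>G\<close> turns the form into a pairing of \<open>d\<close> with the image of a finitely
  supported sequence.\<close>

lemma form_bounded_mat_op_norm:
  assumes "mat_bounded M"
  shows "form_bounded M (mat_op_norm M)"
  unfolding form_bounded_def
proof (intro allI impI)
  fix F G :: "'a set" and c d :: "'a \<Rightarrow> complex"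
  assume FG: "finite F" "finite G"
  let ?c = "\<lambda>j. if j \<in> G then c j else 0"
  have c: "?c \<in> ell2" "ell2_norm ?c = finnorm c G"
    using ell2_finite_support[OF FG(2), of ?c] by (auto intro: L2_set_cong)
  have M: "ell2_bounded_op (mat_apply M)" using assms by (simp add: mat_bounded_def)
  then have Mc: "mat_apply M ?c \<in> ell2" using c unfolding ell2_bounded_op_def by blast
  have "mat_apply M ?c i = (\<Sum>j\<in>G. M (i, j) * c j)" for i
  proof -
    have "((\<lambda>j. M (i, j) * ?c j) has_sum (\<Sum>j\<in>G. M (i, j) * c j)) UNIV"
      by (rule has_sum_finite_neutralI[where B = G]) (use FG in auto)
    then show ?thesis by (simp add: mat_apply_def infsumI)
  qed
  then have "cmod (\<Sum>i\<in>F. \<Sum>j\<in>G. d i * M (i, j) * c j) = cmod (\<Sum>i\<in>F. d i * mat_apply M ?c i)"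
    by (simp add: sum_distrib_left mult_ac)
  also have "\<dots> \<le> finnorm d F * finnorm (mat_apply M ?c) F" by (rule cmod_sum_product_le)
  also have "\<dots> \<le> finnorm d F * (mat_op_norm M * finnorm c G)"
    using ell2_op_norm_bound[OF M c(1)] finnorm_le_ell2_norm[OF Mc, of F] c(2)
    by (intro mult_left_mono) (auto simp: mat_op_norm_def)
  finally show "cmod (\<Sum>i\<in>F. \<Sum>j\<in>G. d i * M (i, j) * c j) \<le> mat_op_norm M * finnorm d F * finnorm c G"
    by (simp add: mult_ac)
qed

section \<open>Operator norms of sums, multiples and adjoints\<close>

lemma mat_op_norm_zero: "mat_op_norm (\<lambda>_. 0) = 0"
  by (intro antisym form_bounded_imp_mat_bounded(2) mat_op_norm_nonneg
      form_bounded_imp_mat_bounded(1)[of _ 0] form_bounded_zero)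

lemma mat_bounded_add:
  assumes "mat_bounded M" "mat_bounded N"
  shows "mat_bounded (\<lambda>x. M x + N x)"
    and "mat_op_norm (\<lambda>x. M x + N x) \<le> mat_op_norm M + mat_op_norm N"
  using form_bounded_imp_mat_bounded[OF form_bounded_add[OF form_bounded_mat_op_norm[OF assms(1)]
    form_bounded_mat_op_norm[OF assms(2)]]] .

lemma mat_bounded_scale:
  assumes "mat_bounded M"
  shows "mat_bounded (\<lambda>x. a * M x)" and "mat_op_norm (\<lambda>x. a * M x) = cmod a * mat_op_norm M"
proof -
  have *: "mat_bounded (\<lambda>x. a * M x)" "mat_op_norm (\<lambda>x. a * M x) \<le> cmod a * mat_op_norm M"
    if "mat_bounded M" for a and M :: "'a mat"
    using form_bounded_imp_mat_bounded[OF form_bounded_scale[OF form_bounded_mat_op_norm[OF that]]] .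
  show M: "mat_bounded (\<lambda>x. a * M x)" using *(1)[OF assms] .
  show "mat_op_norm (\<lambda>x. a * M x) = cmod a * mat_op_norm M"
  proof (cases "a = 0")
    case False
    \<comment> \<open>The reverse inequality is the upper bound for the scalar \<open>1 / a\<close>
      and the matrix already scaled by \<open>a\<close>.\<close>
    have "mat_op_norm M \<le> cmod (1 / a) * mat_op_norm (\<lambda>x. a * M x)"
      using *(2)[OF M, of "1 / a"] False by simp
    then show ?thesis
      using *(2)[OF assms, of a] False by (simp add: norm_divide field_simps)
  qed (simp add: mat_op_norm_zero)
qed

lemma mat_adjoint_adjoint [simp]: "mat_adjoint (mat_adjoint M) = M"
  by (simp add: mat_adjoint_def fun_eq_iff)

lemma mat_bounded_adjoint:
  assumes "mat_bounded M"
  shows "mat_bounded (mat_adjoint M)" and "mat_op_norm (mat_adjoint M) = mat_op_norm M"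
proof -
  have *: "mat_bounded (mat_adjoint M)" "mat_op_norm (mat_adjoint M) \<le> mat_op_norm M"
    if "mat_bounded M" for M :: "'a mat"
    using form_bounded_imp_mat_bounded[OF form_bounded_adjoint[OF form_bounded_mat_op_norm[OF that]]] .
  show "mat_bounded (mat_adjoint M)" "mat_op_norm (mat_adjoint M) = mat_op_norm M"
    using *[OF assms] *(2)[OF *(1)[OF assms]] by simp_all
qed

section \<open>Products of bounded matrices\<close>

lemma ell2_bounded_op_cong:
  assumes "ell2_bounded_op T" "\<And>c. c \<in> ell2 \<Longrightarrow> S c = T c"
  shows "ell2_bounded_op S"
  using assms(1) unfolding ell2_bounded_op_def by (simp add: assms(2) ell2_add(1) ell2_scale)

lemma mat_apply_unit: "mat_apply M (ell2_unit p) i = M (i, p)"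
proof -
  have "((\<lambda>j. M (i, j) * ell2_unit p j) has_sum M (i, p)) UNIV"
    by (rule has_sum_finite_neutralI[where B = "{p}"]) (auto simp: ell2_unit_def)
  then show ?thesis by (simp add: mat_apply_def infsumI)
qed

lemma mat_mult_eq_apply: "mat_mult M N (i, p) = mat_apply M (mat_apply N (ell2_unit p)) i"
  unfolding mat_apply_unit[abs_def] by (simp add: mat_mult_def mat_apply_def[of M])

text \<open>The composition is a bounded operator, and by \<open>mat_mult_eq_apply\<close> its
  expansion in unit vectors has the entries of \<open>mat_mult M N\<close> as coefficients. So the
  entrywise product represents the composition.\<close>

lemma mat_mult_bounded:
  assumes M: "mat_bounded M" and N: "mat_bounded N"
  shows "c \<in> ell2 \<Longrightarrow> mat_apply (mat_mult M N) c = mat_apply M (mat_apply N c)"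
    and "mat_bounded (mat_mult M N)" and "mat_op_norm (mat_mult M N) \<le> mat_op_norm M * mat_op_norm N"
proof -
  let ?T = "\<lambda>c. mat_apply M (mat_apply N c)"
  note M' = form_bounded_apply[OF form_bounded_mat_op_norm[OF M]]
  note N' = form_bounded_apply[OF form_bounded_mat_op_norm[OF N]]
  have bd: "ell2_norm (?T c) \<le> mat_op_norm M * mat_op_norm N * ell2_norm c" if "c \<in> ell2" for c
    using M'(3)[OF N'(2)[OF that]] mult_left_mono[OF N'(3)[OF that] mat_op_norm_nonneg[OF M]] by simp
  have T: "ell2_bounded_op ?T"
    unfolding ell2_bounded_op_def
  proof (intro conjI ballI allI exI)
    have M: "\<forall>c\<in>ell2. \<forall>d\<in>ell2. mat_apply M (\<lambda>x. c x + d x) = (\<lambda>x. mat_apply M c x + mat_apply M d x)"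
       "\<forall>a. \<forall>c\<in>ell2. mat_apply M (\<lambda>x. a * c x) = (\<lambda>x. a * mat_apply M c x)"
       and N: "\<forall>c\<in>ell2. \<forall>d\<in>ell2. mat_apply N (\<lambda>x. c x + d x) = (\<lambda>x. mat_apply N c x + mat_apply N d x)"
       "\<forall>a. \<forall>c\<in>ell2. mat_apply N (\<lambda>x. a * c x) = (\<lambda>x. a * mat_apply N c x)"
      using assms unfolding mat_bounded_def ell2_bounded_op_def by blast+
    fix c d :: "'a \<Rightarrow> complex" and a assume c: "c \<in> ell2"
    show "?T c \<in> ell2" "ell2_norm (?T c) \<le> mat_op_norm M * mat_op_norm N * ell2_norm c"
      using M'(2) N'(2) bd c by blast+
    show "?T (\<lambda>x. a * c x) = (\<lambda>x. a * ?T c x)"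
      using M(2) N(2) c N'(2) by simp
    assume d: "d \<in> ell2"
    show "?T (\<lambda>x. c x + d x) = (\<lambda>x. ?T c x + ?T d x)"
      using M(1) N(1) c d N'(2) by simp
  qed
  have hs: "((\<lambda>p. mat_mult M N (i, p) * c p) has_sum ?T c i) UNIV" if "c \<in> ell2" for c i
    using ell2_bounded_op_expansion[OF T that, of i] by (simp add: mat_mult_eq_apply)
  show eq: "mat_apply (mat_mult M N) c = ?T c" if "c \<in> ell2" for c
    using hs[OF that] by (auto simp: mat_apply_def[of "mat_mult M N"] infsumI)
  show "mat_bounded (mat_mult M N)"
    unfolding mat_bounded_def using hs ell2_bounded_op_cong[OF T eq] by (auto intro: has_sum_imp_summable)
  show "mat_op_norm (mat_mult M N) \<le> mat_op_norm M * mat_op_norm N"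
    unfolding mat_op_norm_def[of "mat_mult M N"]
    by (rule ell2_op_norm_le) (use assms bd eq in \<open>auto intro: mult_nonneg_nonneg mat_op_norm_nonneg\<close>)
qed

text \<open>Both sides have as column \<open>p\<close> the image of a unit vector under
  \<open>P\<close>, then \<open>N\<close>, then \<open>M\<close>. Arguing with operators avoids
  interchanging double sums that need not converge absolutely.\<close>

lemma mat_mult_assoc_bounded:
  assumes "mat_bounded M" "mat_bounded N" "mat_bounded P"
  shows "mat_mult (mat_mult M N) P = mat_mult M (mat_mult N P)"
proof
  fix x
  show "mat_mult (mat_mult M N) P x = mat_mult M (mat_mult N P) x"
    using form_bounded_apply(2)[OF form_bounded_mat_op_norm[OF assms(3)] ell2_unit_ell2]
    by (cases x) (simp add: mat_mult_eq_apply mat_mult_bounded(1)[OF assms(1,2)]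
        mat_mult_bounded(1)[OF assms(2,3) ell2_unit_ell2])
qed

lemma mat_bounded_row: "mat_bounded M \<Longrightarrow> (\<lambda>j. M (i, j)) \<in> ell2"
  and mat_bounded_col: "mat_bounded M \<Longrightarrow> (\<lambda>i. M (i, j)) \<in> ell2"
  by (erule form_bounded_row(1)[OF form_bounded_mat_op_norm], erule form_bounded_col(1)[OF form_bounded_mat_op_norm])

lemma mat_mult_has_sum:
  assumes "mat_bounded M" "mat_bounded N"
  shows "((\<lambda>n. M (i, n) * N (n, j)) has_sum mat_mult M N (i, j)) UNIV"
  unfolding mat_mult_def prod.case
  by (intro has_sum_infsum ell2_product_summable mat_bounded_row mat_bounded_col assms)

lemma mat_mult_add_left_bounded:
  assumes "mat_bounded M" "mat_bounded N" "mat_bounded P"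
  shows "mat_mult (\<lambda>x. M x + N x) P = (\<lambda>x. mat_mult M P x + mat_mult N P x)"
proof
  fix x
  show "mat_mult (\<lambda>x. M x + N x) P x = mat_mult M P x + mat_mult N P x"
    using has_sum_add[OF mat_mult_has_sum[OF assms(1,3)] mat_mult_has_sum[OF assms(2,3)]]
    by (cases x) (simp add: mat_mult_def[of "\<lambda>x. M x + N x"] distrib_right infsumI)
qed

lemma mat_mult_add_right_bounded:
  assumes "mat_bounded M" "mat_bounded N" "mat_bounded P"
  shows "mat_mult P (\<lambda>x. M x + N x) = (\<lambda>x. mat_mult P M x + mat_mult P N x)"
proof
  fix x
  show "mat_mult P (\<lambda>x. M x + N x) x = mat_mult P M x + mat_mult P N x"
    using has_sum_add[OF mat_mult_has_sum[OF assms(3,1)] mat_mult_has_sum[OF assms(3,2)]]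
    by (cases x) (simp add: mat_mult_def[of _ "\<lambda>x. M x + N x"] distrib_left infsumI)
qed

text \<open>These hold for arbitrary matrices: a nonzero scalar preserves summability, and
  nonsummable families have sum 0.\<close>

lemma mat_mult_scale_left: "mat_mult (\<lambda>x. a * M x) N = (\<lambda>x. a * mat_mult M N x)"
  and mat_mult_scale_right: "mat_mult M (\<lambda>x. a * N x) = (\<lambda>x. a * mat_mult M N x)"
  by (simp_all add: mat_mult_def fun_eq_iff infsum_cmult_right'[symmetric] mult_ac)

lemma mat_adjoint_mult: "mat_adjoint (mat_mult M N) = mat_mult (mat_adjoint N) (mat_adjoint M)"
  by (simp add: mat_adjoint_def mat_mult_def fun_eq_iff infsum_cnj[symmetric] mult_ac del: infsum_cnj)


section \<open>Intersection and reindexing of involutive Banach algebras\<close>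

context involutive_banach_algebra
begin

lemma diff_closed: "M \<in> \<X> \<Longrightarrow> N \<in> \<X> \<Longrightarrow> (\<lambda>x. M x - N x) \<in> \<X>"
  using add_closed[of M "\<lambda>x. - 1 * N x"] scale_closed[of N "- 1"] by simp

lemma nrm_zero: "nrm (\<lambda>_. 0) = 0"
  using nrm_eq_zero_iff[OF zero_closed] by simp

lemma nrm_diff_commute: "M \<in> \<X> \<Longrightarrow> N \<in> \<X> \<Longrightarrow> nrm (\<lambda>x. M x - N x) = nrm (\<lambda>x. N x - M x)"
  using nrm_scale[OF diff_closed, of M N "- 1"] by (simp add: minus_diff_eq)

text \<open>The zero element is \<open>M\<close> minus \<open>M\<close>, so its norm 0 is at most
  twice \<open>nrm M\<close>.\<close>

lemma nrm_nonneg: "M \<in> \<X> \<Longrightarrow> 0 \<le> nrm M"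
  using nrm_triangle[of M "\<lambda>x. - 1 * M x"] scale_closed[of M "- 1"] nrm_scale[of M "- 1"] nrm_zero
  by simp

end

text \<open>The delicate axiom is completeness: a Cauchy sequence has one limit in \<open>X\<close>
  and another in \<open>Y\<close>. The premises \<open>evX\<close> and \<open>evY\<close> make point
  evaluations continuous, so the two limits agree pointwise.\<close>

lemma involutive_banach_algebra_Int:
  fixes X Y :: "('x \<Rightarrow> complex) set" and mult :: "('x \<Rightarrow> complex) \<Rightarrow> ('x \<Rightarrow> complex) \<Rightarrow> 'x \<Rightarrow> complex"
  assumes X: "involutive_banach_algebra X n mult star"
    and Y: "involutive_banach_algebra Y m mult star"
    and evX: "\<And>x. \<exists>C. \<forall>M\<in>X. cmod (M x) \<le> C * n M"
    and evY: "\<And>x. \<exists>C. \<forall>M\<in>Y. cmod (M x) \<le> C * m M"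
    and p: "\<And>M. M \<in> X \<Longrightarrow> M \<in> Y \<Longrightarrow> p M = max (n M) (m M)"
  shows "involutive_banach_algebra (X \<inter> Y) p mult star"
proof -
  interpret X: involutive_banach_algebra X n mult star by (rule X)
  interpret Y: involutive_banach_algebra Y m mult star by (rule Y)
  have lim: "(\<lambda>k. Z k x) \<longlonglongrightarrow> L x"
    if iba: "involutive_banach_algebra V q mult star" and ev: "\<exists>C. \<forall>M\<in>V. cmod (M x) \<le> C * q M"
      and Z: "\<And>k. Z k \<in> V" "L \<in> V" "(\<lambda>k. q (\<lambda>x. Z k x - L x)) \<longlonglongrightarrow> 0"
    for V q Z L and x :: 'x
  proof -
    interpret V: involutive_banach_algebra V q mult star by (rule iba)
    obtain C where C: "\<And>M. M \<in> V \<Longrightarrow> cmod (M x) \<le> C * q M" using ev by blast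
    have "(\<lambda>k. Z k x - L x) \<longlonglongrightarrow> 0"
      by (rule Lim_null_comparison[OF _ tendsto_mult_right_zero[OF Z(3), of C]])
         (use C[OF V.diff_closed[OF Z(1,2)]] in auto)
    then show ?thesis by (simp add: LIM_zero_iff)
  qed
  show ?thesis
  proof
    fix M N P a
    assume M: "M \<in> X \<inter> Y"
    show "(\<lambda>x. a * M x) \<in> X \<inter> Y" "star M \<in> X \<inter> Y" "star (star M) = M"
      "star (\<lambda>x. a * M x) = (\<lambda>x. cnj a * star M x)"
      using M X.scale_closed Y.scale_closed X.star_closed Y.star_closed X.star_star X.star_scale
      by auto
    show "p M = 0 \<longleftrightarrow> M = (\<lambda>_. 0)"
      using M p[of M] X.nrm_eq_zero_iff[of M] Y.nrm_eq_zero_iff[of M] X.nrm_nonneg[of M] Y.nrm_nonneg[of M]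
      by (auto simp: max_def split: if_splits)
    show "p (\<lambda>x. a * M x) = cmod a * p M"
      using M p[of M] p[of "\<lambda>x. a * M x"] X.nrm_scale[of M a] Y.nrm_scale[of M a]
        X.scale_closed[of M a] Y.scale_closed[of M a]
      by (simp add: max_mult_distrib_left)
    show "p (star M) = p M"
      using M p[of M] p[of "star M"] X.nrm_star Y.nrm_star X.star_closed Y.star_closed by simp
    assume N: "N \<in> X \<inter> Y"
    show "(\<lambda>x. M x + N x) \<in> X \<inter> Y" "mult M N \<in> X \<inter> Y"
      "mult (\<lambda>x. a * M x) N = (\<lambda>x. a * mult M N x)"
      "mult M (\<lambda>x. a * N x) = (\<lambda>x. a * mult M N x)"
      "star (\<lambda>x. M x + N x) = (\<lambda>x. star M x + star N x)"
      "star (mult M N) = mult (star N) (star M)"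
      using M N X.add_closed Y.add_closed X.mult_closed Y.mult_closed X.mult_scale_left
        X.mult_scale_right X.star_add X.star_mult by auto
    show "p (\<lambda>x. M x + N x) \<le> p M + p N"
      using M N p X.nrm_triangle[of M N] Y.nrm_triangle[of M N] X.add_closed[of M N] Y.add_closed[of M N]
      by auto
    \<comment> \<open>Each norm is at most the maximum \<open>p\<close>, so both submultiplicative
      bounds lie below the product of the maxima.\<close>
    have "n M * n N \<le> p M * p N" "m M * m N \<le> p M * p N"
      using M N p X.nrm_nonneg Y.nrm_nonneg by (auto intro!: mult_mono simp: le_max_iff_disj)
    then show "p (mult M N) \<le> p M * p N"
      using M N p X.nrm_mult[of M N] Y.nrm_mult[of M N] X.mult_closed[of M N] Y.mult_closed[of M N]
      by auto
    assume P: "P \<in> X \<inter> Y"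
    show "mult (mult M N) P = mult M (mult N P)"
      "mult (\<lambda>x. M x + N x) P = (\<lambda>x. mult M P x + mult N P x)"
      "mult P (\<lambda>x. M x + N x) = (\<lambda>x. mult P M x + mult P N x)"
      using M N P X.mult_assoc X.mult_add_left X.mult_add_right by auto
  next
    fix Z :: "nat \<Rightarrow> 'x \<Rightarrow> complex"
    assume Z: "\<And>k. Z k \<in> X \<inter> Y"
      and cauchy: "\<And>r. r > 0 \<Longrightarrow> \<exists>N. \<forall>k\<ge>N. \<forall>l\<ge>N. p (\<lambda>x. Z k x - Z l x) < r"
    have d: "p (\<lambda>x. Z k x - Z l x) = max (n (\<lambda>x. Z k x - Z l x)) (m (\<lambda>x. Z k x - Z l x))" for k l
      using Z by (intro p X.diff_closed Y.diff_closed) auto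
    have cauchyX: "\<exists>N. \<forall>k\<ge>N. \<forall>l\<ge>N. n (\<lambda>x. Z k x - Z l x) < r"
      and cauchyY: "\<exists>N. \<forall>k\<ge>N. \<forall>l\<ge>N. m (\<lambda>x. Z k x - Z l x) < r" if "r > 0" for r
      using cauchy[OF that] unfolding d max_less_iff_conj by blast+
    obtain L where L: "L \<in> X" "(\<lambda>k. n (\<lambda>x. Z k x - L x)) \<longlonglongrightarrow> 0"
      using X.nrm_complete[of Z, OF _ cauchyX] Z by blast
    obtain L' where L': "L' \<in> Y" "(\<lambda>k. m (\<lambda>x. Z k x - L' x)) \<longlonglongrightarrow> 0"
      using Y.nrm_complete[of Z, OF _ cauchyY] Z by blast
    have "L = L'"
    proof
      fix x
      have "(\<lambda>k. Z k x) \<longlonglongrightarrow> L x" by (rule lim[OF X evX _ L]) (use Z in auto)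
      moreover have "(\<lambda>k. Z k x) \<longlonglongrightarrow> L' x" by (rule lim[OF Y evY _ L']) (use Z in auto)
      ultimately show "L x = L' x" by (rule LIMSEQ_unique)
    qed
    then have LXY: "L \<in> X \<inter> Y" using L L' by simp
    have "(\<lambda>k. max (n (\<lambda>x. Z k x - L x)) (m (\<lambda>x. Z k x - L x))) \<longlonglongrightarrow> max 0 0"
      using L L' \<open>L = L'\<close> by (intro tendsto_max) auto
    moreover have "p (\<lambda>x. Z k x - L x) = max (n (\<lambda>x. Z k x - L x)) (m (\<lambda>x. Z k x - L x))" for k
      using Z LXY by (intro p X.diff_closed Y.diff_closed) auto
    ultimately show "\<exists>L\<in>X \<inter> Y. (\<lambda>k. p (\<lambda>x. Z k x - L x)) \<longlonglongrightarrow> 0"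
      using LXY by (intro bexI[of _ L]) simp_all
  qed (use X.zero_closed Y.zero_closed in auto)
qed

text \<open>The structure of \<open>Y\<close> is pulled back along \<open>\<pi>\<close>.
  Surjectivity lets an identity be checked after composing with \<open>\<pi>\<close>, and a limit
  found in \<open>X\<close> is carried back through \<open>inv \<pi>\<close>.\<close>

lemma involutive_banach_algebra_reindex:
  fixes X :: "('x \<Rightarrow> complex) set" and mult :: "('x \<Rightarrow> complex) \<Rightarrow> ('x \<Rightarrow> complex) \<Rightarrow> 'x \<Rightarrow> complex"
    and Y :: "('y \<Rightarrow> complex) set" and mult' :: "('y \<Rightarrow> complex) \<Rightarrow> ('y \<Rightarrow> complex) \<Rightarrow> 'y \<Rightarrow> complex"
  assumes X: "involutive_banach_algebra X n mult star" and bij: "bij \<pi>"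
    and Y: "\<And>M. M \<in> Y \<longleftrightarrow> (\<lambda>x. M (\<pi> x)) \<in> X"
    and m: "\<And>M. M \<in> Y \<Longrightarrow> m M = n (\<lambda>x. M (\<pi> x))"
    and mult': "\<And>M N. M \<in> Y \<Longrightarrow> N \<in> Y \<Longrightarrow>
      (\<lambda>x. mult' M N (\<pi> x)) = mult (\<lambda>x. M (\<pi> x)) (\<lambda>x. N (\<pi> x))"
    and star': "\<And>M. M \<in> Y \<Longrightarrow> (\<lambda>x. star' M (\<pi> x)) = star (\<lambda>x. M (\<pi> x))"
  shows "involutive_banach_algebra Y m mult' star'"
proof -
  interpret X: involutive_banach_algebra X n mult star by (rule X)
  have eqI: "M = N" if "(\<lambda>x. M (\<pi> x)) = (\<lambda>x. N (\<pi> x))" for M N :: "'y \<Rightarrow> complex"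
    using that surj_f_inv_f[OF bij_is_surj[OF bij]] by (metis ext)
  have closed: "(\<lambda>_. 0) \<in> Y" "\<And>M N. M \<in> Y \<Longrightarrow> N \<in> Y \<Longrightarrow> (\<lambda>x. M x + N x) \<in> Y"
    "\<And>M N. M \<in> Y \<Longrightarrow> N \<in> Y \<Longrightarrow> (\<lambda>x. M x - N x) \<in> Y"
    "\<And>M a. M \<in> Y \<Longrightarrow> (\<lambda>x. a * M x) \<in> Y"
    "\<And>M N. M \<in> Y \<Longrightarrow> N \<in> Y \<Longrightarrow> mult' M N \<in> Y" "\<And>M. M \<in> Y \<Longrightarrow> star' M \<in> Y"
    by (simp_all add: Y X.zero_closed X.add_closed X.diff_closed X.scale_closed)
       (simp_all add: mult' star' Y X.mult_closed X.star_closed)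
  show ?thesis
  proof
    fix M N P a
    assume M: "M \<in> Y"
    note M' = M[unfolded Y]
    show "m M = 0 \<longleftrightarrow> M = (\<lambda>_. 0)"
      using eqI[of M "\<lambda>_. 0"] X.nrm_eq_zero_iff[OF M'] m[OF M] by auto
    show "m (\<lambda>x. a * M x) = cmod a * m M"
      using X.nrm_scale[OF M'] by (simp add: m closed M)
    show "star' (star' M) = M" by (rule eqI) (simp add: closed M star' X.star_star M')
    show "star' (\<lambda>x. a * M x) = (\<lambda>x. cnj a * star' M x)"
      by (rule eqI) (simp add: closed M star' X.star_scale M' fun_cong[OF star'])
    show "m (star' M) = m M" by (simp add: m closed M star' X.nrm_star M')
    assume N: "N \<in> Y"
    note N' = N[unfolded Y]
    show "m (\<lambda>x. M x + N x) \<le> m M + m N"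
      by (simp add: m closed M N X.nrm_triangle M' N')
    show "m (mult' M N) \<le> m M * m N"
      by (simp add: m closed M N mult' X.nrm_mult M' N')
    show "mult' (\<lambda>x. a * M x) N = (\<lambda>x. a * mult' M N x)"
      "mult' M (\<lambda>x. a * N x) = (\<lambda>x. a * mult' M N x)"
      by (rule eqI, simp add: closed M N mult' X.mult_scale_left X.mult_scale_right M' N' fun_cong[OF mult'])+
    show "star' (\<lambda>x. M x + N x) = (\<lambda>x. star' M x + star' N x)"
      by (rule eqI) (simp add: closed M N star' X.star_add M' N' fun_cong[OF star'])
    show "star' (mult' M N) = mult' (star' N) (star' M)"
      by (rule eqI) (simp add: closed M N star' mult' X.star_mult M' N')
    assume P: "P \<in> Y"
    note P' = P[unfolded Y]
    show "mult' (mult' M N) P = mult' M (mult' N P)"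
      by (rule eqI) (simp add: closed M N P mult' X.mult_assoc M' N' P')
    show "mult' (\<lambda>x. M x + N x) P = (\<lambda>x. mult' M P x + mult' N P x)"
      "mult' P (\<lambda>x. M x + N x) = (\<lambda>x. mult' P M x + mult' P N x)"
      by (rule eqI, simp add: closed M N P mult' X.mult_add_left X.mult_add_right M' N' P' fun_cong[OF mult'])+
  next
    fix Z :: "nat \<Rightarrow> 'y \<Rightarrow> complex"
    assume Z: "\<And>k. Z k \<in> Y"
      and cauchy: "\<And>r. r > 0 \<Longrightarrow> \<exists>N. \<forall>k\<ge>N. \<forall>l\<ge>N. m (\<lambda>x. Z k x - Z l x) < r"
    have "\<exists>L\<in>X. (\<lambda>k. n (\<lambda>x. Z k (\<pi> x) - L x)) \<longlonglongrightarrow> 0"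
      by (rule X.nrm_complete) (use Z cauchy in \<open>auto simp: m closed Y[symmetric]\<close>)
    then obtain L where L: "L \<in> X" "(\<lambda>k. n (\<lambda>x. Z k (\<pi> x) - L x)) \<longlonglongrightarrow> 0" by blast
    let ?L = "\<lambda>y. L (inv \<pi> y)"
    have L': "(\<lambda>x. ?L (\<pi> x)) = L" using bij by (simp add: bij_is_inj)
    then have "?L \<in> Y" using L(1) by (simp add: Y)
    moreover have "m (\<lambda>x. Z k x - ?L x) = n (\<lambda>x. Z k (\<pi> x) - L x)" for k
      using m[OF closed(3)[OF Z \<open>?L \<in> Y\<close>]] bij by (simp add: bij_is_inj)
    ultimately show "\<exists>L\<in>Y. (\<lambda>k. m (\<lambda>x. Z k x - L x)) \<longlonglongrightarrow> 0"
      using L(2) by (intro bexI[of _ ?L]) simp_all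
  qed (use closed in auto)
qed


section \<open>Block norms of tensors\<close>

text \<open>The tensor read as a matrix over pairs, with row \<open>(i, k)\<close> and column
  \<open>(j, l)\<close>; the tensor lists the column indices in reversed order. Under this reading
  tensor operations become matrix operations.\<close>

definition flatten :: "('i, 'k) tensor4 \<Rightarrow> ('i \<times> 'k) mat" where
  "flatten A = (\<lambda>((i, k), (j, l)). A (i, k, l, j))"

lemma flatten_apply [simp]: "flatten A ((i, k), (j, l)) = A (i, k, l, j)"
  by (simp add: flatten_def)

lemma flatten_inject: "flatten A = flatten B \<longleftrightarrow> A = B"
  by (auto simp: flatten_def fun_eq_iff)

lemma flatten_add: "flatten (\<lambda>x. A x + B x) = (\<lambda>x. flatten A x + flatten B x)"
  and flatten_scale: "flatten (\<lambda>x. a * A x) = (\<lambda>x. a * flatten A x)"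
  and flatten_adjoint: "flatten (tensor_adjoint A) = mat_adjoint (flatten A)"
  by (auto simp: flatten_def mat_adjoint_def tensor_adjoint_def)

text \<open>A row of \<open>flatten A\<close> and a column of \<open>flatten B\<close> are
  square-summable, so their product is summable over pairs. This permits rearranging iterated
  sums.\<close>

lemma flatten_product_summable:
  assumes "mat_bounded (flatten A)" "mat_bounded (flatten B)"
  shows "(\<lambda>(m, n). A (i, k, n, m) * B (m, n, l, j)) summable_on UNIV"
  using ell2_product_summable[OF mat_bounded_row[OF assms(1), of "(i, k)"] mat_bounded_col[OF assms(2), of "(j, l)"]]
  by (rule back_subst[of "\<lambda>f. f summable_on UNIV"]) auto

text \<open>In the definition the sum over \<open>m\<close> is innermost, whereas block products and
  \<open>flatten\<close> need the sum over \<open>n\<close> innermost.\<close>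

lemma tensor_mult_altdef:
  assumes "mat_bounded (flatten A)" "mat_bounded (flatten B)"
  shows "tensor_mult A B (i, k, l, j) = (\<Sum>\<^sub>\<infinity>m. \<Sum>\<^sub>\<infinity>n. A (i, k, n, m) * B (m, n, l, j))"
  unfolding tensor_mult_def prod.case
  using flatten_product_summable[OF assms, of i k l j]
  by (intro infsum_swap_banach[symmetric]) simp

lemma flatten_mult:
  assumes "mat_bounded (flatten A)" "mat_bounded (flatten B)"
  shows "flatten (tensor_mult A B) = mat_mult (flatten A) (flatten B)"
proof
  fix x :: "('a \<times> 'b) \<times> 'a \<times> 'b"
  obtain i k j l where x: "x = ((i, k), (j, l))" by (metis surj_pair)
  have "flatten (tensor_mult A B) x = (\<Sum>\<^sub>\<infinity>m. \<Sum>\<^sub>\<infinity>n. A (i, k, n, m) * B (m, n, l, j))"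
    by (simp add: x tensor_mult_altdef[OF assms])
  also have "\<dots> = (\<Sum>\<^sub>\<infinity>(m, n). A (i, k, n, m) * B (m, n, l, j))"
    using infsum_Sigma'_banach[of "\<lambda>m n. A (i, k, n, m) * B (m, n, l, j)" UNIV "\<lambda>_. UNIV"]
      flatten_product_summable[OF assms, of i k l j] by simp
  also have "\<dots> = mat_mult (flatten A) (flatten B) x"
    unfolding mat_mult_def x prod.case by (rule infsum_cong) auto
  finally show "flatten (tensor_mult A B) x = mat_mult (flatten A) (flatten B) x" .
qed

lemma tensor_apply_eq_flatten:
  assumes "mat_bounded (flatten A)" "c \<in> ell2"
  shows "(\<lambda>(m, n). A (i, k, n, m) * c (m, n)) summable_on UNIV"
    and "tensor_apply A c = mat_apply (flatten A) c"
proof -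
  show sm: "(\<lambda>(m, n). A (i, k, n, m) * c (m, n)) summable_on UNIV" for i k
    using ell2_product_summable[OF mat_bounded_row[OF assms(1), of "(i, k)"] assms(2)]
    by (rule back_subst[of "\<lambda>f. f summable_on UNIV"]) auto
  show "tensor_apply A c = mat_apply (flatten A) c"
  proof
    fix x :: "'a \<times> 'b"
    obtain i k where x: "x = (i, k)" by (metis surj_pair)
    have "tensor_apply A c x = (\<Sum>\<^sub>\<infinity>(m, n). A (i, k, n, m) * c (m, n))"
      using infsum_Sigma'_banach[of "\<lambda>m n. A (i, k, n, m) * c (m, n)" UNIV "\<lambda>_. UNIV"] sm[of i k]
      by (simp add: tensor_apply_def x)
    also have "\<dots> = mat_apply (flatten A) c x"
      unfolding mat_apply_def x by (rule infsum_cong) auto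
    finally show "tensor_apply A c x = mat_apply (flatten A) c x" .
  qed
qed

lemma tensor_bounded_flatten:
  assumes "mat_bounded (flatten A)"
  shows "tensor_bounded A"
  unfolding tensor_bounded_def
  using tensor_apply_eq_flatten[OF assms] assms
  by (auto simp: mat_bounded_def intro: ell2_bounded_op_cong)

text \<open>A two-stage estimate: each block is bounded on slices of \<open>c\<close> and
  \<open>d\<close>, then \<open>M\<close> is tested on the sequences of slice norms. The l2 norm of
  the slice norms is the norm of the whole sequence, so the constant of \<open>M\<close> is
  kept.\<close>

lemma form_bounded_flatten:
  assumes M: "form_bounded M C"
    and A: "\<And>i j. form_bounded (inner_block A i j) (a i j)" "\<And>i j. M (i, j) = of_real (a i j)"
  shows "form_bounded (flatten A) C"
  unfolding form_bounded_def
proof (intro allI impI)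
  fix F G :: "('a \<times> 'b) set" and c d :: "'a \<times> 'b \<Rightarrow> complex"
  assume FG: "finite F" "finite G"
  \<comment> \<open>Arbitrary finite sets are enlarged to rectangles and \<open>c\<close>,
    \<open>d\<close> extended by zero, so that the sums split over the two indices.\<close>
  define F1 F2 G1 G2 where FG12: "F1 = fst ` F" "F2 = snd ` F" "G1 = fst ` G" "G2 = snd ` G"
  have fin: "finite F1" "finite F2" "finite G1" "finite G2" using FG by (auto simp: FG12)
  have sub: "F \<subseteq> F1 \<times> F2" "G \<subseteq> G1 \<times> G2" by (force simp: FG12)+
  define c' d' where c'd': "c' = (\<lambda>x. if x \<in> G then c x else 0)" "d' = (\<lambda>x. if x \<in> F then d x else 0)"
  define \<gamma> \<delta> where \<gamma>\<delta>: "\<gamma> = (\<lambda>j. finnorm (\<lambda>l. c' (j, l)) G2)" "\<delta> = (\<lambda>i. finnorm (\<lambda>k. d' (i, k)) F2)"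
  have restrict: "finnorm (\<lambda>i. of_real (finnorm (\<lambda>k. if (i, k) \<in> H then e (i, k) else 0) H2)) H1 = finnorm e H"
    if "H \<subseteq> H1 \<times> H2" "finite H1" "finite H2" for H H1 H2 and e :: "'a \<times> 'b \<Rightarrow> complex"
  proof -
    have "(\<Sum>i\<in>H1. \<Sum>k\<in>H2. (cmod (if (i, k) \<in> H then e (i, k) else 0))\<^sup>2) = (\<Sum>x\<in>H. (cmod (e x))\<^sup>2)"
      unfolding sum.cartesian_product
      by (rule sum.mono_neutral_cong_right) (use that in auto)
    then show ?thesis by (simp add: L2_set_def sum_nonneg)
  qed
  have "(\<Sum>x\<in>F. \<Sum>y\<in>G. d x * flatten A (x, y) * c y) =
      (\<Sum>x\<in>F1 \<times> F2. \<Sum>y\<in>G1 \<times> G2. d' x * flatten A (x, y) * c' y)"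
  proof (rule sum.mono_neutral_cong_left)
    fix x assume x: "x \<in> F"
    then show "(\<Sum>y\<in>G. d x * flatten A (x, y) * c y) = (\<Sum>y\<in>G1 \<times> G2. d' x * flatten A (x, y) * c' y)"
      by (intro sum.mono_neutral_cong_left) (use sub fin in \<open>auto simp: c'd'\<close>)
  qed (use sub fin in \<open>auto simp: c'd'\<close>)
  also have "\<dots> = (\<Sum>i\<in>F1. \<Sum>k\<in>F2. \<Sum>j\<in>G1. \<Sum>l\<in>G2. d' (i, k) * A (i, k, l, j) * c' (j, l))"
    by (simp add: sum.cartesian_product' )
  also have "\<dots> = (\<Sum>i\<in>F1. \<Sum>j\<in>G1. \<Sum>k\<in>F2. \<Sum>l\<in>G2. d' (i, k) * inner_block A i j (k, l) * c' (j, l))"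
    by (intro sum.cong refl, subst sum.swap) (simp add: inner_block_def)
  finally have "cmod (\<Sum>x\<in>F. \<Sum>y\<in>G. d x * flatten A (x, y) * c y)
      \<le> (\<Sum>i\<in>F1. \<Sum>j\<in>G1. a i j * \<delta> i * \<gamma> j)"
    unfolding \<gamma>\<delta> by (auto intro!: sum_norm_le form_boundedD A fin)
  \<comment> \<open>All factors are real; writing the sum as a real part makes the complex form
    bound of \<open>M\<close> available.\<close>
  also have "\<dots> = Re (\<Sum>i\<in>F1. \<Sum>j\<in>G1. of_real (\<delta> i) * M (i, j) * of_real (\<gamma> j))"
    by (simp add: A(2) mult_ac)
  also have "\<dots> \<le> cmod (\<Sum>i\<in>F1. \<Sum>j\<in>G1. of_real (\<delta> i) * M (i, j) * of_real (\<gamma> j))"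
    by (rule complex_Re_le_cmod)
  also have "\<dots> \<le> C * finnorm (\<lambda>i. of_real (\<delta> i)) F1 * finnorm (\<lambda>j. of_real (\<gamma> j)) G1"
    by (rule form_boundedD[OF M fin(1,3)])
  also have "\<dots> = C * finnorm d F * finnorm c G"
    unfolding \<gamma>\<delta> c'd' by (simp only: restrict sub fin)
  finally show "cmod (\<Sum>x\<in>F. \<Sum>y\<in>G. d x * flatten A (x, y) * c y) \<le> C * finnorm d F * finnorm c G" .
qed

text \<open>Block multiplication: with the sum over \<open>n\<close> inside, the inner sum is an
  entry of the product of the blocks at \<open>(i, m)\<close> and \<open>(m, j)\<close>, and the sum
  over \<open>m\<close> converges as an iterated sum of a summable family on pairs.\<close>

lemma inner_block_mult_has_sum:
  assumes "mat_bounded (flatten A)" "mat_bounded (flatten B)"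
    and "\<And>m. mat_bounded (inner_block A i m)" "\<And>m. mat_bounded (inner_block B m j)"
  shows "((\<lambda>m. mat_mult (inner_block A i m) (inner_block B m j) (k, l)) has_sum
    inner_block (tensor_mult A B) i j (k, l)) UNIV"
proof -
  let ?f = "\<lambda>m n. A (i, k, n, m) * B (m, n, l, j)"
  have "((\<lambda>m. infsum (?f m) UNIV) has_sum inner_block (tensor_mult A B) i j (k, l)) UNIV"
    unfolding inner_block_def prod.case tensor_mult_altdef[OF assms(1,2)]
    using summable_on_Sigma_banach[of ?f UNIV "\<lambda>_. UNIV"]
      flatten_product_summable[OF assms(1,2), of i k l j]
    by (intro has_sum_infsum) simp
  then show ?thesis by (simp add: mat_mult_def inner_block_def)
qed

context solid_spectral_matrix_algebra
begin

text \<open>If \<open>M (i, j) \<noteq> 0\<close>, then by solidity the elementary matrix at \<open>(i, j)\<close> belongs to the algebra and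
  \<open>M (i, j)\<close> times its norm is at most the norm of \<open>M\<close>.\<close>

lemma entry_bound: "\<exists>C. \<forall>M\<in>\<M>. cmod (M (i, j)) \<le> C * nrm M"
proof -
  let ?E = "\<lambda>x. if x = (i, j) then 1 else 0 :: complex"
  show ?thesis
  proof (cases "?E \<in> \<M>")
    case True
    then have pos: "nrm ?E > 0"
      using nrm_eq_zero_iff[OF True] nrm_nonneg[OF True] by (metis less_eq_real_def zero_neq_one)
    have "cmod (M (i, j)) \<le> 1 / nrm ?E * nrm M" if "M \<in> \<M>" for M
    proof -
      have "nrm (\<lambda>x. M (i, j) * ?E x) \<le> nrm M"
        by (rule nrm_solid[OF that]) auto
      then show ?thesis using pos by (simp add: nrm_scale[OF True] field_simps)
    qed
    then show ?thesis by blast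
  next
    case False
    have "M (i, j) = 0" if "M \<in> \<M>" for M
    proof (rule ccontr)
      assume nz: "M (i, j) \<noteq> 0"
      have "?E \<in> \<M>"
        by (rule solid[OF scale_closed[OF that, of "1 / M (i, j)"]]) (use nz in auto)
      with False show False ..
    qed
    then show ?thesis by (intro exI[of _ 0]) auto
  qed
qed

section \<open>Membership in the first tensor space\<close>

lemma mem_tilde1_iff: "A \<in> tilde1 \<M> nrm \<longleftrightarrow>
    (\<forall>i j. mat_bounded (inner_block A i j)) \<and> inner_block_norms A \<in> \<M>"
  by (simp add: tilde1_def tilde1_norm_def)

lemma tilde1_blocks:
  assumes "A \<in> tilde1 \<M> nrm"
  shows "form_bounded (inner_block A i j) (mat_op_norm (inner_block A i j))"
    and "mat_bounded (inner_block A i j)" and "inner_block_norms A \<in> \<M>"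
    and "cmod (inner_block_norms A (i, j)) = mat_op_norm (inner_block A i j)"
  using assms mat_op_norm_nonneg[of "inner_block A i j"] form_bounded_mat_op_norm
  by (auto simp: mem_tilde1_iff inner_block_norms_def)

text \<open>Working criterion: any matrix of the algebra that majorises the block norms entrywise
  suffices, since solidity yields both membership and the norm estimate. Its entries enter through
  their moduli, so the majorant may be complex.\<close>

lemma tilde1I:
  assumes "M \<in> \<M>" "\<And>i j. form_bounded (inner_block A i j) (cmod (M (i, j)))"
  shows "A \<in> tilde1 \<M> nrm" and "nrm (inner_block_norms A) \<le> nrm M"
proof -
  have "cmod (inner_block_norms A (i, j)) \<le> cmod (M (i, j))" for i j
    using form_bounded_imp_mat_bounded[OF assms(2)] mat_op_norm_nonneg[of "inner_block A i j"]
    by (simp add: inner_block_norms_def)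
  from solid[OF assms(1) this] nrm_solid[OF assms(1) this]
  show "A \<in> tilde1 \<M> nrm" "nrm (inner_block_norms A) \<le> nrm M"
    using form_bounded_imp_mat_bounded[OF assms(2)] by (auto simp: mem_tilde1_iff)
qed

section \<open>Algebra operations and completeness of the first tensor space\<close>

lemma inner_block_zero: "inner_block (\<lambda>_. 0) i j = (\<lambda>_. 0)"
  by (auto simp: inner_block_def)

lemma tilde1_zero: "(\<lambda>_. 0) \<in> tilde1 \<M> nrm"
  by (rule tilde1I[OF zero_closed]) (simp add: inner_block_zero form_bounded_zero)

lemma tilde1_add:
  assumes "A \<in> tilde1 \<M> nrm" "B \<in> tilde1 \<M> nrm"
  shows "(\<lambda>x. A x + B x) \<in> tilde1 \<M> nrm"
    and "nrm (inner_block_norms (\<lambda>x. A x + B x)) \<le> nrm (inner_block_norms A) + nrm (inner_block_norms B)"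
proof -
  let ?M = "\<lambda>x. inner_block_norms A x + inner_block_norms B x"
  note AB = tilde1_blocks[OF assms(1)] tilde1_blocks[OF assms(2)]
  have M: "?M \<in> \<M>" by (intro add_closed AB)
  have "form_bounded (inner_block (\<lambda>x. A x + B x) i j) (cmod (?M (i, j)))" for i j
  proof (rule form_bounded_mono)
    show "form_bounded (inner_block (\<lambda>x. A x + B x) i j)
        (mat_op_norm (inner_block A i j) + mat_op_norm (inner_block B i j))"
      using form_bounded_add[OF AB(1) AB(5)] by (simp add: inner_block_def case_prod_unfold)
    show "mat_op_norm (inner_block A i j) + mat_op_norm (inner_block B i j) \<le> cmod (?M (i, j))"
      using complex_Re_le_cmod[of "?M (i, j)"] by (simp add: inner_block_norms_def)
  qed
  note tilde1I[OF M this]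
  then show "(\<lambda>x. A x + B x) \<in> tilde1 \<M> nrm"
    "nrm (inner_block_norms (\<lambda>x. A x + B x)) \<le> nrm (inner_block_norms A) + nrm (inner_block_norms B)"
    using nrm_triangle[OF AB(3,7)] by auto
qed

lemma tilde1_scale:
  assumes "A \<in> tilde1 \<M> nrm"
  shows "(\<lambda>x. a * A x) \<in> tilde1 \<M> nrm"
    and "nrm (inner_block_norms (\<lambda>x. a * A x)) = cmod a * nrm (inner_block_norms A)"
proof -
  have blk: "inner_block (\<lambda>x. a * A x) i j = (\<lambda>x. a * inner_block A i j x)" for i j
    by (auto simp: inner_block_def)
  have nb: "inner_block_norms (\<lambda>x. a * A x) = (\<lambda>x. of_real (cmod a) * inner_block_norms A x)"
    using tilde1_blocks[OF assms] by (auto simp: inner_block_norms_def blk mat_bounded_scale)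
  show "(\<lambda>x. a * A x) \<in> tilde1 \<M> nrm"
    "nrm (inner_block_norms (\<lambda>x. a * A x)) = cmod a * nrm (inner_block_norms A)"
    using tilde1_blocks[OF assms] unfolding mem_tilde1_iff nb
    by (auto simp: blk mat_bounded_scale scale_closed nrm_scale)
qed

lemma tilde1_diff:
  assumes "A \<in> tilde1 \<M> nrm" "B \<in> tilde1 \<M> nrm"
  shows "(\<lambda>x. A x - B x) \<in> tilde1 \<M> nrm"
  using tilde1_add(1)[OF assms(1) tilde1_scale(1)[OF assms(2), of "- 1"]] by simp

lemma tilde1_entry_bound: "\<exists>C. \<forall>A\<in>tilde1 \<M> nrm. cmod (A x) \<le> C * nrm (inner_block_norms A)"
proof -
  obtain i k l j where x: "x = (i, k, l, j)" by (metis surj_pair)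
  obtain C where C: "\<And>M. M \<in> \<M> \<Longrightarrow> cmod (M (i, j)) \<le> C * nrm M" using entry_bound by blast
  have "cmod (A x) \<le> C * nrm (inner_block_norms A)" if "A \<in> tilde1 \<M> nrm" for A
    using form_bounded_entry[OF tilde1_blocks(1)[OF that], of i j k l] tilde1_blocks(3,4)[OF that]
      C[of "inner_block_norms A"] by (simp add: x inner_block_def)
  then show ?thesis by blast
qed

text \<open>The matrix of block norms belongs to the algebra, hence acts boundedly and supplies the
  constant in \<open>form_bounded_flatten\<close>. This makes the identities for bounded matrices
  available for tensors.\<close>

lemma tilde1_flatten:
  assumes "A \<in> tilde1 \<M> nrm"
  shows "mat_bounded (flatten A)"
  by (rule form_bounded_imp_mat_bounded(1)[OF form_bounded_flatten[OF
      form_bounded_mat_op_norm[OF bounded[OF tilde1_blocks(3)[OF assms]]] tilde1_blocks(1)[OF assms]]])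
     (simp add: inner_block_norms_def)

lemma tilde1_mult:
  assumes "A \<in> tilde1 \<M> nrm" "B \<in> tilde1 \<M> nrm"
  shows "tensor_mult A B \<in> tilde1 \<M> nrm"
    and "nrm (inner_block_norms (tensor_mult A B)) \<le> nrm (inner_block_norms A) * nrm (inner_block_norms B)"
proof -
  let ?a = "inner_block_norms A" and ?b = "inner_block_norms B"
  note A = tilde1_blocks[OF assms(1)] and B = tilde1_blocks[OF assms(2)]
  have M: "mat_mult ?a ?b \<in> \<M>" by (intro mult_closed A B)
  have "form_bounded (inner_block (tensor_mult A B) i j) (cmod (mat_mult ?a ?b (i, j)))" for i j
  \<comment> \<open>The block is a sum of block products over \<open>m\<close>; their bounds add up
    to the real part of the entry of \<open>mat_mult ?a ?b\<close>, which is at most its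
    modulus.\<close>
  proof (rule form_bounded_mono[OF _ complex_Re_le_cmod], rule form_bounded_has_sum)
    show "((\<lambda>m. mat_mult (inner_block A i m) (inner_block B m j) (k, l)) has_sum
        inner_block (tensor_mult A B) i j (k, l)) UNIV" for k l
      by (intro inner_block_mult_has_sum tilde1_flatten assms A B)
    have "((\<lambda>m. ?a (i, m) * ?b (m, j)) has_sum mat_mult ?a ?b (i, j)) UNIV"
      by (intro mat_mult_has_sum bounded A B)
    from has_sum_bounded_linear[OF bounded_linear_Re this]
    show "((\<lambda>m. mat_op_norm (inner_block A i m) * mat_op_norm (inner_block B m j)) has_sum
        Re (mat_mult ?a ?b (i, j))) UNIV"
      by (simp add: inner_block_norms_def)
    show "form_bounded (mat_mult (inner_block A i m) (inner_block B m j))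
        (mat_op_norm (inner_block A i m) * mat_op_norm (inner_block B m j))" for m
      by (rule form_bounded_mono[OF form_bounded_mat_op_norm mat_mult_bounded(3)[OF A(2) B(2)]])
        (rule mat_mult_bounded(2)[OF A(2) B(2)])
  qed
  from tilde1I[OF M this] show "tensor_mult A B \<in> tilde1 \<M> nrm"
    "nrm (inner_block_norms (tensor_mult A B)) \<le> nrm (inner_block_norms A) * nrm (inner_block_norms B)"
    using nrm_mult[OF A(3) B(3)] by auto
qed

text \<open>The adjoint exchanges the blocks at \<open>(i, j)\<close> and \<open>(j, i)\<close> and
  takes the adjoint of each, which keeps its norm. The block norm matrix is thus replaced by its
  adjoint, and the matrix involution is isometric.\<close>

lemma tilde1_adjoint:
  assumes "A \<in> tilde1 \<M> nrm"
  shows "tensor_adjoint A \<in> tilde1 \<M> nrm"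
    and "nrm (inner_block_norms (tensor_adjoint A)) = nrm (inner_block_norms A)"
proof -
  have blk: "inner_block (tensor_adjoint A) i j = mat_adjoint (inner_block A j i)" for i j
    by (auto simp: inner_block_def tensor_adjoint_def mat_adjoint_def)
  have nb: "inner_block_norms (tensor_adjoint A) = mat_adjoint (inner_block_norms A)"
    using tilde1_blocks[OF assms] by (auto simp: inner_block_norms_def blk mat_bounded_adjoint mat_adjoint_def[of "case_prod _"])
  show "tensor_adjoint A \<in> tilde1 \<M> nrm"
    "nrm (inner_block_norms (tensor_adjoint A)) = nrm (inner_block_norms A)"
    using tilde1_blocks[OF assms] unfolding mem_tilde1_iff nb
    by (auto simp: blk mat_bounded_adjoint star_closed nrm_star)
qed

text \<open>The differences \<open>D m n\<close> have block norm matrices that form a Cauchy sequence in \<open>m\<close>, because by the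
  reverse triangle inequality and solidity two of them differ by at most the block norms of \<open>D m k\<close>.
  Their limit \<open>E\<close> in the algebra bounds the blocks of \<open>L - X n\<close>.\<close>

lemma tilde1_complete:
  fixes X :: "nat \<Rightarrow> ('a, 'k) tensor4"
  assumes X: "\<And>n. X n \<in> tilde1 \<M> nrm"
    and cauchy: "\<And>r. r > 0 \<Longrightarrow> \<exists>N. \<forall>m\<ge>N. \<forall>n\<ge>N. nrm (inner_block_norms (\<lambda>x. X m x - X n x)) < r"
  shows "\<exists>L\<in>tilde1 \<M> nrm. (\<lambda>n. nrm (inner_block_norms (\<lambda>x. X n x - L x))) \<longlonglongrightarrow> 0"
proof -
  define D where "D m n = (\<lambda>x. X m x - X n x)" for m n
  let ?d = "\<lambda>m n. inner_block_norms (D m n)"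
  have D: "D m n \<in> tilde1 \<M> nrm" for m n unfolding D_def by (intro tilde1_diff X)
  note blk = tilde1_blocks[OF D]
  have cauchy: "\<exists>N. \<forall>m\<ge>N. \<forall>n\<ge>N. nrm (?d m n) < r" if "r > 0" for r
    using cauchy[OF that] by (simp add: D_def)
  \<comment> \<open>Evaluation is controlled by the norm, so the entries are Cauchy; their limits
    form the candidate \<open>L\<close>.\<close>
  have "convergent (\<lambda>n. X n x)" for x
  proof -
    obtain C where C: "\<And>A. A \<in> tilde1 \<M> nrm \<Longrightarrow> cmod (A x) \<le> C * nrm (inner_block_norms A)"
      using tilde1_entry_bound by blast
    have "Cauchy (\<lambda>n. X n x)"
      unfolding Cauchy_iff
    proof (intro allI impI)
      fix e :: real assume e: "e > 0"
      \<comment> \<open>The sign of \<open>C\<close> is unknown; the enlarged constant is positive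
        and can be divided by.\<close>
      define C' where "C' = \<bar>C\<bar> + 1"
      have C': "C' > 0" "C \<le> C'" by (auto simp: C'_def)
      obtain N where N: "\<And>m n. m \<ge> N \<Longrightarrow> n \<ge> N \<Longrightarrow> nrm (?d m n) < e / C'"
        using cauchy[of "e / C'"] e C' by auto
      have "cmod (X m x - X n x) < e" if "m \<ge> N" "n \<ge> N" for m n
      proof -
        have "cmod (X m x - X n x) \<le> C * nrm (?d m n)" using C[OF D, of m n] by (simp add: D_def)
        also have "\<dots> \<le> C' * nrm (?d m n)" by (intro mult_right_mono C' nrm_nonneg blk)
        also have "\<dots> < e" using N[OF that] C' by (simp add: field_simps)
        finally show ?thesis .
      qed
      then show "\<exists>N. \<forall>m\<ge>N. \<forall>n\<ge>N. cmod (X m x - X n x) < e" by blast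
    qed
    then show ?thesis by (rule Cauchy_convergent)
  qed
  then obtain L where L: "\<And>x. (\<lambda>n. X n x) \<longlonglongrightarrow> L x" unfolding convergent_def by metis
  have key: "\<exists>E\<in>\<M>. (\<lambda>m. nrm (\<lambda>x. ?d m n x - E x)) \<longlonglongrightarrow> 0" for n
  proof (rule nrm_complete)
    show "?d m n \<in> \<M>" for m by (rule blk)
    fix r :: real assume "r > 0"
    then obtain N where N: "\<And>m k. m \<ge> N \<Longrightarrow> k \<ge> N \<Longrightarrow> nrm (?d m k) < r" using cauchy by blast
    have "nrm (\<lambda>x. ?d m n x - ?d k n x) < r" if "m \<ge> N" "k \<ge> N" for m k
    proof -
      have tri: "mat_op_norm (inner_block (D m n) i j) \<le>
          mat_op_norm (inner_block (D k n) i j) + mat_op_norm (inner_block (D m k) i j)" for i j m k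
      proof -
        have "inner_block (D m n) i j = (\<lambda>x. inner_block (D k n) i j x + inner_block (D m k) i j x)"
          by (auto simp: inner_block_def D_def)
        then show ?thesis using mat_bounded_add(2)[OF blk(2) blk(2)] by simp
      qed
      have "nrm (\<lambda>x. ?d m n x - ?d k n x) \<le> nrm (?d m k)"
      proof (rule nrm_solid[OF blk(3)])
        fix i j
        \<comment> \<open>The reverse triangle inequality uses the difference in both orders, so the
          two orders must have equal block norms.\<close>
        have "inner_block (D k m) i j = (\<lambda>x. - 1 * inner_block (D m k) i j x)"
          by (auto simp: inner_block_def D_def)
        then have "mat_op_norm (inner_block (D k m) i j) = mat_op_norm (inner_block (D m k) i j)"
          using mat_bounded_scale(2)[OF blk(2), of "- 1"] by simp
        then show "cmod (?d m n (i, j) - ?d k n (i, j)) \<le> cmod (?d m k (i, j))"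
          using tri[of m i j k] tri[of k i j m] unfolding blk(4)
          by (simp add: inner_block_norms_def flip: of_real_diff)
      qed
      then show ?thesis using N[OF that] by simp
    qed
    then show "\<exists>N. \<forall>m\<ge>N. \<forall>k\<ge>N. nrm (\<lambda>x. ?d m n x - ?d k n x) < r" by blast
  qed
  \<comment> \<open>With \<open>L\<close> first, the remainder is the entrywise limit of
    \<open>D m n\<close> as \<open>m\<close> grows.\<close>
  define R where "R n = (\<lambda>x. L x - X n x)" for n
  have R: "R n \<in> tilde1 \<M> nrm"
    "(\<And>m. m \<ge> N \<Longrightarrow> nrm (?d m n) < r) \<Longrightarrow> nrm (inner_block_norms (R n)) \<le> r" for n N r
  proof -
    obtain E where E: "E \<in> \<M>" "(\<lambda>m. nrm (\<lambda>x. ?d m n x - E x)) \<longlonglongrightarrow> 0" using key by blast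
    have "(\<lambda>m. ?d m n (i, j)) \<longlonglongrightarrow> E (i, j)" for i j
    proof -
      obtain C where C: "\<And>M. M \<in> \<M> \<Longrightarrow> cmod (M (i, j)) \<le> C * nrm M" using entry_bound by blast
      have "(\<lambda>m. ?d m n (i, j) - E (i, j)) \<longlonglongrightarrow> 0"
        by (rule Lim_null_comparison[OF _ tendsto_mult_right_zero[OF E(2), of C]])
           (use C[OF diff_closed[OF blk(3) E(1)]] in auto)
      then show ?thesis by (simp add: LIM_zero_iff)
    qed
    then have lim: "(\<lambda>m. cmod (?d m n (i, j))) \<longlonglongrightarrow> cmod (E (i, j))" for i j
      by (rule tendsto_norm)
    have "form_bounded (inner_block (R n) i j) (cmod (E (i, j)))" for i j
    proof (rule form_bounded_tendsto[OF _ lim])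
      show "(\<lambda>m. inner_block (D m n) i j (k, l)) \<longlonglongrightarrow> inner_block (R n) i j (k, l)" for k l
        by (auto simp: inner_block_def R_def D_def intro!: tendsto_intros L)
    qed (simp_all add: blk)
    note RE = tilde1I[OF E(1) this]
    show "R n \<in> tilde1 \<M> nrm" by (rule RE)
    assume N: "\<And>m. m \<ge> N \<Longrightarrow> nrm (?d m n) < r"
    \<comment> \<open>Split \<open>E\<close> into \<open>E - ?d m n\<close>, whose norm tends to 0
      in \<open>m\<close>, and \<open>?d m n\<close>, whose norm is below \<open>r\<close> from
      \<open>N\<close> on.\<close>
    have "nrm E \<le> r"
    proof (rule tendsto_lowerbound)
      show "(\<lambda>m. nrm (\<lambda>x. ?d m n x - E x) + r) \<longlonglongrightarrow> r"
        using tendsto_add[OF E(2) tendsto_const[of r]] by simp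
      have "nrm E \<le> nrm (\<lambda>x. ?d m n x - E x) + r" if "m \<ge> N" for m
        using nrm_triangle[OF diff_closed[OF E(1) blk(3)] blk(3), of m n m n]
          nrm_diff_commute[OF E(1) blk(3), of m n] N[OF that] by simp
      then show "\<forall>\<^sub>F m in sequentially. nrm E \<le> nrm (\<lambda>x. ?d m n x - E x) + r"
        using eventually_sequentially by blast
    qed simp
    then show "nrm (inner_block_norms (R n)) \<le> r" using RE(2) by linarith
  qed
  \<comment> \<open>One term and its remainder already place \<open>L\<close> in the space; the
    index 0 is arbitrary.\<close>
  have "L = (\<lambda>x. X 0 x + R 0 x)" by (simp add: R_def)
  then have LT: "L \<in> tilde1 \<M> nrm" using tilde1_add(1)[OF X R(1)] by metis
  have "(\<lambda>n. nrm (inner_block_norms (\<lambda>x. X n x - L x))) \<longlonglongrightarrow> 0"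
    unfolding LIMSEQ_iff
  proof (intro allI impI)
    fix r :: real assume r: "r > 0"
    then obtain N where N: "\<And>m n. m \<ge> N \<Longrightarrow> n \<ge> N \<Longrightarrow> nrm (?d m n) < r / 2"
      using cauchy[of "r / 2"] by auto
    have "norm (nrm (inner_block_norms (\<lambda>x. X n x - L x)) - 0) < r" if "n \<ge> N" for n
    proof -
      have "nrm (inner_block_norms (\<lambda>x. X n x - L x)) = nrm (inner_block_norms (R n))"
        using tilde1_scale(2)[OF R(1), of "- 1" n] by (simp add: R_def)
      then show ?thesis
        using R(2)[of N n "r / 2"] N that r nrm_nonneg[OF tilde1_blocks(3)[OF R(1)], of n] by simp
    qed
    then show "\<exists>N. \<forall>n\<ge>N. norm (nrm (inner_block_norms (\<lambda>x. X n x - L x)) - 0) < r" by blast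
  qed
  with LT show ?thesis by blast
qed

text \<open>The laws involving products are pulled back from bounded matrices over pairs through the
  injective map \<open>flatten\<close>. The norm of \<open>A\<close> vanishes only for the zero
  tensor because it controls every entry.\<close>

lemma tilde1_algebra:
  "involutive_banach_algebra (tilde1 \<M> nrm :: ('a, 'k) tensor4 set)
     (\<lambda>A. nrm (inner_block_norms A)) tensor_mult tensor_adjoint"
proof
  fix A B C :: "('a, 'k) tensor4" and a
  assume A: "A \<in> tilde1 \<M> nrm"
  note flat = flatten_add flatten_scale flatten_adjoint flatten_mult tilde1_flatten
    mat_bounded_add(1) mat_bounded_scale(1) mat_bounded_adjoint(1) mat_mult_bounded(2)
  show "nrm (inner_block_norms A) = 0 \<longleftrightarrow> A = (\<lambda>_. 0)"
  proof
    assume *: "nrm (inner_block_norms A) = 0"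
    show "A = (\<lambda>_. 0)"
    proof
      fix x :: "'a \<times> 'k \<times> 'k \<times> 'a"
      obtain C where "\<forall>A\<in>tilde1 \<M> nrm :: ('a, 'k) tensor4 set. cmod (A x) \<le> C * nrm (inner_block_norms A)"
        using tilde1_entry_bound by blast
      with A have "cmod (A x) \<le> C * nrm (inner_block_norms A)" by blast
      with * show "A x = 0" by simp
    qed
  next
    assume "A = (\<lambda>_. 0)"
    then have "inner_block_norms A = (\<lambda>_. 0)"
      by (auto simp: inner_block_norms_def inner_block_zero mat_op_norm_zero)
    then show "nrm (inner_block_norms A) = 0" by (simp add: nrm_zero)
  qed
  show "tensor_adjoint (tensor_adjoint A) = A"
    by (auto simp: tensor_adjoint_def)
  show "tensor_adjoint (\<lambda>x. a * A x) = (\<lambda>x. cnj a * tensor_adjoint A x)"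
    by (auto simp: tensor_adjoint_def)
  assume B: "B \<in> tilde1 \<M> nrm"
  show "tensor_mult (\<lambda>x. a * A x) B = (\<lambda>x. a * tensor_mult A B x)"
    "tensor_mult A (\<lambda>x. a * B x) = (\<lambda>x. a * tensor_mult A B x)"
    by (simp_all add: A B flat mat_mult_scale_left mat_mult_scale_right flip: flatten_inject)
  show "tensor_adjoint (\<lambda>x. A x + B x) = (\<lambda>x. tensor_adjoint A x + tensor_adjoint B x)"
    by (auto simp: tensor_adjoint_def)
  show "tensor_adjoint (tensor_mult A B) = tensor_mult (tensor_adjoint B) (tensor_adjoint A)"
    by (simp add: A B flat mat_adjoint_mult flip: flatten_inject)
  assume C: "C \<in> tilde1 \<M> nrm"
  show "tensor_mult (tensor_mult A B) C = tensor_mult A (tensor_mult B C)"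
    by (simp add: A B C flat mat_mult_assoc_bounded flip: flatten_inject)
  show "tensor_mult (\<lambda>x. A x + B x) C = (\<lambda>x. tensor_mult A C x + tensor_mult B C x)"
    "tensor_mult C (\<lambda>x. A x + B x) = (\<lambda>x. tensor_mult C A x + tensor_mult C B x)"
    by (simp_all add: A B C flat mat_mult_add_left_bounded mat_mult_add_right_bounded flip: flatten_inject)
next
  fix X :: "nat \<Rightarrow> ('a, 'k) tensor4"
  assume "\<And>n. X n \<in> tilde1 \<M> nrm"
    and "\<And>r. r > 0 \<Longrightarrow> \<exists>N. \<forall>m\<ge>N. \<forall>n\<ge>N. nrm (inner_block_norms (\<lambda>x. X m x - X n x)) < r"
  then show "\<exists>L\<in>tilde1 \<M> nrm. (\<lambda>n. nrm (inner_block_norms (\<lambda>x. X n x - L x))) \<longlonglongrightarrow> 0"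
    by (rule tilde1_complete)
qed (fact tilde1_zero | erule (1) tilde1_add | erule (1) tilde1_mult | erule tilde1_scale
    | erule tilde1_adjoint)+

end


section \<open>The algebra of tensors\<close>

text \<open>Exchanges the two index sets in the row pair and in the column pair. Outer blocks become
  inner blocks, so facts about the second tensor space reduce to the first.\<close>

definition tensor_swap :: "('i, 'k) tensor4 \<Rightarrow> ('k, 'i) tensor4" where
  "tensor_swap A = (\<lambda>x. A (case x of (k, i, j, l) \<Rightarrow> (i, k, l, j)))"

lemma tensor_swap_apply [simp]: "tensor_swap A (k, i, j, l) = A (i, k, l, j)"
  by (simp add: tensor_swap_def)

lemma inner_block_tensor_swap: "inner_block (tensor_swap A) = outer_block A"
  by (auto simp: inner_block_def outer_block_def fun_eq_iff)

lemma mem_tilde2_iff: "A \<in> tilde2 \<M> nrm \<longleftrightarrow> tensor_swap A \<in> tilde1 \<M> nrm"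
  by (simp add: tilde1_def tilde1_norm_def tilde2_def tilde2_norm_def inner_block_norms_def
      outer_block_norms_def inner_block_tensor_swap)

lemma outer_block_norms_eq: "outer_block_norms A = inner_block_norms (tensor_swap A)"
  by (simp add: inner_block_norms_def outer_block_norms_def inner_block_tensor_swap)

context solid_spectral_matrix_algebra
begin

lemma tilde2_algebra:
  "involutive_banach_algebra (tilde2 \<M> nrm :: ('i, 'a) tensor4 set)
     (\<lambda>A. nrm (outer_block_norms A)) tensor_mult tensor_adjoint"
proof (rule involutive_banach_algebra_reindex[OF tilde1_algebra])
  show "bij (\<lambda>(k, i, j, l). (i, k, l, j))"
    by (rule bij_betw_byWitness[where f' = "\<lambda>(i, k, l, j). (k, i, j, l)"]) auto
  fix A B :: "('i, 'a) tensor4"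
  show "A \<in> tilde2 \<M> nrm \<longleftrightarrow> (\<lambda>x. A (case x of (k, i, j, l) \<Rightarrow> (i, k, l, j))) \<in> tilde1 \<M> nrm"
    unfolding mem_tilde2_iff tensor_swap_def ..
  show "nrm (outer_block_norms A) = nrm (inner_block_norms (\<lambda>x. A (case x of (k, i, j, l) \<Rightarrow> (i, k, l, j))))"
    unfolding outer_block_norms_eq tensor_swap_def ..
  show "(\<lambda>x. tensor_adjoint A (case x of (k, i, j, l) \<Rightarrow> (i, k, l, j))) =
      tensor_adjoint (\<lambda>x. A (case x of (k, i, j, l) \<Rightarrow> (i, k, l, j)))"
    by (auto simp: tensor_adjoint_def)
  assume "A \<in> tilde2 \<M> nrm" "B \<in> tilde2 \<M> nrm"
  then have "mat_bounded (flatten (tensor_swap A))" "mat_bounded (flatten (tensor_swap B))"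
    by (simp_all add: mem_tilde2_iff tilde1_flatten)
  \<comment> \<open>Swapping also exchanges the order of summation, so the interchanged form on the
    swapped side matches the definition of \<open>tensor_mult A B\<close>.\<close>
  from tensor_mult_altdef[OF this]
  have "tensor_swap (tensor_mult A B) = tensor_mult (tensor_swap A) (tensor_swap B)"
    by (auto simp: fun_eq_iff tensor_mult_def[of A])
  then show "(\<lambda>x. tensor_mult A B (case x of (k, i, j, l) \<Rightarrow> (i, k, l, j))) =
      tensor_mult (\<lambda>x. A (case x of (k, i, j, l) \<Rightarrow> (i, k, l, j))) (\<lambda>x. B (case x of (k, i, j, l) \<Rightarrow> (i, k, l, j)))"
    by (simp add: tensor_swap_def)
qed

lemma tilde2_entry_bound:
  "\<exists>C. \<forall>A\<in>(tilde2 \<M> nrm :: ('i, 'a) tensor4 set). cmod (A x) \<le> C * nrm (outer_block_norms A)"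
proof -
  obtain i k l j where x: "x = (i, k, l, j)" by (metis surj_pair)
  obtain C where C: "\<forall>A\<in>(tilde1 \<M> nrm :: ('a, 'i) tensor4 set). cmod (A (k, i, j, l)) \<le> C * nrm (inner_block_norms A)"
    using tilde1_entry_bound by blast
  show ?thesis
  proof (intro exI ballI)
    fix A :: "('i, 'a) tensor4" assume "A \<in> tilde2 \<M> nrm"
    then have "tensor_swap A \<in> tilde1 \<M> nrm" by (simp only: mem_tilde2_iff)
    with C have "cmod (tensor_swap A (k, i, j, l)) \<le> C * nrm (inner_block_norms (tensor_swap A))" by blast
    then show "cmod (A x) \<le> C * nrm (outer_block_norms A)" by (simp add: x outer_block_norms_eq)
  qed
qed

end

section \<open>The intersection of the two tensor spaces\<close>

lemma tensor_algebra_banach: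
  assumes "solid_spectral_matrix_algebra \<A>1 nrm1" "solid_spectral_matrix_algebra \<A>2 nrm2"
  shows "involutive_banach_algebra (tensor_algebra \<A>1 nrm1 \<A>2 nrm2)
    (tensor_algebra_norm \<A>1 nrm1 \<A>2 nrm2) tensor_mult tensor_adjoint"
proof -
  interpret A1: solid_spectral_matrix_algebra \<A>1 nrm1 by fact
  interpret A2: solid_spectral_matrix_algebra \<A>2 nrm2 by fact
  show ?thesis
    unfolding tensor_algebra_def
  proof (rule involutive_banach_algebra_Int[OF A1.tilde1_algebra A2.tilde2_algebra])
    fix A :: "('a, 'b) tensor4"
    assume "A \<in> tilde1 \<A>1 nrm1" "A \<in> tilde2 \<A>2 nrm2"
    then have "tilde1_norm \<A>1 nrm1 A = ereal (nrm1 (inner_block_norms A))"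
      "tilde2_norm \<A>2 nrm2 A = ereal (nrm2 (outer_block_norms A))"
      by (auto simp: tilde1_def tilde1_norm_def tilde2_def tilde2_norm_def split: if_splits)
    then show "tensor_algebra_norm \<A>1 nrm1 \<A>2 nrm2 A =
        max (nrm1 (inner_block_norms A)) (nrm2 (outer_block_norms A))"
      by (simp add: tensor_algebra_norm_def flip: ereal_max)
  qed (fact A1.tilde1_entry_bound A2.tilde2_entry_bound)+
qed

section \<open>Tensors of Kronecker form and the Gram tensor\<close>

lemma (in solid_spectral_matrix_algebra) tilde1_kroneckerI:
  assumes "M \<in> \<M>" "mat_bounded N"
    and "\<And>i j. inner_block A i j = (\<lambda>x. a i j * N x)" "\<And>i j. cmod (a i j) = cmod (M (i, j))"
  shows "A \<in> tilde1 \<M> nrm"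
proof (rule tilde1I(1))
  \<comment> \<open>The majorant is \<open>M\<close> scaled by the norm of the common block
    \<open>N\<close>; only the moduli of the factors matter, which admits conjugated
    entries.\<close>
  show "(\<lambda>x. of_real (mat_op_norm N) * M x) \<in> \<M>" by (rule scale_closed[OF assms(1)])
  show "form_bounded (inner_block A i j) (cmod (of_real (mat_op_norm N) * M (i, j)))" for i j
    using form_bounded_scale[OF form_bounded_mat_op_norm[OF assms(2)], of "a i j"] mat_op_norm_nonneg[OF assms(2)]
    by (simp add: assms(3,4) norm_mult mult.commute)
qed

text \<open>The conjugate arises because an elementary tensor depends conjugate-linearly on its
  first argument.\<close>

lemma gram_tensor_tensor_family:
  "gram_tensor (tensor_family \<psi>1 \<psi>2) (i, k, l, j) = cnj (gram_matrix \<psi>1 (i, j)) * gram_matrix \<psi>2 (k, l)"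
  by (simp add: gram_tensor_def tensor_family_def gram_matrix_def cinner_elementary_tensor)

lemma gram_tensor_mem:
  assumes "solid_spectral_matrix_algebra \<A>1 nrm1" "solid_spectral_matrix_algebra \<A>2 nrm2"
    and G1: "gram_matrix \<psi>1 \<in> \<A>1" and G2: "gram_matrix \<psi>2 \<in> \<A>2"
  shows "gram_tensor (tensor_family \<psi>1 \<psi>2) \<in> tensor_algebra \<A>1 nrm1 \<A>2 nrm2"
proof -
  interpret A1: solid_spectral_matrix_algebra \<A>1 nrm1 by fact
  interpret A2: solid_spectral_matrix_algebra \<A>2 nrm2 by fact
  let ?G = "gram_tensor (tensor_family \<psi>1 \<psi>2)"
  have "?G \<in> tilde1 \<A>1 nrm1"
  proof (rule A1.tilde1_kroneckerI[OF G1 A2.bounded[OF G2]])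
    show "inner_block ?G i j = (\<lambda>x. cnj (gram_matrix \<psi>1 (i, j)) * gram_matrix \<psi>2 x)" for i j
      by (auto simp: inner_block_def gram_tensor_tensor_family)
  qed simp
  moreover have "tensor_swap ?G \<in> tilde1 \<A>2 nrm2"
  proof (rule A2.tilde1_kroneckerI[OF G2])
    \<comment> \<open>In the swapped tensor the conjugated Gram matrix of \<open>\<psi>1\<close> is
      the common block; form bounds survive entrywise conjugation.\<close>
    show "mat_bounded (\<lambda>x. cnj (gram_matrix \<psi>1 x))"
      by (rule form_bounded_imp_mat_bounded(1)[OF form_bounded_cnj[OF form_bounded_mat_op_norm[OF A1.bounded[OF G1]]]])
    show "inner_block (tensor_swap ?G) k l = (\<lambda>x. gram_matrix \<psi>2 (k, l) * cnj (gram_matrix \<psi>1 x))" for k l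
      by (auto simp: inner_block_def gram_tensor_tensor_family mult.commute)
  qed simp
  ultimately show ?thesis by (simp add: tensor_algebra_def mem_tilde2_iff)
qed

lemma tensor_inverse_closed_Int:
  "tensor_inverse_closed X \<Longrightarrow> tensor_inverse_closed Y \<Longrightarrow> tensor_inverse_closed (X \<inter> Y)"
  unfolding tensor_inverse_closed_def by blast


section \<open>Tensor products of frames\<close>

lemma Parseval_norm: "is_onb S \<Longrightarrow> ((\<lambda>e. (cmod (cinner x e))\<^sup>2) has_sum (norm x)\<^sup>2) S"
  using has_sum_bounded_linear[OF bounded_linear_Re Parseval[of S x x]]
  by (simp only: cinner_self complex_norm_square[symmetric] Re_complex_of_real)

lemma cmod_cinner_commute: "cmod (cinner x y) = cmod (cinner y x)"
  by (subst cinner_commute) simp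

text \<open>Tonelli for unconditional sums: for nonnegative terms one convergent iterated sum gives
  summability on the product, after which the order may be exchanged.\<close>

lemma has_sum_swap_nonneg:
  fixes f :: "'x \<Rightarrow> 'y \<Rightarrow> real"
  assumes nonneg: "\<And>x y. x \<in> A \<Longrightarrow> y \<in> B \<Longrightarrow> 0 \<le> f x y"
    and f: "\<And>x. x \<in> A \<Longrightarrow> (f x has_sum g x) B" "(g has_sum s) A"
    and h: "\<And>y. y \<in> B \<Longrightarrow> ((\<lambda>x. f x y) has_sum h y) A"
  shows "(h has_sum s) B"
proof -
  have "(\<lambda>(x, y). f x y) summable_on A \<times> B"
    by (rule summable_on_SigmaI[where g = g]) (use assms in \<open>auto intro: has_sum_imp_summable\<close>)
  then have "((\<lambda>(x, y). f x y) has_sum s) (A \<times> B)"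
    by (intro has_sum_SigmaI[where g = g]) (use f in auto)
  then have "((\<lambda>(y, x). f x y) has_sum s) (B \<times> A)"
    by (subst (asm) has_sum_swap) (simp add: case_prod_unfold)
  then show ?thesis
    by (rule has_sum_Sigma') (use h in auto)
qed

text \<open>The vector \<open>y\<close> is the adjoint of \<open>T\<close> applied to \<open>e\<close>, defined by its coordinates in the
  orthonormal basis.\<close>

lemma hs_adjoint_vector:
  fixes T :: "('a::chilbert_space, 'b::chilbert_space) hs"
  obtains y where "\<And>x. cinner (hs_apply T x) e = cinner x y"
    and "((\<lambda>f. (cmod (cinner (hs_apply T f) e))\<^sup>2) has_sum (norm y)\<^sup>2) some_onb"
proof -
  let ?a = "\<lambda>f. cnj (cinner (hs_apply T f) e)"
  \<comment> \<open>By Cauchy-Schwarz the coordinates are dominated by the norms of \<open>T\<close>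
    on the basis, which are square-summable.\<close>
  have "(\<lambda>f. (cmod (?a f))\<^sup>2) summable_on some_onb"
  proof (rule summable_on_comparison_test)
    show "(\<lambda>f. (norm (hs_apply T f))\<^sup>2 * (norm e)\<^sup>2) summable_on some_onb"
      by (intro summable_on_cmult_left hs_summable)
    show "(cmod (?a f))\<^sup>2 \<le> (norm (hs_apply T f))\<^sup>2 * (norm e)\<^sup>2" for f
      using power_mono[OF cinner_Cauchy_Schwarz[of "hs_apply T f" e], of 2]
      by (simp add: power_mult_distrib)
  qed simp
  then have sm: "(\<lambda>f. ?a f *\<^sub>C f) summable_on some_onb"
    by (rule orthogonal_series_summable[OF orthonormal_some_onb])
  define y where "y = (\<Sum>\<^sub>\<infinity>f\<in>some_onb. ?a f *\<^sub>C f)"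
  have hy: "((\<lambda>f. ?a f *\<^sub>C f) has_sum y) some_onb" unfolding y_def using sm by simp
  have yf: "cinner y f = ?a f" if f: "f \<in> some_onb" for f
  proof -
    have "((\<lambda>g. cinner (?a g *\<^sub>C g) f) has_sum cinner y f) some_onb"
      by (rule has_sum_bounded_linear[OF bounded_linear_cinner_left hy])
    moreover have "((\<lambda>g. cinner (?a g *\<^sub>C g) f) has_sum ?a f) some_onb"
      using f orthonormal_some_onb
      by (intro has_sum_finite_neutralI[where B = "{f}"]) (auto simp: orthonormal_def)
    ultimately show ?thesis by (rule has_sum_unique)
  qed
  show thesis
  proof
    fix x
    have "((\<lambda>f. cinner x f * cnj (cinner y f)) has_sum cinner x y) some_onb"
      by (rule Parseval[OF some_onb])
    then have "((\<lambda>f. cinner x f * cinner (hs_apply T f) e) has_sum cinner x y) some_onb"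
      by (rule has_sum_cong[THEN iffD1, rotated]) (simp add: yf)
    moreover have "((\<lambda>f. hs_apply T (cinner x f *\<^sub>C f)) has_sum hs_apply T x) some_onb"
      by (rule has_sum_bounded_linear[OF bounded_linear_hs_apply onb_expansion[OF some_onb]])
    from has_sum_bounded_linear[OF bounded_linear_cinner_left this, of e]
    have "((\<lambda>f. cinner x f * cinner (hs_apply T f) e) has_sum cinner (hs_apply T x) e) some_onb"
      by (simp add: hs_apply_scaleC)
    ultimately show "cinner (hs_apply T x) e = cinner x y" by (rule has_sum_unique[rotated])
  next
    have "((\<lambda>f. (cmod (cinner y f))\<^sup>2) has_sum (norm y)\<^sup>2) some_onb"
      by (rule Parseval_norm[OF some_onb])
    then show "((\<lambda>f. (cmod (cinner (hs_apply T f) e))\<^sup>2) has_sum (norm y)\<^sup>2) some_onb"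
      by (rule has_sum_cong[THEN iffD1, rotated]) (simp add: yf)
  qed
qed

section \<open>Frame inequalities under Hilbert-Schmidt operators and tensor products\<close>

lemma is_frame_iff: "is_frame \<psi> \<longleftrightarrow> (\<exists>A>0. \<exists>B>0. \<forall>f. \<exists>s.
    ((\<lambda>i. (cmod (cinner f (\<psi> i)))\<^sup>2) has_sum s) UNIV \<and> A * (norm f)\<^sup>2 \<le> s \<and> s \<le> B * (norm f)\<^sup>2)"
proof -
  have *: "(f summable_on UNIV \<and> L \<le> infsum f UNIV \<and> infsum f UNIV \<le> U) \<longleftrightarrow>
      (\<exists>s. (f has_sum s) UNIV \<and> L \<le> s \<and> s \<le> U)" for f :: "'a \<Rightarrow> real" and L U
    by (auto simp: summable_on_def dest: infsumI)
  show ?thesis unfolding is_frame_def * ..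
qed

text \<open>Expand the image of \<open>\<psi> i\<close> in an orthonormal basis and move
  \<open>T\<close> to the other side as \<open>y e\<close>. Exchanging the sums leaves the frame
  sums \<open>q (y e)\<close>, which are compared with the squared norms of the
  \<open>y e\<close>.\<close>

lemma frame_hs_image:
  fixes T :: "('a::chilbert_space, 'b::chilbert_space) hs" and \<psi> :: "'i \<Rightarrow> 'a"
  assumes \<psi>: "\<And>f. \<exists>s. ((\<lambda>i. (cmod (cinner f (\<psi> i)))\<^sup>2) has_sum s) UNIV \<and> A * (norm f)\<^sup>2 \<le> s \<and> s \<le> B * (norm f)\<^sup>2"
  shows "\<exists>s. ((\<lambda>i. (norm (hs_apply T (\<psi> i)))\<^sup>2) has_sum s) UNIV \<and> A * (norm T)\<^sup>2 \<le> s \<and> s \<le> B * (norm T)\<^sup>2"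
proof -
  from \<psi> obtain q where q: "\<And>f. ((\<lambda>i. (cmod (cinner f (\<psi> i)))\<^sup>2) has_sum q f) UNIV"
    "\<And>f. A * (norm f)\<^sup>2 \<le> q f" "\<And>f. q f \<le> B * (norm f)\<^sup>2" by metis
  have "\<forall>e. \<exists>y. (\<forall>x. cinner (hs_apply T x) e = cinner x y) \<and>
      ((\<lambda>f. (cmod (cinner (hs_apply T f) e))\<^sup>2) has_sum (norm y)\<^sup>2) some_onb"
    using hs_adjoint_vector[of T] by metis
  then obtain y where y: "\<And>e x. cinner (hs_apply T x) e = cinner x (y e)"
    and hy: "\<And>e. ((\<lambda>f. (cmod (cinner (hs_apply T f) e))\<^sup>2) has_sum (norm (y e))\<^sup>2) some_onb"
    by metis
  \<comment> \<open>The operator and its adjoint have equal Hilbert-Schmidt norm: both squares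
    evaluate the same double sum over two bases.\<close>
  have Ty: "((\<lambda>e. (norm (y e))\<^sup>2) has_sum (norm T)\<^sup>2) some_onb"
  proof (rule has_sum_swap_nonneg)
    show "((\<lambda>f. (norm (hs_apply T f))\<^sup>2) has_sum (norm T)\<^sup>2) some_onb"
      using has_sum_infsum[OF hs_summable[of T]] by (simp add: norm_hs.rep_eq infsum_nonneg)
    show "((\<lambda>e. (cmod (cinner (hs_apply T f) e))\<^sup>2) has_sum (norm (hs_apply T f))\<^sup>2) some_onb" for f
      by (rule Parseval_norm[OF some_onb])
    show "((\<lambda>f. (cmod (cinner (hs_apply T f) e))\<^sup>2) has_sum (norm (y e))\<^sup>2) some_onb" for e
      by (rule hy)
  qed simp
  \<comment> \<open>The upper frame bound provides a summable majorant, and \<open>q\<close> is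
    nonnegative as a sum of squares.\<close>
  have "(\<lambda>e. q (y e)) summable_on some_onb"
    by (rule summable_on_comparison_test[OF has_sum_imp_summable[OF has_sum_cmult_right[OF Ty, of B]]])
       (rule q(3), rule has_sum_nonneg[OF q(1)], simp)
  then obtain s where s: "((\<lambda>e. q (y e)) has_sum s) some_onb" unfolding summable_on_def by blast
  have "((\<lambda>i. (norm (hs_apply T (\<psi> i)))\<^sup>2) has_sum s) UNIV"
  proof (rule has_sum_swap_nonneg[OF _ _ s])
    show "((\<lambda>i. (cmod (cinner (hs_apply T (\<psi> i)) e))\<^sup>2) has_sum q (y e)) UNIV" for e
      using q(1)[of "y e"] unfolding y cmod_cinner_commute[of _ "y e"] .
    show "((\<lambda>e. (cmod (cinner (hs_apply T (\<psi> i)) e))\<^sup>2) has_sum (norm (hs_apply T (\<psi> i)))\<^sup>2) some_onb" for i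
      by (rule Parseval_norm[OF some_onb])
  qed simp
  moreover have "A * (norm T)\<^sup>2 \<le> s" "s \<le> B * (norm T)\<^sup>2"
    using has_sum_mono[OF has_sum_cmult_right[OF Ty, of A] s] has_sum_mono[OF s has_sum_cmult_right[OF Ty, of B]] q
    by blast+
  ultimately show ?thesis by blast
qed

lemma is_frame_tensor_family:
  fixes \<psi>1 :: "'i::countable \<Rightarrow> 'a::chilbert_space" and \<psi>2 :: "'k::countable \<Rightarrow> 'b::chilbert_space"
  assumes "is_frame \<psi>1" "is_frame \<psi>2"
  shows "is_frame (tensor_family \<psi>1 \<psi>2)"
proof -
  obtain A1 B1 where AB1: "A1 > 0" "B1 > 0"
    and f1: "\<And>f. \<exists>s. ((\<lambda>i. (cmod (cinner f (\<psi>1 i)))\<^sup>2) has_sum s) UNIV \<and> A1 * (norm f)\<^sup>2 \<le> s \<and> s \<le> B1 * (norm f)\<^sup>2"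
    using assms(1) unfolding is_frame_iff by blast
  obtain A2 B2 where AB2: "A2 > 0" "B2 > 0"
    and f2: "\<And>f. \<exists>s. ((\<lambda>i. (cmod (cinner f (\<psi>2 i)))\<^sup>2) has_sum s) UNIV \<and> A2 * (norm f)\<^sup>2 \<le> s \<and> s \<le> B2 * (norm f)\<^sup>2"
    using assms(2) unfolding is_frame_iff by blast
  from f2 obtain q where q: "\<And>f. ((\<lambda>k. (cmod (cinner f (\<psi>2 k)))\<^sup>2) has_sum q f) UNIV"
    "\<And>f. A2 * (norm f)\<^sup>2 \<le> q f" "\<And>f. q f \<le> B2 * (norm f)\<^sup>2" by metis
  \<comment> \<open>The bounds multiply: for fixed \<open>i\<close> the sum over \<open>k\<close>
    contributes \<open>A2\<close> and \<open>B2\<close>, and the remaining sum over \<open>i\<close>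
    contributes \<open>A1\<close> and \<open>B1\<close>.\<close>
  have "\<exists>s. ((\<lambda>x. (cmod (cinner T (tensor_family \<psi>1 \<psi>2 x)))\<^sup>2) has_sum s) UNIV \<and>
      A2 * A1 * (norm T)\<^sup>2 \<le> s \<and> s \<le> B2 * B1 * (norm T)\<^sup>2" for T
  proof -
    let ?n = "\<lambda>i. (norm (hs_apply T (\<psi>1 i)))\<^sup>2"
    obtain t where t: "(?n has_sum t) UNIV" "A1 * (norm T)\<^sup>2 \<le> t" "t \<le> B1 * (norm T)\<^sup>2"
      using frame_hs_image[OF f1, of T] by blast
    have "(\<lambda>i. q (hs_apply T (\<psi>1 i))) summable_on UNIV"
      by (rule summable_on_comparison_test[OF has_sum_imp_summable[OF has_sum_cmult_right[OF t(1), of B2]]])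
         (rule q(3), rule has_sum_nonneg[OF q(1)], simp)
    then obtain s where s: "((\<lambda>i. q (hs_apply T (\<psi>1 i))) has_sum s) UNIV" unfolding summable_on_def by blast
    have qi: "((\<lambda>k. (cmod (cinner T (tensor_family \<psi>1 \<psi>2 (i, k))))\<^sup>2) has_sum q (hs_apply T (\<psi>1 i))) UNIV" for i
      using q(1)[of "hs_apply T (\<psi>1 i)"] by (simp add: tensor_family_def cinner_hs_elementary_tensor)
    \<comment> \<open>Nonnegative terms with a convergent iterated sum are jointly summable, so the
      sum over pairs equals \<open>s\<close>.\<close>
    have "(\<lambda>x. (cmod (cinner T (tensor_family \<psi>1 \<psi>2 x)))\<^sup>2) summable_on UNIV \<times> UNIV"
      by (rule summable_on_SigmaI[OF qi has_sum_imp_summable[OF s]]) simp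
    from has_sum_SigmaI[OF qi s this]
    have "((\<lambda>x. (cmod (cinner T (tensor_family \<psi>1 \<psi>2 x)))\<^sup>2) has_sum s) UNIV" by simp
    moreover have "A2 * t \<le> s" "s \<le> B2 * t"
      using has_sum_mono[OF has_sum_cmult_right[OF t(1), of A2] s] has_sum_mono[OF s has_sum_cmult_right[OF t(1), of B2]] q
      by blast+
    moreover have "A2 * A1 * (norm T)\<^sup>2 \<le> A2 * t" "B2 * t \<le> B2 * B1 * (norm T)\<^sup>2"
      using t AB1 AB2 by (simp_all add: mult.assoc)
    ultimately show ?thesis by (meson order_trans)
  qed
  then show ?thesis
    unfolding is_frame_iff using AB1 AB2
    by - (rule exI[of _ "A2 * A1"], simp, rule exI[of _ "B2 * B1"], simp)
qed

theorem proposition5p1: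
  fixes \<A>1 :: "'i::countable mat set" and nrm1 :: "'i mat \<Rightarrow> real"
    and \<A>2 :: "'k::countable mat set" and nrm2 :: "'k mat \<Rightarrow> real"
    and \<psi>1 :: "'i \<Rightarrow> 'a::chilbert_space"
    and \<psi>2 :: "'k \<Rightarrow> 'b::chilbert_space"
  assumes "separable_space (euclidean :: 'a topology)"
    and "separable_space (euclidean :: 'b topology)"
    and "solid_spectral_matrix_algebra \<A>1 nrm1"
    and "solid_spectral_matrix_algebra \<A>2 nrm2"
    and "tensor_inverse_closed (tilde1 \<A>1 nrm1 :: ('i, 'k) tensor4 set)"
    and "tensor_inverse_closed (tilde2 \<A>2 nrm2 :: ('i, 'k) tensor4 set)"
    and "is_frame \<psi>1" and "self_localised \<A>1 nrm1 \<psi>1"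
    and "is_frame \<psi>2" and "self_localised \<A>2 nrm2 \<psi>2"
  shows "is_frame (tensor_family \<psi>1 \<psi>2) \<and>
    tensor_self_localised (tensor_algebra \<A>1 nrm1 \<A>2 nrm2)
      (tensor_algebra_norm \<A>1 nrm1 \<A>2 nrm2) (tensor_family \<psi>1 \<psi>2)"
proof
  show "is_frame (tensor_family \<psi>1 \<psi>2)"
    using assms(7,9) by (rule is_frame_tensor_family)
  interpret A1: solid_spectral_matrix_algebra \<A>1 nrm1 by fact
  interpret A2: solid_spectral_matrix_algebra \<A>2 nrm2 by fact
  have "tensor_inverse_closed (tensor_algebra \<A>1 nrm1 \<A>2 nrm2 :: ('i, 'k) tensor4 set)"
    unfolding tensor_algebra_def by (rule tensor_inverse_closed_Int) fact+
  \<comment> \<open>Boundedness comes from the first of the two spaces, through the matrix over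
    pairs.\<close>
  moreover have "tensor_bounded A" if "A \<in> tensor_algebra \<A>1 nrm1 \<A>2 nrm2" for A :: "('i, 'k) tensor4"
    using that unfolding tensor_algebra_def by (blast intro: tensor_bounded_flatten A1.tilde1_flatten)
  moreover have "gram_tensor (tensor_family \<psi>1 \<psi>2) \<in> tensor_algebra \<A>1 nrm1 \<A>2 nrm2"
    using assms(8,10) by (intro gram_tensor_mem assms(3,4)) (simp_all add: self_localised_def)
  ultimately show "tensor_self_localised (tensor_algebra \<A>1 nrm1 \<A>2 nrm2)
      (tensor_algebra_norm \<A>1 nrm1 \<A>2 nrm2) (tensor_family \<psi>1 \<psi>2)"
    unfolding tensor_self_localised_def using tensor_algebra_banach[OF assms(3,4)] by blast
qed

end
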